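(* Let $M^n$ be a Riemannian manifold of bounded geometry whose volume growth function $Vol(r)=\sup\{vol(B_x(r)): x\in M^n\}$ satisfies $$\lim_{r\to\infty}\frac{Vol(r)}{r^{k+1}}=0\quad\text{for some } k\in\mathbb N.$$ Then $\operatorname{asdim} M^n\le k$.
   Context: $M^n$ is an $n$-dimensional Riemannian manifold, regarded as a metric space with its Riemannian distance; $B_x(r)$ is the ball of radius $r$ centered at $x$ and $vol$ is the Riemannian volume. $M^n$ is of bounded geometry if there are $a>0$, $b>1$ such that for any open ball of radius $a$ in $M^n$ there is a $b$-bilipschitz map from it to a Euclidean open ball of radius $1$ (in $\mathbb R^n$). A map $f:X\to Y$ is $b$-bilipschitz if it is onto and $\frac1b d(x,y)\le d(f(x),f(y))\le b\,d(x,y)$ for all $x,y\in X$. The asymptotic dimension $\operatorname{asdim} X$ of a metric space $X$ is defined as follows: $\operatorname{asdim} X\le n$ if and only if for every $m>0$ there exist $D(m)>0$ and a covering $\mathcal U$ of $X$ by sets of diameter $\le D(m)$ such that any ball of radius $m$ in $X$ intersects at most $n+1$ elements of $\mathcal U$. *)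

theory Defs
  imports "HOL-Analysis.Analysis" "HOL-Library.Extended_Nat"
begin

section \<open>Metric notions\<close>

text \<open>A metric space is given by a carrier and a distance that is meaningful on the carrier only.\<close>

definition open_ball :: "'a set \<Rightarrow> ('a \<Rightarrow> 'a \<Rightarrow> real) \<Rightarrow> 'a \<Rightarrow> real \<Rightarrow> 'a set" where
  "open_ball X d x r = {y \<in> X. d x y < r}"

definition bilipschitz ::
  "real \<Rightarrow> 'a set \<Rightarrow> ('a \<Rightarrow> 'a \<Rightarrow> real) \<Rightarrow> 'b set \<Rightarrow> ('b \<Rightarrow> 'b \<Rightarrow> real) \<Rightarrow> ('a \<Rightarrow> 'b) \<Rightarrow> bool" where
  "bilipschitz b X d Y e f \<longleftrightarrow>
     f ` X = Y \<and>
     (\<forall>x\<in>X. \<forall>y\<in>X. 1 / b * d x y \<le> e (f x) (f y) \<and> e (f x) (f y) \<le> b * d x y)"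

definition asdim_at_most :: "'a set \<Rightarrow> ('a \<Rightarrow> 'a \<Rightarrow> real) \<Rightarrow> nat \<Rightarrow> bool" where
  "asdim_at_most X d n \<longleftrightarrow>
     (\<forall>m>0. \<exists>D>0. \<exists>\<U>. \<Union>\<U> = X \<and>
        (\<forall>U\<in>\<U>. \<forall>x\<in>U. \<forall>y\<in>U. d x y \<le> D) \<and>
        (\<forall>x\<in>X. finite {U \<in> \<U>. U \<inter> open_ball X d x m \<noteq> {}} \<and>
               card {U \<in> \<U>. U \<inter> open_ball X d x m \<noteq> {}} \<le> n + 1))"

definition asdim :: "'a set \<Rightarrow> ('a \<Rightarrow> 'a \<Rightarrow> real) \<Rightarrow> enat" where
  "asdim X d = Inf {enat n | n. asdim_at_most X d n}"

lemma asdim_at_most_mono: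
  assumes "asdim_at_most X d n" "n \<le> k"
  shows "asdim_at_most X d k"
proof -
  have "n + 1 \<le> k + 1" using assms(2) by simp
  then show ?thesis
    using assms(1) unfolding asdim_at_most_def by (meson le_trans)
qed

lemma asdim_le_iff: "asdim X d \<le> enat n \<longleftrightarrow> asdim_at_most X d n"
proof
  assume le: "asdim X d \<le> enat n"
  then have ne: "{enat k | k. asdim_at_most X d k} \<noteq> {}"
    unfolding asdim_def by (metis Inf_enat_def infinity_ileE)
  then obtain z where "z \<in> {enat k | k. asdim_at_most X d k}" by blast
  then have "asdim X d \<in> {enat k | k. asdim_at_most X d k}"
    using ne LeastI[of "\<lambda>z. z \<in> {enat k | k. asdim_at_most X d k}" z]
    by (simp only: asdim_def Inf_enat_def if_False)
  then show "asdim_at_most X d n"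
    using le asdim_at_most_mono by auto
next
  assume "asdim_at_most X d n"
  then show "asdim X d \<le> enat n"
    unfolding asdim_def by (intro Inf_lower) auto
qed

section \<open>Riemannian manifolds\<close>

text \<open>Smoothness on an open subset of a finite-dimensional space; on a set that is not open the
  Frechet derivative used here need not be determined.\<close>

primrec Ck_on :: "nat \<Rightarrow> 'a::euclidean_space set \<Rightarrow> ('a \<Rightarrow> 'b::real_normed_vector) \<Rightarrow> bool" where
  "Ck_on 0 S f \<longleftrightarrow> continuous_on S f"
| "Ck_on (Suc k) S f \<longleftrightarrow>
     f differentiable_on S \<and> (\<forall>v. Ck_on k S (\<lambda>x. frechet_derivative f (at x) v))"

definition smooth_on :: "'a::euclidean_space set \<Rightarrow> ('a \<Rightarrow> 'b::real_normed_vector) \<Rightarrow> bool" where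
  "smooth_on S f \<longleftrightarrow> (\<forall>k. Ck_on k S f)"

text \<open>A chart is its domain together with its coordinate map, whose values outside the domain are
  irrelevant.  The metric tensor is given by its Gram matrix in every chart of the atlas, as a
  function on the chart domain.\<close>

type_synonym ('a, 'n) chart = "'a set \<times> ('a \<Rightarrow> real ^ 'n)"

record ('a, 'n) riemannian =
  mtop :: "'a topology"
  charts :: "('a, 'n::finite) chart set"
  gram :: "('a, 'n) chart \<Rightarrow> 'a \<Rightarrow> real ^ 'n ^ 'n"

abbreviation points :: "('a, 'n::finite) riemannian \<Rightarrow> 'a set" where
  "points M \<equiv> topspace (mtop M)"

definition chart_inv :: "('a, 'n::finite) chart \<Rightarrow> real ^ 'n \<Rightarrow> 'a" where
  "chart_inv c = inv_into (fst c) (snd c)"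

text \<open>Connectedness is required so that the Riemannian distance is finite.\<close>

definition riemannian_manifold :: "('a, 'n::finite) riemannian \<Rightarrow> bool" where
  "riemannian_manifold M \<longleftrightarrow>
     Hausdorff_space (mtop M) \<and> second_countable (mtop M) \<and> connected_space (mtop M) \<and>
     (\<Union>(U, \<phi>)\<in>charts M. U) = points M \<and>
     (\<forall>(U, \<phi>)\<in>charts M. openin (mtop M) U \<and> open (\<phi> ` U) \<and>
        homeomorphic_map (subtopology (mtop M) U) (top_of_set (\<phi> ` U)) \<phi>) \<and>
     (\<forall>c\<in>charts M. \<forall>c'\<in>charts M.
        smooth_on (snd c ` (fst c \<inter> fst c')) (snd c' \<circ> chart_inv c)) \<and>
     (\<forall>c\<in>charts M. smooth_on (snd c ` fst c) (gram M c \<circ> chart_inv c)) \<and>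
     (\<forall>c\<in>charts M. \<forall>x\<in>fst c. transpose (gram M c x) = gram M c x \<and>
        (\<forall>v. v \<noteq> 0 \<longrightarrow> v \<bullet> (gram M c x *v v) > 0)) \<and>
     (\<forall>c\<in>charts M. \<forall>c'\<in>charts M. \<forall>x\<in>fst c \<inter> fst c'. \<forall>v w.
        (let J = frechet_derivative (snd c' \<circ> chart_inv c) (at (snd c x))
         in v \<bullet> (gram M c x *v w) = J v \<bullet> (gram M c' x *v J w)))"

section \<open>Riemannian distance\<close>

text \<open>One-sided derivatives are taken at the endpoints of the interval.\<close>

definition C1_curve_on :: "('a, 'n::finite) riemannian \<Rightarrow> real \<Rightarrow> real \<Rightarrow> (real \<Rightarrow> 'a) \<Rightarrow> bool" where
  "C1_curve_on M s t \<gamma> \<longleftrightarrow>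
     (\<forall>(U, \<phi>)\<in>charts M. \<exists>D. continuous_on {\<tau>\<in>{s..t}. \<gamma> \<tau> \<in> U} D \<and>
        (\<forall>\<tau>\<in>{s..t}. \<gamma> \<tau> \<in> U \<longrightarrow> (\<phi> \<circ> \<gamma> has_vector_derivative D \<tau>) (at \<tau> within {s..t})))"

definition piecewise_C1_curve :: "('a, 'n::finite) riemannian \<Rightarrow> (real \<Rightarrow> 'a) \<Rightarrow> bool" where
  "piecewise_C1_curve M \<gamma> \<longleftrightarrow>
     continuous_map (top_of_set {0..1}) (mtop M) \<gamma> \<and>
     (\<exists>S. finite S \<and> {0, 1} \<subseteq> S \<and> S \<subseteq> {0..1} \<and>
        (\<forall>s\<in>S. \<forall>t\<in>S. s < t \<and> {s<..<t} \<inter> S = {} \<longrightarrow> C1_curve_on M s t \<gamma>))"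

text \<open>By the transformation law of the Gram matrices the speed does not depend on the chart that is
  chosen at the given point.\<close>

definition speed :: "('a, 'n::finite) riemannian \<Rightarrow> (real \<Rightarrow> 'a) \<Rightarrow> real \<Rightarrow> real" where
  "speed M \<gamma> t =
     (let c = (SOME c. c \<in> charts M \<and> \<gamma> t \<in> fst c);
          v = vector_derivative (snd c \<circ> \<gamma>) (at t)
      in sqrt (v \<bullet> (gram M c (\<gamma> t) *v v)))"

definition curve_length :: "('a, 'n::finite) riemannian \<Rightarrow> (real \<Rightarrow> 'a) \<Rightarrow> real" where
  "curve_length M \<gamma> = integral {0..1} (speed M \<gamma>)"

definition rdist :: "('a, 'n::finite) riemannian \<Rightarrow> 'a \<Rightarrow> 'a \<Rightarrow> real" where
  "rdist M x y = Inf {curve_length M \<gamma> | \<gamma>. piecewise_C1_curve M \<gamma> \<and> \<gamma> 0 = x \<and> \<gamma> 1 = y}"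

abbreviation rball :: "('a, 'n::finite) riemannian \<Rightarrow> 'a \<Rightarrow> real \<Rightarrow> 'a set" where
  "rball M \<equiv> open_ball (points M) (rdist M)"

section \<open>Riemannian volume\<close>

text \<open>The unique Borel measure that is given by \<open>sqrt (det g) dx\<close> in every chart.\<close>

definition is_rvol :: "('a, 'n::finite) riemannian \<Rightarrow> 'a measure \<Rightarrow> bool" where
  "is_rvol M \<mu> \<longleftrightarrow>
     sets \<mu> = sigma_sets (points M) {U. openin (mtop M) U} \<and>
     (\<forall>c\<in>charts M. \<forall>B\<in>sets \<mu>. B \<subseteq> fst c \<longrightarrow>
        emeasure \<mu> B =
          (\<integral>\<^sup>+ y \<in> snd c ` B. ennreal (sqrt (det (gram M c (chart_inv c y)))) \<partial>lborel))"

definition rvol :: "('a, 'n::finite) riemannian \<Rightarrow> 'a measure" where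
  "rvol M = (THE \<mu>. is_rvol M \<mu>)"

definition volume_growth :: "('a, 'n::finite) riemannian \<Rightarrow> real \<Rightarrow> ennreal" where
  "volume_growth M r = (SUP x\<in>points M. emeasure (rvol M) (rball M x r))"

section \<open>Bounded geometry\<close>

definition bounded_geometry :: "('a, 'n::finite) riemannian \<Rightarrow> bool" where
  "bounded_geometry M \<longleftrightarrow>
     (\<exists>a>0. \<exists>b>1. \<forall>x\<in>points M. \<exists>f :: 'a \<Rightarrow> real ^ 'n. \<exists>z.
        bilipschitz b (rball M x a) (rdist M) (ball z 1) dist f)"

end

theory Submission
  imports Defs
begin

text \<open>Passing to a maximal separated net reduces the theorem to a discrete statement: bounded
  geometry bounds the volume of balls of a fixed radius from below, so the net has at most
  \<open>o(r\<^sup>k\<^sup>+\<^sup>1)\<close> points in a ball of radius \<open>r\<close>.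

  For finite sets one inducts on the exponent.  Let \<open>F\<close> have at most \<open>\<epsilon> r\<^sup>n\<^sup>+\<^sup>1\<close> points in each ball of
  radius \<open>r\<close>, and choose \<open>S \<subseteq> F\<close> of minimal cardinality such that the components of \<open>F - S\<close> at
  scale \<open>m\<close> have diameter at most \<open>2r\<close>.  Replacing the part of \<open>S\<close> in a ball of radius \<open>t \<le> r\<close> by an
  annulus of thickness \<open>m\<close> yields another such set, and some annulus with \<open>r/2 \<le> t \<le> r\<close> has
  \<open>O(m \<epsilon> r\<^sup>n)\<close> points.  So \<open>S\<close> satisfies the hypothesis with exponent \<open>n\<close>, and the components of
  \<open>F - S\<close> add at most one to the multiplicity of the partition of \<open>S\<close>.  Compactness extends this
  from the finite subsets to the whole net.

  The lower volume bound only uses straight segments in charts: near a point \<open>p\<close> the Riemannian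
  distance is at most twice the one given by the Gram matrix at \<open>p\<close>, so ellipsoids in a chart map
  into small balls of the Euclidean target, and such balls fill the target up to a null set.\<close>

section \<open>Sparse sets in pseudometric spaces\<close>

text \<open>The multiplicity k+1 of the covering is the exponent k+1 of the growth bound. Each cut
  lowers the exponent by one at the price of one more class, and the descent stops at exponent 0:
  there a ball may hold at most half a point although it contains its centre, so nothing is left.
  The growth bound is applied at one large radius r. Every cut halves this radius, and the factors
  lost on the way are absorbed by a small \<epsilon> chosen in advance, independently of the set.
  Minimal cardinality forces the sets to be finite; the diameter bound 2r is the same for all of
  them, and this uniformity is what compactness turns into a partition of the whole net. On the
  geometric side, all estimates of the Riemannian distance are upper bounds by explicit curves. They
  yield a pseudometric whose balls are open in the manifold topology. The volume bound compares
  balls of the Euclidean target with ellipsoids in charts of the manifold, so that every set whose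
  volume is taken is Borel by construction.\<close>

locale pseudometric =
  fixes X :: "'a set" and d :: "'a \<Rightarrow> 'a \<Rightarrow> real"
  assumes nonneg: "x \<in> X \<Longrightarrow> y \<in> X \<Longrightarrow> 0 \<le> d x y"
    and refl: "x \<in> X \<Longrightarrow> d x x = 0"
    and sym: "x \<in> X \<Longrightarrow> y \<in> X \<Longrightarrow> d x y = d y x"
    and tri: "x \<in> X \<Longrightarrow> y \<in> X \<Longrightarrow> z \<in> X \<Longrightarrow> d x z \<le> d x y + d y z"

text \<open>The bound on \<open>card A\<close> says nothing about infinite \<open>A\<close>; these are excluded by the finiteness
  of balls.\<close>

definition bounded_partition ::
  "('a \<Rightarrow> 'a \<Rightarrow> real) \<Rightarrow> real \<Rightarrow> real \<Rightarrow> nat \<Rightarrow> 'a set \<Rightarrow> ('a \<Rightarrow> 'a \<Rightarrow> bool) \<Rightarrow> bool" where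
  "bounded_partition d m D n F E \<longleftrightarrow>
     (\<forall>x\<in>F. E x x) \<and> (\<forall>x\<in>F. \<forall>y\<in>F. E x y \<longrightarrow> E y x) \<and>
     (\<forall>x\<in>F. \<forall>y\<in>F. \<forall>z\<in>F. E x y \<longrightarrow> E y z \<longrightarrow> E x z) \<and>
     (\<forall>x\<in>F. \<forall>y\<in>F. E x y \<longrightarrow> d x y \<le> D) \<and>
     (\<forall>A\<subseteq>F. (\<forall>x\<in>A. \<forall>y\<in>A. d x y \<le> m) \<longrightarrow> (\<forall>x\<in>A. \<forall>y\<in>A. x \<noteq> y \<longrightarrow> \<not> E x y) \<longrightarrow> card A \<le> n)"

section \<open>Cutting a finite set into components of bounded diameter\<close>

definition link :: "('a \<Rightarrow> 'a \<Rightarrow> real) \<Rightarrow> real \<Rightarrow> 'a set \<Rightarrow> ('a \<times> 'a) set" where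
  "link d m A = {(u, v). u \<in> A \<and> v \<in> A \<and> d u v \<le> m}"

definition cuts :: "('a \<Rightarrow> 'a \<Rightarrow> real) \<Rightarrow> real \<Rightarrow> real \<Rightarrow> 'a set \<Rightarrow> 'a set \<Rightarrow> bool" where
  "cuts d m D F S \<longleftrightarrow> S \<subseteq> F \<and> (\<forall>x\<in>F - S. \<forall>y. (x, y) \<in> (link d m (F - S))\<^sup>* \<longrightarrow> d x y \<le> D)"

text \<open>The closure is reflexive at all points, also at those outside A; membership of one end
  has to be assumed.\<close>

lemma link_rtrancl_in: "(x, y) \<in> (link d m A)\<^sup>* \<Longrightarrow> x \<in> A \<Longrightarrow> y \<in> A"
  by (induction rule: rtrancl_induct) (auto simp: link_def)

lemma (in pseudometric) link_rtrancl_sym: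
  assumes "A \<subseteq> X" "(x, y) \<in> (link d m A)\<^sup>*" shows "(y, x) \<in> (link d m A)\<^sup>*"
proof -
  have "sym (link d m A)"
    using assms(1) by (auto simp: sym_def link_def subset_iff sym)
  then show ?thesis using assms(2) by (meson sym_rtrancl symD)
qed

text \<open>A step of length at most m cannot jump over an annulus of thickness m. A chain that
  avoids the new set therefore stays inside the ball, whose diameter is at most 2t, or stays outside
  it, where the new set contains S and the old bound applies.\<close>

lemma (in pseudometric) cuts_annulus:
  assumes FX: "F \<subseteq> X" and S: "cuts d m D F S" and x: "x \<in> X" and t: "2 * t \<le> D"
  shows "cuts d m D F (S - {y. d x y \<le> t} \<union> {y \<in> F. t < d x y \<and> d x y \<le> t + m})"
proof -
  let ?S = "S - {y. d x y \<le> t} \<union> {y \<in> F. t < d x y \<and> d x y \<le> t + m}"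
  have SF: "S \<subseteq> F" using S by (simp add: cuts_def)
  \<comment> \<open>A step out of the ball ends at distance at most t + m, hence in the annulus,
    which belongs to the removed set.\<close>
  have stay: "d x v \<le> t" if "(u, v) \<in> link d m (F - ?S)" "d x u \<le> t" for u v
  proof -
    have uv: "u \<in> F" "v \<in> F" "d u v \<le> m" "v \<notin> ?S" using that by (auto simp: link_def)
    have "d x v \<le> d x u + d u v" using uv FX x by (intro tri) auto
    then show ?thesis using uv that(2) by (cases "d x v \<le> t") auto
  qed
  have D: "d u v \<le> D" if "u \<in> F - ?S" and uv: "(u, v) \<in> (link d m (F - ?S))\<^sup>*" for u v
  proof (cases "d x u \<le> t")
    case True
    have "d x v \<le> t" using uv
      by (induction rule: rtrancl_induct) (use True stay in auto)
    moreover have "u \<in> X" "v \<in> X" using link_rtrancl_in[OF uv that(1)] that(1) FX by auto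
    moreover have "d u v \<le> d u x + d x v" using calculation x by (intro tri) auto
    ultimately show ?thesis using True t sym[of u x] x by linarith
  next
    case False
    have "(u, v) \<in> (link d m (F - S))\<^sup>* \<and> \<not> d x v \<le> t" using uv
    proof (induction rule: rtrancl_induct)
      case base then show ?case using False by simp
    next
      case (step y z)
      have "y \<in> F - ?S" "z \<in> F - ?S" "d y z \<le> m" using step(2) by (simp_all add: link_def)
      \<comment> \<open>The edge is reversed: if z were in the ball, then so would be y, by
        \<open>stay\<close>.\<close>
      moreover have "d z y \<le> m" using calculation sym[of z y] subsetD[OF FX, of y] subsetD[OF FX, of z] by simp
      ultimately have "(z, y) \<in> link d m (F - ?S)" by (simp add: link_def)
      then have z: "\<not> d x z \<le> t" using step.IH stay[of z y] by blast
      then have "(y, z) \<in> link d m (F - S)"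
        using step(2) step.IH by (auto simp: link_def)
      with step.IH z show ?case by (meson rtrancl.rtrancl_into_rtrancl)
    qed
    moreover have "u \<in> F - S" using that(1) False by auto
    ultimately show ?thesis using S by (auto simp: cuts_def)
  qed
  then show ?thesis unfolding cuts_def using SF by blast
qed

text \<open>By minimality, the part of S in a ball is no larger than any annulus that could replace
  it. About r / (2m) disjoint annuli fit between the radii r/2 and r and share at most C points, so
  one of them is small.\<close>

lemma (in pseudometric) minimal_cut_growth:
  assumes fin: "finite F" and FX: "F \<subseteq> X" and m: "0 < m" and r: "2 * m \<le> r"
    and growth: "\<And>x. x \<in> F \<Longrightarrow> real (card {y \<in> F. d x y \<le> r}) \<le> C"
    and S: "cuts d m (2 * r) F S" and min: "\<And>T. cuts d m (2 * r) F T \<Longrightarrow> card S \<le> card T"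
    and x: "x \<in> F"
  shows "real (card {y \<in> S. d x y \<le> r / 2}) \<le> 4 * m * C / r"
proof -
  define K where "K = nat \<lfloor>r / (2 * m)\<rfloor>"
  have r0: "0 < r" using m r by linarith
  have K1: "real K \<le> r / (2 * m)" "r / (2 * m) < real K + 1"
  proof -
    have "0 \<le> r / (2 * m)" using r0 m by simp
    then have "real K = of_int \<lfloor>r / (2 * m)\<rfloor>" unfolding K_def by simp
    then show "real K \<le> r / (2 * m)" "r / (2 * m) < real K + 1" by linarith+
  qed
  have "1 \<le> r / (2 * m)" using r m by (simp add: field_simps)
  then have "1 \<le> K" unfolding K_def by (simp add: le_nat_iff)
  \<comment> \<open>Rounding down costs at most a factor 2, since K + 1 \<le> 2K.\<close>
  have K2: "r / (4 * m) \<le> real K"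
  proof -
    have "r / (4 * m) = r / (2 * m) / 2" using m by simp
    moreover have "1 \<le> real K" using \<open>1 \<le> K\<close> by simp
    ultimately show ?thesis using K1 by linarith
  qed
  have K3: "real K * m \<le> r / 2" using K1(1) m by (simp add: field_simps)
  \<comment> \<open>Open below and closed above: neighbouring annuli are disjoint and each has the
    full thickness m that \<open>cuts_annulus\<close> asks for.\<close>
  define A where "A j = {y \<in> F. r / 2 + real j * m < d x y \<and> d x y \<le> r / 2 + real j * m + m}" for j
  have disj: "disjoint_family_on A {..<K}"
  proof -
    have "A i \<inter> A j = {}" if "i < j" for i j
    proof -
      have "real i * m + m \<le> real j * m" using mult_right_mono[of "real i + 1" "real j" m] that m
        by (simp add: algebra_simps)
      then show ?thesis by (auto simp: A_def)
    qed
    then show ?thesis unfolding disjoint_family_on_def by (metis Int_commute nat_neq_iff)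
  qed
  have sub: "(\<Union>j<K. A j) \<subseteq> {y \<in> F. d x y \<le> r}"
  proof -
    have "real j * m + m \<le> r / 2" if "j < K" for j
    proof -
      have "(real j + 1) * m \<le> real K * m" using that m by (intro mult_right_mono) auto
      then show ?thesis using K3 by (simp add: algebra_simps)
    qed
    then have "A j \<subseteq> {y \<in> F. d x y \<le> r}" if "j < K" for j using that by (force simp: A_def)
    then show ?thesis by blast
  qed
  have "real (\<Sum>j<K. card (A j)) = card (\<Union>j<K. A j)"
    using disj fin by (subst card_UN_disjoint) (auto simp: A_def disjoint_family_on_def)
  also have "\<dots> \<le> card {y \<in> F. d x y \<le> r}" using sub fin by (intro of_nat_mono card_mono) auto
  also have "\<dots> \<le> C" by (rule growth[OF x])
  finally have sumC: "(\<Sum>j<K. real (card (A j))) \<le> C" by simp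
  \<comment> \<open>Pigeonhole: if every annulus had more than C / K points, their sum would exceed
    C.\<close>
  obtain j where j: "j < K" "real K * card (A j) \<le> C"
  proof (rule ccontr)
    assume "\<not> thesis"
    with that have "C < real K * real (card (A j))" if "j < K" for j
      using \<open>j < K\<close> not_le by blast
    then have "(\<Sum>j<K. C) < (\<Sum>j<K. real K * real (card (A j)))"
      using \<open>1 \<le> K\<close> by (intro sum_strict_mono) (auto simp: lessThan_empty_iff)
    then have "real K * C < real K * (\<Sum>j<K. real (card (A j)))" unfolding sum_distrib_left by simp
    moreover have "real K * (\<Sum>j<K. real (card (A j))) \<le> real K * C" using sumC by (intro mult_left_mono) auto
    ultimately show False by linarith
  qed
  define t where "t = r / 2 + real j * m"
  have "real j * m \<le> real K * m" using j m by (intro mult_right_mono) auto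
  then have t: "r / 2 \<le> t" "t \<le> r" using m K3 mult_nonneg_nonneg[of "real j" m] unfolding t_def by linarith+
  have SF: "S \<subseteq> F" using S by (simp add: cuts_def)
  have finS: "finite S" using SF fin finite_subset by blast
  \<comment> \<open>As t \<le> r, the ball has diameter at most 2r, the bound prescribed for the
    components.\<close>
  have "cuts d m (2 * r) F (S - {y. d x y \<le> t} \<union> A j)"
    unfolding A_def t_def[symmetric] by (rule cuts_annulus[OF FX S]) (use x FX t in auto)
  from min[OF this] have "card S \<le> card (S - {y. d x y \<le> t} \<union> A j)" .
  also have "\<dots> \<le> card (S - {y. d x y \<le> t}) + card (A j)" by (rule card_Un_le)
  also have "card (S - {y. d x y \<le> t}) = card S - card (S \<inter> {y. d x y \<le> t})"
    using finS by (simp add: card_Diff_subset_Int)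
  finally have "card (S \<inter> {y. d x y \<le> t}) \<le> card (A j)"
    using card_mono[OF finS, of "S \<inter> {y. d x y \<le> t}"] by simp
  moreover have "card {y \<in> S. d x y \<le> r / 2} \<le> card (S \<inter> {y. d x y \<le> t})"
    using finS t by (intro card_mono) auto
  ultimately have "real (card {y \<in> S. d x y \<le> r / 2}) \<le> real (card (A j))" by linarith
  moreover {
    have "r / (4 * m) * card (A j) \<le> C"
    using mult_right_mono[OF K2, of "card (A j)"] j(2) by simp
  then have "real (card (A j)) \<le> 4 * m * C / r" using m r0 by (simp add: field_simps)
  }
  ultimately show ?thesis by linarith
qed

section \<open>Partitions of bounded multiplicity at a fixed scale\<close>

lemma bounded_partitionD:
  assumes "bounded_partition d m D n F E"
  shows "x \<in> F \<Longrightarrow> E x x"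
    and "x \<in> F \<Longrightarrow> y \<in> F \<Longrightarrow> E x y \<Longrightarrow> E y x"
    and "x \<in> F \<Longrightarrow> y \<in> F \<Longrightarrow> z \<in> F \<Longrightarrow> E x y \<Longrightarrow> E y z \<Longrightarrow> E x z"
    and "x \<in> F \<Longrightarrow> y \<in> F \<Longrightarrow> E x y \<Longrightarrow> d x y \<le> D"
    and "A \<subseteq> F \<Longrightarrow> (\<And>x y. x \<in> A \<Longrightarrow> y \<in> A \<Longrightarrow> d x y \<le> m) \<Longrightarrow>
      (\<And>x y. x \<in> A \<Longrightarrow> y \<in> A \<Longrightarrow> x \<noteq> y \<Longrightarrow> \<not> E x y) \<Longrightarrow> card A \<le> n"
  using assms unfolding bounded_partition_def by metis+

lemma bounded_partitionI:
  assumes "\<And>x. x \<in> F \<Longrightarrow> E x x"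
    and "\<And>x y. x \<in> F \<Longrightarrow> y \<in> F \<Longrightarrow> E x y \<Longrightarrow> E y x"
    and "\<And>x y z. x \<in> F \<Longrightarrow> y \<in> F \<Longrightarrow> z \<in> F \<Longrightarrow> E x y \<Longrightarrow> E y z \<Longrightarrow> E x z"
    and "\<And>x y. x \<in> F \<Longrightarrow> y \<in> F \<Longrightarrow> E x y \<Longrightarrow> d x y \<le> D"
    and "\<And>A. A \<subseteq> F \<Longrightarrow> (\<And>x y. x \<in> A \<Longrightarrow> y \<in> A \<Longrightarrow> d x y \<le> m) \<Longrightarrow>
      (\<And>x y. x \<in> A \<Longrightarrow> y \<in> A \<Longrightarrow> x \<noteq> y \<Longrightarrow> \<not> E x y) \<Longrightarrow> card A \<le> n"
  shows "bounded_partition d m D n F E"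
  unfolding bounded_partition_def
  apply (intro conjI ballI allI impI)
  using assms(1) apply blast
  using assms(2) apply blast
  using assms(3) apply blast
  using assms(4) apply blast
  apply (rule assms(5); blast)
  done

lemma bounded_partition_mono:
  assumes E: "bounded_partition d m D n F E" and "D \<le> D'" "G \<subseteq> F"
  shows "bounded_partition d m D' n G E"
proof (rule bounded_partitionI)
  show "card A \<le> n" if "A \<subseteq> G" "\<And>x y. x \<in> A \<Longrightarrow> y \<in> A \<Longrightarrow> d x y \<le> m"
    "\<And>x y. x \<in> A \<Longrightarrow> y \<in> A \<Longrightarrow> x \<noteq> y \<Longrightarrow> \<not> E x y" for A
    by (rule bounded_partitionD(5)[OF E]) (use that assms in auto)
  show "d x y \<le> D'" if "x \<in> G" "y \<in> G" "E x y" for x y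
    using bounded_partitionD(4)[OF E] that assms by fastforce
  show "E x z" if "x \<in> G" "y \<in> G" "z \<in> G" "E x y" "E y z" for x y z
    using bounded_partitionD(3)[OF E _ _ _ that(4,5)] that assms by blast
qed (use bounded_partitionD(1,2)[OF E] assms in blast)+

text \<open>Two points outside S at distance at most m form an edge and so lie in one component.
  Hence a set of pairwise close, pairwise inequivalent points has at most one element outside
  S.\<close>

lemma (in pseudometric) bounded_partition_extend:
  assumes FX: "F \<subseteq> X" and fin: "finite F" and S: "cuts d m D F S"
    and E: "bounded_partition d m D n S E"
  shows "\<exists>E. bounded_partition d m D (Suc n) F E"
proof -
  have SF: "S \<subseteq> F" using S by (simp add: cuts_def)
  let ?R = "(link d m (F - S))\<^sup>*"
  define E' where "E' x y \<longleftrightarrow> x \<in> S \<and> y \<in> S \<and> E x y \<or> x \<in> F - S \<and> y \<in> F - S \<and> (x, y) \<in> ?R" for x y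
  have "bounded_partition d m D (Suc n) F E'"
  proof (rule bounded_partitionI)
    fix A assume A: "A \<subseteq> F" and close: "\<And>x y. x \<in> A \<Longrightarrow> y \<in> A \<Longrightarrow> d x y \<le> m"
      and ne: "\<And>x y. x \<in> A \<Longrightarrow> y \<in> A \<Longrightarrow> x \<noteq> y \<Longrightarrow> \<not> E' x y"
    have "card (A \<inter> S) \<le> n"
      by (rule bounded_partitionD(5)[OF E]) (use close ne E'_def in auto)
    moreover have "x = y" if "x \<in> A - S" "y \<in> A - S" for x y
    proof (rule ccontr)
      assume "x \<noteq> y"
      have "(x, y) \<in> link d m (F - S)" using that A close by (auto simp: link_def)
      then have "E' x y" using that A by (auto simp: E'_def)
      then show False using ne that \<open>x \<noteq> y\<close> by blast
    qed
    then have "card (A - S) \<le> 1"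
      using card_le_Suc0_iff_eq[of "A - S"] finite_subset[OF A fin] by simp
    moreover have "card A = card (A \<inter> S) + card (A - S)"
      using card_Int_Diff[OF finite_subset[OF A fin]] by simp
    ultimately show "card A \<le> Suc n" by simp
  next
    fix x y assume "x \<in> F" "y \<in> F" "E' x y"
    then show "d x y \<le> D" using bounded_partitionD(4)[OF E] S by (auto simp: E'_def cuts_def)
    show "E' y x" using \<open>E' x y\<close> bounded_partitionD(2)[OF E] link_rtrancl_sym[of "F - S" x y m] FX
      by (auto simp: E'_def)
  next
    fix x y z assume "E' x y" "E' y z"
    then show "E' x z" using bounded_partitionD(3)[OF E, of x y z] rtrancl_trans[of x y _ z]
      by (auto simp: E'_def)
  next
    fix x assume "x \<in> F"
    then show "E' x x" using bounded_partitionD(1)[OF E] by (auto simp: E'_def)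
  qed
  then show ?thesis by blast
qed

text \<open>A growth bound at a single radius, for balls centred in F; it passes to subsets.
  Finiteness is explicit because \<open>card\<close> is 0 on infinite sets.\<close>

definition (in pseudometric) thin :: "real \<Rightarrow> real \<Rightarrow> 'a set \<Rightarrow> bool" where
  "thin r C F \<longleftrightarrow> F \<subseteq> X \<and> (\<forall>x\<in>F. finite {y \<in> F. d x y \<le> r} \<and> real (card {y \<in> F. d x y \<le> r}) \<le> C)"

text \<open>The same n is the exponent of the growth and the multiplicity of the partition. That
  \<epsilon> and \<rho> precede r and F in the quantifiers allows the induction to change r and F,
  and compactness to vary F.\<close>

lemma (in pseudometric) finite_bounded_partition:
  assumes m: "0 < m"
  shows "\<exists>\<epsilon>>0. \<exists>\<rho>. \<forall>r\<ge>\<rho>. \<forall>F. finite F \<and> thin r (\<epsilon> * r ^ n) F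
           \<longrightarrow> (\<exists>E. bounded_partition d m (2 * r) n F E)"
proof (induction n)
  case 0
  \<comment> \<open>A ball around a point of F contains that point, so the bound 1/2 leaves only the
    empty set.\<close>
  have "\<exists>E. bounded_partition d m (2 * r) 0 F E" if "0 \<le> r" "thin r (1 / 2 * r ^ 0) F" for r F
  proof -
    have "F = {}"
    proof (rule ccontr)
      assume "F \<noteq> {}"
      then obtain x where x: "x \<in> F" by blast
      then have "{x} \<subseteq> {y \<in> F. d x y \<le> r}" using that refl by (auto simp: thin_def)
      moreover have "finite {y \<in> F. d x y \<le> r}" "real (card {y \<in> F. d x y \<le> r}) \<le> 1 / 2"
        using that(2) x by (auto simp: thin_def)
      ultimately show False using card_mono[of "{y \<in> F. d x y \<le> r}" "{x}"] by simp
    qed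
    then show ?thesis by (simp add: bounded_partition_def)
  qed
  then show ?case by (meson half_gt_zero_iff zero_less_one)
next
  case (Suc n)
  then obtain \<epsilon> \<rho> where \<epsilon>: "\<epsilon> > 0" and IH: "\<And>r F. r \<ge> \<rho> \<Longrightarrow> finite F \<Longrightarrow>
      thin r (\<epsilon> * r ^ n) F \<Longrightarrow> \<exists>E. bounded_partition d m (2 * r) n F E"
    by blast
  \<comment> \<open>Solves 4 m (\<epsilon>' r^(n+1)) / r = \<epsilon> (r/2)^n, which matches the
    bound for S from \<open>minimal_cut_growth\<close> with the hypothesis of the induction at
    radius r/2.\<close>
  define \<epsilon>' where "\<epsilon>' = \<epsilon> / (4 * m * 2 ^ n)"
  have "\<exists>E. bounded_partition d m (2 * r) (Suc n) F E"
    \<comment> \<open>The first bound brings r/2 above \<rho>, the second makes room for at least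
      one annulus.\<close>
    if r: "r \<ge> max (2 * \<rho>) (2 * m)" and F: "finite F" and growth: "thin r (\<epsilon>' * r ^ Suc n) F" for r F
  proof -
    have r0: "0 < r" using r m by linarith
    have FX: "F \<subseteq> X" using growth by (simp add: thin_def)
    \<comment> \<open>The whole set cuts itself, so some minimal cut exists.\<close>
    have "cuts d m (2 * r) F F" by (simp add: cuts_def)
    then obtain S where S: "cuts d m (2 * r) F S" and min: "\<And>T. cuts d m (2 * r) F T \<Longrightarrow> card S \<le> card T"
      using arg_min_nat_lemma[of "cuts d m (2 * r) F" F card] by blast
    have SF: "S \<subseteq> F" using S by (simp add: cuts_def)
    have "real (card {y \<in> S. d x y \<le> r / 2}) \<le> \<epsilon> * (r / 2) ^ n" if "x \<in> S" for x
    proof -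
      have "real (card {y \<in> S. d x y \<le> r / 2}) \<le> 4 * m * (\<epsilon>' * r ^ Suc n) / r"
        by (rule minimal_cut_growth[OF F FX m _ _ S min]) (use r growth that SF thin_def in auto)
      also have "\<dots> = \<epsilon> * (r / 2) ^ n" using m r0 by (simp add: \<epsilon>'_def field_simps)
      finally show ?thesis .
    qed
    then have "thin (r / 2) (\<epsilon> * (r / 2) ^ n) S"
      using SF FX finite_subset[OF SF F] by (auto simp: thin_def)
    then obtain E where "bounded_partition d m (2 * (r / 2)) n S E"
      using IH[of "r / 2" S] r finite_subset[OF SF F] by auto
    then have "bounded_partition d m (2 * r) n S E"
      by (rule bounded_partition_mono) (use r0 in auto)
    then show ?thesis using bounded_partition_extend[OF FX F S] by blast
  qed
  moreover have "\<epsilon>' > 0" using \<epsilon> m by (simp add: \<epsilon>'_def)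
  ultimately show ?case by blast
qed

text \<open>By Tychonoff's theorem, applied to the relations on \<open>N\<close> as points of a power of the
  two-point space.\<close>

lemma bounded_partition_compactness:
  assumes "\<And>F. finite F \<Longrightarrow> F \<subseteq> N \<Longrightarrow> \<exists>E. bounded_partition d m D n F E"
    and "\<And>A. A \<subseteq> N \<Longrightarrow> (\<And>x y. x \<in> A \<Longrightarrow> y \<in> A \<Longrightarrow> d x y \<le> m) \<Longrightarrow> finite A"
  shows "\<exists>E. bounded_partition d m D n N E"
proof -
  let ?T = "product_topology (\<lambda>_. discrete_topology (UNIV :: bool set)) (UNIV :: ('a \<times> 'a) set)"
  define C where "C F = {e. bounded_partition d m D n F (curry e)}" for F
  have cl: "closedin ?T (C F)" if F: "finite F" for F
  proof -
    \<comment> \<open>Membership in \<open>C F\<close> depends on the finitely many coordinates in F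
      \<times> F only. In the product of discrete spaces the complement is then a union of basic
      open sets.\<close>
    have loc: "e \<in> C F \<longleftrightarrow> e' \<in> C F" if "\<forall>p\<in>F \<times> F. e p = e' p" for e e'
    proof -
      have "bounded_partition d m D n F E'" if E: "bounded_partition d m D n F E"
        and eq: "\<And>x y. x \<in> F \<Longrightarrow> y \<in> F \<Longrightarrow> E x y = E' x y" for E E'
      proof (rule bounded_partitionI)
        show "card A \<le> n" if "A \<subseteq> F" "\<And>x y. x \<in> A \<Longrightarrow> y \<in> A \<Longrightarrow> d x y \<le> m"
          "\<And>x y. x \<in> A \<Longrightarrow> y \<in> A \<Longrightarrow> x \<noteq> y \<Longrightarrow> \<not> E' x y" for A
        proof (rule bounded_partitionD(5)[OF E that(1,2)])
          show "\<not> E x y" if "x \<in> A" "y \<in> A" "x \<noteq> y" for x y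
            using \<open>A \<subseteq> F\<close> eq[of x y] that \<open>\<And>x y. x \<in> A \<Longrightarrow> y \<in> A \<Longrightarrow> x \<noteq> y \<Longrightarrow> \<not> E' x y\<close>[of x y] by blast
        qed
        show "E' x z" if "x \<in> F" "y \<in> F" "z \<in> F" "E' x y" "E' y z" for x y z
          using bounded_partitionD(3)[OF E that(1-3)] that eq by simp
      qed (use bounded_partitionD(1,2,4)[OF E] eq in auto)
      then show ?thesis using that unfolding C_def by (simp add: curry_def) (metis (mono_tags, lifting))
    qed
    have "openin ?T (topspace ?T - C F)"
      unfolding openin_product_topology_alt
    proof (intro conjI ballI)
      fix e assume e: "e \<in> topspace ?T - C F"
      let ?U = "\<lambda>p. if p \<in> F \<times> F then {e p} else UNIV"
      have "finite {p. ?U p \<noteq> UNIV}" using F by (rule_tac finite_subset[of _ "F \<times> F"]) auto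
      moreover have "Pi\<^sub>E UNIV ?U \<subseteq> topspace ?T - C F"
      proof
        fix e' assume "e' \<in> Pi\<^sub>E UNIV ?U"
        then have "\<forall>p\<in>F \<times> F. e p = e' p" by (auto simp: PiE_iff split: if_splits)
        then show "e' \<in> topspace ?T - C F" using e loc[of e e'] by simp
      qed
      moreover have "e \<in> Pi\<^sub>E UNIV ?U" by auto
      ultimately show "\<exists>U. finite {i \<in> UNIV. U i \<noteq> topspace (discrete_topology UNIV)} \<and>
        (\<forall>i\<in>UNIV. openin (discrete_topology UNIV) (U i)) \<and> e \<in> Pi\<^sub>E UNIV U \<and>
        Pi\<^sub>E UNIV U \<subseteq> topspace ?T - C F"
        by (intro exI[of _ ?U]) simp
    qed
    then show ?thesis unfolding closedin_def by simp
  qed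
  have "compact_space ?T" by (simp add: compact_space_product_topology compact_space_discrete_topology)
  \<comment> \<open>Finite intersection property: a partition of the union of finitely many finite
    sets restricts to a partition of each of them.\<close>
  moreover have "\<Inter>\<F> \<noteq> {}" if \<F>: "finite \<F>" "\<F> \<subseteq> C ` {F. finite F \<and> F \<subseteq> N}" for \<F>
  proof -
    obtain \<G> where G: "\<G> \<subseteq> {F. finite F \<and> F \<subseteq> N}" "finite \<G>" "\<F> = C ` \<G>"
      using finite_subset_image[OF \<F>] by blast
    then obtain E where E: "bounded_partition d m D n (\<Union>\<G>) E" using assms(1)[of "\<Union>\<G>"] by blast
    have "case_prod E \<in> C F" if "F \<in> \<G>" for F
      using bounded_partition_mono[OF E] that by (auto simp: C_def curry_def)
    then show ?thesis using G by blast
  qed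
  moreover have "\<forall>B\<in>C ` {F. finite F \<and> F \<subseteq> N}. closedin ?T B" using cl by blast
  ultimately have "\<Inter>(C ` {F. finite F \<and> F \<subseteq> N}) \<noteq> {}"
    using iffD1[OF compact_space_fip, of ?T, rule_format, of "C ` {F. finite F \<and> F \<subseteq> N}"] by blast
  then obtain e where e: "\<And>F. finite F \<Longrightarrow> F \<subseteq> N \<Longrightarrow> bounded_partition d m D n F (curry e)"
    unfolding C_def by blast
  have "bounded_partition d m D n N (curry e)"
  proof (rule bounded_partitionI)
    \<comment> \<open>A pairwise close set is finite by assumption and can itself be taken as F. The
      remaining conditions involve at most three points each.\<close>
    show "card A \<le> n" if "A \<subseteq> N" "\<And>x y. x \<in> A \<Longrightarrow> y \<in> A \<Longrightarrow> d x y \<le> m"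
      "\<And>x y. x \<in> A \<Longrightarrow> y \<in> A \<Longrightarrow> x \<noteq> y \<Longrightarrow> \<not> curry e x y" for A
      using bounded_partitionD(5)[OF e order.refl, of A] assms(2)[of A] that by blast
    show "curry e x z" if "x \<in> N" "y \<in> N" "z \<in> N" "curry e x y" "curry e y z" for x y z
      using bounded_partitionD(3)[OF e[of "{x, y, z}"], of x y z] that by simp
    show "curry e y x" if "x \<in> N" "y \<in> N" "curry e x y" for x y
      using bounded_partitionD(2)[OF e[of "{x, y}"], of x y] that by simp
    show "d x y \<le> D" if "x \<in> N" "y \<in> N" "curry e x y" for x y
      using bounded_partitionD(4)[OF e[of "{x, y}"], of x y] that by simp
    show "curry e x x" if "x \<in> N" for x
      using bounded_partitionD(1)[OF e[of "{x}"], of x] that by simp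
  qed
  then show ?thesis by blast
qed

text \<open>The classes of a partition of the net, thickened by s, cover X. Thickening enlarges the
  scale at which the multiplicity must be controlled from m to 2m + 2s.\<close>

lemma (in pseudometric) asdim_at_most_of_net_growth:
  assumes NX: "N \<subseteq> X" and s: "0 \<le> s" and net: "\<And>x. x \<in> X \<Longrightarrow> \<exists>p\<in>N. d x p \<le> s"
    and growth: "\<And>\<epsilon> \<rho>. 0 < \<epsilon> \<Longrightarrow> \<exists>r\<ge>\<rho>. thin r (\<epsilon> * r ^ (k + 1)) N"
  shows "asdim_at_most X d k"
  unfolding asdim_at_most_def
proof (intro allI impI)
  fix m :: real assume m: "0 < m"
  \<comment> \<open>Net points within m + s of a common centre are at mutual distance at most
    m'.\<close>
  define m' where "m' = 2 * m + 2 * s"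
  have m': "0 < m'" using m s by (simp add: m'_def)
  obtain \<epsilon> \<rho> where \<epsilon>: "\<epsilon> > 0" and fin: "\<And>r F. r \<ge> \<rho> \<Longrightarrow> finite F \<Longrightarrow>
      thin r (\<epsilon> * r ^ (k + 1)) F \<Longrightarrow> \<exists>E. bounded_partition d m' (2 * r) (k + 1) F E"
    using finite_bounded_partition[OF m', of "k + 1"] by blast
  \<comment> \<open>With r \<ge> m', a pairwise m'-close subset of the net lies in the r-ball around
    any of its points, which makes it finite.\<close>
  obtain r where r: "r \<ge> max \<rho> m'" and thinN: "thin r (\<epsilon> * r ^ (k + 1)) N" using growth[OF \<epsilon>] by blast
  have ballfin: "finite {y \<in> N. d x y \<le> r}" if "x \<in> N" for x using thinN that by (simp add: thin_def)
  have closefin: "finite A" if A: "A \<subseteq> N" "\<And>x y. x \<in> A \<Longrightarrow> y \<in> A \<Longrightarrow> d x y \<le> m'" for A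
  proof (cases "A = {}")
    case False
    then obtain x where x: "x \<in> A" by blast
    have "d x y \<le> r" if "y \<in> A" for y using A(2)[OF x that] r by simp
    then have "A \<subseteq> {y \<in> N. d x y \<le> r}" using A(1) by blast
    then show ?thesis using ballfin[of x] x A(1) finite_subset by blast
  qed simp
  have "\<exists>E. bounded_partition d m' (2 * r) (k + 1) N E"
  proof (rule bounded_partition_compactness[OF _ closefin])
    fix F assume F: "finite F" "F \<subseteq> N"
    have "thin r (\<epsilon> * r ^ (k + 1)) F" unfolding thin_def
    proof (intro conjI ballI)
      fix x assume "x \<in> F"
      then have x: "x \<in> N" using F by blast
      have sub: "{y \<in> F. d x y \<le> r} \<subseteq> {y \<in> N. d x y \<le> r}" using F by blast
      then show "finite {y \<in> F. d x y \<le> r}" using ballfin[OF x] finite_subset by blast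
      have "real (card {y \<in> N. d x y \<le> r}) \<le> \<epsilon> * r ^ (k + 1)" using thinN x by (simp add: thin_def)
      moreover have "card {y \<in> F. d x y \<le> r} \<le> card {y \<in> N. d x y \<le> r}"
        by (rule card_mono[OF ballfin[OF x] sub])
      ultimately show "real (card {y \<in> F. d x y \<le> r}) \<le> \<epsilon> * r ^ (k + 1)" by linarith
    qed (use F NX in blast)
    then show "\<exists>E. bounded_partition d m' (2 * r) (k + 1) F E" using fin r F by auto
  qed
  then obtain E where E: "bounded_partition d m' (2 * r) (k + 1) N E" by blast
  note E' = bounded_partitionD[OF E]
  \<comment> \<open>Depends only on the class of p; equivalent indices give the same member of the
    cover, which is counted once.\<close>
  define U where "U p = {x \<in> X. \<exists>q\<in>N. E p q \<and> d x q \<le> s}" for p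
  have U_eq: "U p = U q" if "p \<in> N" "q \<in> N" "E p q" for p q
    using E'(2,3) that unfolding U_def by blast
  have cover: "\<Union>(U ` N) = X"
  proof
    show "X \<subseteq> \<Union>(U ` N)"
    proof
      fix x assume x: "x \<in> X"
      obtain p where p: "p \<in> N" "d x p \<le> s" using net[OF x] by blast
      then have "x \<in> U p" using x E'(1) by (auto simp: U_def)
      then show "x \<in> \<Union>(U ` N)" using p by blast
    qed
  qed (auto simp: U_def)
  have diam: "d x y \<le> 2 * r + 2 * s" if pxy: "p \<in> N" "x \<in> U p" "y \<in> U p" for p x y
  proof -
    obtain q q' where q: "q \<in> N" "E p q" "d x q \<le> s" "q' \<in> N" "E p q'" "d y q' \<le> s" "x \<in> X" "y \<in> X"
      using pxy unfolding U_def by blast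
    have "E q q'" using E'(2)[of p q] E'(3)[of q p q'] q that by blast
    then have "d q q' \<le> 2 * r" using E'(4) q by blast
    moreover have "d x y \<le> d x q + d q y" "d q y \<le> d q q' + d q' y" using q NX by (auto intro!: tri)
    moreover have "d q' y = d y q'" using q NX by (auto intro!: sym)
    ultimately show ?thesis using q by linarith
  qed
  have mult: "finite {V \<in> U ` N. V \<inter> open_ball X d x m \<noteq> {}} \<and>
      card {V \<in> U ` N. V \<inter> open_ball X d x m \<noteq> {}} \<le> k + 1" if x: "x \<in> X" for x
  proof -
    define Q where "Q = {q \<in> N. d x q \<le> m + s}"
    have Q: "d p q \<le> m'" if "p \<in> Q" "q \<in> Q" for p q
    proof -
      have "d p q \<le> d p x + d x q" "d p x = d x p" using that NX x by (auto simp: Q_def intro!: tri sym)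
      then show ?thesis using that by (simp add: Q_def m'_def)
    qed
    have "finite Q" by (rule closefin) (auto simp: Q, auto simp: Q_def)
    have "{V \<in> U ` N. V \<inter> open_ball X d x m \<noteq> {}} \<subseteq> U ` Q"
    proof
      fix V assume "V \<in> {V \<in> U ` N. V \<inter> open_ball X d x m \<noteq> {}}"
      then obtain p y q where p: "p \<in> N" "V = U p" "y \<in> X" "d x y < m" "q \<in> N" "E p q" "d y q \<le> s"
        by (auto simp: open_ball_def U_def)
      have "d x q \<le> d x y + d y q" using p NX x by (intro tri) auto
      then have "q \<in> Q" using p by (simp add: Q_def)
      then show "V \<in> U ` Q" using p U_eq by blast
    qed
    \<comment> \<open>One representative for each member of the cover that is hit. Different members
      come from inequivalent points, so the multiplicity of the partition bounds
      \<open>card A\<close>.\<close>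
    then obtain A where A: "A \<subseteq> Q" "inj_on U A" and hit: "{V \<in> U ` N. V \<inter> open_ball X d x m \<noteq> {}} = U ` A"
      unfolding subset_image_inj by blast
    have AN: "A \<subseteq> N" using A(1) by (auto simp: Q_def)
    have "\<not> E p q" if "p \<in> A" "q \<in> A" "p \<noteq> q" for p q
      using U_eq[of p q] A(2) AN that by (auto simp: inj_on_def)
    then have "card A \<le> k + 1" using E'(5)[OF AN] Q A(1) by blast
    then show ?thesis unfolding hit using card_image[OF A(2)] finite_subset[OF A(1) \<open>finite Q\<close>] by simp
  qed
  show "\<exists>D>0. \<exists>\<U>. \<Union>\<U> = X \<and> (\<forall>V\<in>\<U>. \<forall>x\<in>V. \<forall>y\<in>V. d x y \<le> D) \<and>
      (\<forall>x\<in>X. finite {V \<in> \<U>. V \<inter> open_ball X d x m \<noteq> {}} \<and>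
        card {V \<in> \<U>. V \<inter> open_ball X d x m \<noteq> {}} \<le> k + 1)"
    using r m' s by (intro exI[of _ "2 * r + 2 * s"] exI[of _ "U ` N"] conjI cover ballI)
      (linarith, use diam in blast, use mult in blast, use mult in blast)
qed

text \<open>A point farther than s from all of a maximal separated set could be added to it; so
  separation and density hold with the same constant.\<close>

lemma (in pseudometric) ex_maximal_separated:
  assumes s: "0 < s"
  shows "\<exists>N\<subseteq>X. (\<forall>x\<in>N. \<forall>y\<in>N. x \<noteq> y \<longrightarrow> s \<le> d x y) \<and> (\<forall>x\<in>X. \<exists>p\<in>N. d x p \<le> s)"
proof -
  let ?A = "{N. N \<subseteq> X \<and> (\<forall>x\<in>N. \<forall>y\<in>N. x \<noteq> y \<longrightarrow> s \<le> d x y)}"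
  have "\<exists>N\<in>?A. \<forall>N'\<in>?A. N \<subseteq> N' \<longrightarrow> N' = N"
  proof (rule subset_Zorn')
    fix C assume C: "subset.chain ?A C"
    have "s \<le> d x y" if xy: "x \<in> \<Union>C" "y \<in> \<Union>C" "x \<noteq> y" for x y
    proof -
      obtain N where N: "N \<in> C" "x \<in> N" using xy(1) by (rule UnionE)
      obtain N' where N': "N' \<in> C" "y \<in> N'" using xy(2) by (rule UnionE)
      have CA: "P \<in> ?A" if "P \<in> C" for P using C that unfolding subset.chain_def by (rule_tac subsetD[of C]) simp_all
      have "N \<subseteq> N' \<or> N' \<subseteq> N" using subset.chain_total[OF C N(1) N'(1)] by auto
      then show ?thesis
      proof
        assume "N \<subseteq> N'"
        then show ?thesis using CA[OF N'(1)] N N' xy(3) by (simp add: subset_iff)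
      next
        assume "N' \<subseteq> N"
        then show ?thesis using CA[OF N(1)] N N' xy(3) by (simp add: subset_iff)
      qed
    qed
    moreover have "\<Union>C \<subseteq> X" using C unfolding subset.chain_def by (simp add: subset_iff) blast
    ultimately show "\<Union>C \<in> ?A" by simp
  qed
  then obtain N where N: "N \<subseteq> X" "\<forall>x\<in>N. \<forall>y\<in>N. x \<noteq> y \<longrightarrow> s \<le> d x y"
    and max: "\<And>N'. N' \<subseteq> X \<Longrightarrow> (\<forall>x\<in>N'. \<forall>y\<in>N'. x \<noteq> y \<longrightarrow> s \<le> d x y) \<Longrightarrow> N \<subseteq> N' \<Longrightarrow> N' = N"
    by auto
  have "\<exists>p\<in>N. d x p \<le> s" if x: "x \<in> X" for x
  proof (rule ccontr)
    assume far: "\<not> (\<exists>p\<in>N. d x p \<le> s)"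
    have "s \<le> d u v" if "u \<in> insert x N" "v \<in> insert x N" "u \<noteq> v" for u v
      using that far N x sym[of u v] by (auto simp: not_le less_imp_le subset_iff)
    then have "insert x N = N" using N(1) x by (intro max) auto
    then have "x \<in> N" by blast
    then show False using far refl[OF x] s by force
  qed
  then show ?thesis using N by blast
qed

lemma asdim_at_most_empty: "asdim_at_most {} d k"
  unfolding asdim_at_most_def by (auto intro!: exI[of _ 1] exI[of _ "{}"])

section \<open>Change of variables\<close>

text \<open>The change of variables theorems of the library need a well-ordered index type.\<close>

typedef ('n::finite) ordered_index = "{..<CARD('n)}"
  by (intro exI[of _ 0]) simp

instance ordered_index :: (finite) finite
proof
  show "finite (UNIV :: 'a ordered_index set)"
    using type_definition.univ[OF type_definition_ordered_index] by (metis finite_imageI finite_lessThan)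
qed

instantiation ordered_index :: (finite) wellorder
begin

definition less_eq_ordered_index :: "'a ordered_index \<Rightarrow> 'a ordered_index \<Rightarrow> bool" where
  "less_eq_ordered_index x y \<longleftrightarrow> Rep_ordered_index x \<le> Rep_ordered_index y"

definition less_ordered_index :: "'a ordered_index \<Rightarrow> 'a ordered_index \<Rightarrow> bool" where
  "less_ordered_index x y \<longleftrightarrow> Rep_ordered_index x < Rep_ordered_index y"

instance
proof
  fix P :: "'a ordered_index \<Rightarrow> bool" and a :: "'a ordered_index"
  assume step: "\<And>x. (\<And>y. y < x \<Longrightarrow> P y) \<Longrightarrow> P x"
  show "P a"
    by (induction a rule: measure_induct_rule[of Rep_ordered_index])
      (rule step, simp add: less_ordered_index_def)
qed (auto simp: less_eq_ordered_index_def less_ordered_index_def Rep_ordered_index_inject)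

end

lemma ex_bij_ordered_index: "\<exists>e :: 'n::finite ordered_index \<Rightarrow> 'n. bij e"
proof -
  have "CARD('n ordered_index) = CARD('n)"
    using type_definition.card[OF type_definition_ordered_index[where 'n='n]] by simp
  then show ?thesis by (simp add: bij_betw_iff_card)
qed

definition reindex :: "('m \<Rightarrow> 'n) \<Rightarrow> real ^ 'n \<Rightarrow> real ^ 'm" where
  "reindex e x = (\<chi> i. x $ e i)"

lemma reindex_inverse: "bij e \<Longrightarrow> reindex (inv e) (reindex e x) = x" "bij e \<Longrightarrow> reindex e (reindex (inv e) y) = y"
  by (simp_all add: reindex_def vec_eq_iff bij_is_surj surj_f_inv_f bij_is_inj)

lemma linear_reindex: "linear (reindex (e :: 'm::finite \<Rightarrow> 'n::finite))"
  by (rule linearI) (simp_all add: reindex_def vec_eq_iff)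

lemma reindex_has_derivative [derivative_intros]:
  "(f has_derivative f') F \<Longrightarrow> ((\<lambda>x. reindex (e :: 'm::finite \<Rightarrow> 'n::finite) (f x)) has_derivative (\<lambda>h. reindex e (f' h))) F"
  using bounded_linear.has_derivative[OF linear_conv_bounded_linear[THEN iffD1, OF linear_reindex]] by blast

lemma borel_measurable_reindex [measurable]: "reindex (e :: 'm::finite \<Rightarrow> 'n::finite) \<in> borel_measurable borel"
  by (rule borel_measurable_continuous_onI, rule linear_continuous_on,
      rule linear_conv_bounded_linear[THEN iffD1, OF linear_reindex])

text \<open>A relabelling of coordinates maps boxes to boxes with the same side lengths, and
  Lebesgue measure is determined by its values on boxes.\<close>

lemma distr_reindex_lborel:
  fixes e :: "'m::finite \<Rightarrow> 'n::finite"
  assumes e: "bij e"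
  shows "distr lborel borel (reindex e) = (lborel :: (real ^ 'm) measure)"
proof (rule lborel_eqI[symmetric])
  fix l u :: "real ^ 'm" assume "\<And>b. b \<in> Basis \<Longrightarrow> l \<bullet> b \<le> u \<bullet> b"
  then have le: "l $ i \<le> u $ i" for i by (metis axis_in_Basis_iff cart_eq_inner_axis Basis_real_def insertI1)
  have "reindex e -` box l u = box (reindex (inv e) l) (reindex (inv e) u)"
  proof -
    have "(\<forall>i. l $ i < x $ e i \<and> x $ e i < u $ i) \<longleftrightarrow> (\<forall>j. l $ inv e j < x $ j \<and> x $ j < u $ inv e j)" for x :: "real ^ 'n"
      using e by (metis bij_inv_eq_iff)
    then show ?thesis by (auto simp: mem_box_cart reindex_def)
  qed
  then have "emeasure (distr lborel borel (reindex e)) (box l u) =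
      emeasure lborel (box (reindex (inv e) l) (reindex (inv e) u))"
    by (simp add: emeasure_distr)
  also have "\<dots> = (\<Prod>b\<in>Basis. (reindex (inv e) u - reindex (inv e) l) \<bullet> b)"
    by (rule emeasure_lborel_box) (auto simp: Basis_vec_def inner_axis reindex_def le)
  also have "(\<Prod>b\<in>Basis. (reindex (inv e) u - reindex (inv e) l) \<bullet> b) = (\<Prod>j\<in>UNIV. (u - l) $ inv e j)"
    by (simp add: Basis_vec_def UNION_singleton_eq_range prod.reindex axis_eq_axis inj_on_def inner_axis reindex_def)
  also have "\<dots> = (\<Prod>i\<in>UNIV. (u - l) $ i)"
    using prod.reindex_bij_betw[OF bij_imp_bij_inv[OF e], of "\<lambda>i. (u - l) $ i"] by simp
  also have "\<dots> = (\<Prod>b\<in>Basis. (u - l) \<bullet> b)"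
    by (simp add: Basis_vec_def UNION_singleton_eq_range prod.reindex axis_eq_axis inj_on_def inner_axis)
  finally show "emeasure (distr lborel borel (reindex e)) (box l u) = (\<Prod>b\<in>Basis. (u - l) \<bullet> b)" .
qed simp

lemma nn_integral_reindex:
  fixes e :: "'m::finite \<Rightarrow> 'n::finite"
  assumes "bij e" "F \<in> borel_measurable borel"
  shows "(\<integral>\<^sup>+ x. F (reindex e x) \<partial>lborel) = (\<integral>\<^sup>+ y. F y \<partial>lborel)"
  by (subst distr_reindex_lborel[OF assms(1), symmetric], subst nn_integral_distr) (use assms(2) in auto)

text \<open>Conjugation by e is a sign-preserving bijection between the permutations of the two
  index types, and it matches the terms of the Leibniz formula.\<close>

lemma det_reindex:
  fixes e :: "'m::finite \<Rightarrow> 'n::finite" and A :: "real ^ 'n ^ 'n"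
  assumes e: "bij e"
  shows "det (\<chi> i j. A $ e i $ e j) = det A"
proof -
  let ?c = "map_permutation (UNIV :: 'm set) e"
  have inj: "inj e" using e by (rule bij_is_inj)
  have bij: "bij_betw ?c {p. p permutes UNIV} {p. p permutes UNIV}"
  proof (rule bij_betwI[where g = "map_permutation (UNIV :: 'n set) (inv e)"])
    show "?c \<in> {p. p permutes UNIV} \<rightarrow> {p. p permutes UNIV}"
      using map_permutation_permutes[OF e] by auto
    show "map_permutation UNIV (inv e) \<in> {p. p permutes UNIV} \<rightarrow> {p. p permutes UNIV}"
      using map_permutation_permutes[OF bij_imp_bij_inv[OF e]] by auto
  qed (use e in \<open>auto simp: fun_eq_iff map_permutation_def bij_is_inj bij_is_surj surj_f_inv_f inv_inv_eq
      restrict_id_def bij_is_surj[OF bij_imp_bij_inv]\<close>)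
  have ce: "?c p (e i) = e (p i)" if "p permutes UNIV" for p i
    using map_permutation_apply[OF inj, of i p] by simp
  have "det A = (\<Sum>p | p permutes UNIV. of_int (sign (?c p)) * (\<Prod>i\<in>UNIV. A $ i $ ?c p i))"
    unfolding det_def by (rule sum.reindex_bij_betw[OF bij, symmetric])
  also have "\<dots> = (\<Sum>p | p permutes UNIV. of_int (sign p) * (\<Prod>i\<in>UNIV. A $ e i $ e (p i)))"
  proof (rule sum.cong[OF refl])
    fix p :: "'m \<Rightarrow> 'm" assume p: "p \<in> {p. p permutes UNIV}"
    have "(\<Prod>i\<in>UNIV. A $ i $ ?c p i) = (\<Prod>i\<in>UNIV. A $ e i $ ?c p (e i))"
      using prod.reindex_bij_betw[OF e, of "\<lambda>i. A $ i $ ?c p i"] by simp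
    then show "of_int (sign (?c p)) * (\<Prod>i\<in>UNIV. A $ i $ ?c p i) =
        of_int (sign p) * (\<Prod>i\<in>UNIV. A $ e i $ e (p i))"
      using p ce sign_map_permutation[OF inj, of p] by simp
  qed
  finally show ?thesis by (simp add: det_def)
qed

text \<open>Infinity is the only value left when no finite one is attained. This suits statements of
  the form that one integral has the value r iff another one has.\<close>

lemma ennreal_eqI_finite:
  fixes a b :: ennreal
  assumes "\<And>r. 0 \<le> r \<Longrightarrow> a = ennreal r \<longleftrightarrow> b = ennreal r"
  shows "a = b"
proof (cases a)
  case (real r)
  then show ?thesis using assms[of r] by simp
next
  case top
  have "b = top"
  proof (cases b)
    case (real r)
    then show ?thesis using assms[of r] top by simp
  qed
  then show ?thesis using top by simp
qed

lemma has_integral_iff_nn_integral_lborel: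
  fixes F :: "'a::euclidean_space \<Rightarrow> real"
  assumes "\<And>x. 0 \<le> F x" "F \<in> borel_measurable borel"
  shows "(F has_integral r) UNIV \<longleftrightarrow> (\<integral>\<^sup>+ x. ennreal (F x) \<partial>lborel) = ennreal r \<and> 0 \<le> r"
proof -
  have "F \<in> lebesgue \<rightarrow>\<^sub>M borel" using assms(2) by (intro measurable_completion) simp
  then show ?thesis
    unfolding has_integral_iff_nn_integral_lebesgue[of F, OF assms(1)] nn_integral_completion by blast
qed

text \<open>The change of variables is an equivalence between \<open>has_integral\<close>
  statements. Extension by zero and Borel measurability allow both sides to be read as Lebesgue
  integrals, where infinite values make sense.\<close>

lemma nn_integral_change_of_variables_wellorder:
  fixes f :: "real^'m::{finite,wellorder} \<Rightarrow> real" and g :: "real^'m::_ \<Rightarrow> real^'m::_"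
  assumes der: "\<And>x. x \<in> S \<Longrightarrow> (g has_derivative g' x) (at x within S)"
      and der_h: "\<And>y. y \<in> T \<Longrightarrow> (h has_derivative h' y) (at y within T)"
      and nonneg: "\<And>y. y \<in> T \<Longrightarrow> 0 \<le> f y"
      and hg: "\<And>x. x \<in> S \<Longrightarrow> g x \<in> T \<and> h(g x) = x"
      and gh: "\<And>y. y \<in> T \<Longrightarrow> h y \<in> S \<and> g(h y) = y"
      and inv: "\<And>y. y \<in> T \<Longrightarrow> h' y \<circ> g'(h y) = id"
      and meas: "(\<lambda>x. if x \<in> S then \<bar>det (matrix (g' x))\<bar> * f (g x) else 0) \<in> borel_measurable borel"
        "(\<lambda>y. if y \<in> T then f y else 0) \<in> borel_measurable borel"
  shows "(\<integral>\<^sup>+ x. ennreal (if x \<in> S then \<bar>det (matrix (g' x))\<bar> * f (g x) else 0) \<partial>lborel) =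
    (\<integral>\<^sup>+ y. ennreal (if y \<in> T then f y else 0) \<partial>lborel)" (is "?I = ?J")
proof -
  have I: "((\<lambda>x. \<bar>det (matrix (g' x))\<bar> * f (g x)) has_integral r) S \<longleftrightarrow> ?I = ennreal r \<and> 0 \<le> r" for r
    unfolding has_integral_restrict_UNIV[of S, symmetric]
    by (rule has_integral_iff_nn_integral_lborel[OF _ meas(1)]) (use nonneg hg in simp)
  have J: "(f has_integral r) T \<longleftrightarrow> ?J = ennreal r \<and> 0 \<le> r" for r
    unfolding has_integral_restrict_UNIV[of T, symmetric]
    by (rule has_integral_iff_nn_integral_lborel[OF _ meas(2)]) (use nonneg in simp)
  have "?I = ennreal r \<and> 0 \<le> r \<longleftrightarrow> ?J = ennreal r \<and> 0 \<le> r" for r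
    unfolding I[symmetric] J[symmetric]
    by (rule cov_invertible_nonneg_eq[OF der der_h nonneg hg gh inv])
  then show ?thesis by (intro ennreal_eqI_finite) blast
qed

text \<open>All data are conjugated by a relabelling of the coordinates, which changes neither
  Lebesgue measure nor Jacobian determinants.\<close>

lemma nn_integral_change_of_variables:
  fixes f :: "real^'n::finite \<Rightarrow> real" and g :: "real^'n \<Rightarrow> real^'n"
  assumes der: "\<And>x. x \<in> S \<Longrightarrow> (g has_derivative g' x) (at x within S)"
      and der_h: "\<And>y. y \<in> T \<Longrightarrow> (h has_derivative h' y) (at y within T)"
      and nonneg: "\<And>y. y \<in> T \<Longrightarrow> 0 \<le> f y"
      and hg: "\<And>x. x \<in> S \<Longrightarrow> g x \<in> T \<and> h(g x) = x"
      and gh: "\<And>y. y \<in> T \<Longrightarrow> h y \<in> S \<and> g(h y) = y"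
      and inv: "\<And>y. y \<in> T \<Longrightarrow> h' y \<circ> g'(h y) = id"
      and meas: "(\<lambda>x. if x \<in> S then \<bar>det (matrix (g' x))\<bar> * f (g x) else 0) \<in> borel_measurable borel"
        "(\<lambda>y. if y \<in> T then f y else 0) \<in> borel_measurable borel"
  shows "(\<integral>\<^sup>+ x. ennreal (if x \<in> S then \<bar>det (matrix (g' x))\<bar> * f (g x) else 0) \<partial>lborel) =
    (\<integral>\<^sup>+ y. ennreal (if y \<in> T then f y else 0) \<partial>lborel)"
proof -
  obtain e :: "'n ordered_index \<Rightarrow> 'n" where e: "bij e" using ex_bij_ordered_index by blast
  define R where "R = reindex e"
  define Q where "Q = reindex (Hilbert_Choice.inv e)"
  have [simp]: "Q (R x) = x" "R (Q y) = y" for x y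
    using reindex_inverse[OF e] by (simp_all add: R_def Q_def)
  have [measurable]: "Q \<in> borel_measurable borel" by (simp add: Q_def)
  have der_conj: "((\<lambda>x. R (k (Q x))) has_derivative (\<lambda>v. R (k' (Q v)))) (at x within Q -` U)"
    if "(k has_derivative k') (at (Q x) within U)" for k k' x U
  proof -
    have "(Q has_derivative Q) (at x within Q -` U)"
      unfolding Q_def by (rule linear_imp_has_derivative[OF linear_reindex])
    moreover have "(k has_derivative k') (at (Q x) within Q ` (Q -` U))"
      using that by (rule has_derivative_subset) auto
    ultimately have "((\<lambda>x. k (Q x)) has_derivative (\<lambda>v. k' (Q v))) (at x within Q -` U)"
      using has_derivative_in_compose by blast
    then show ?thesis unfolding R_def by (rule reindex_has_derivative)
  qed
  \<comment> \<open>The matrix of the conjugated map is the old one with rows and columns relabelled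
    by the same bijection.\<close>
  have detR: "det (matrix (\<lambda>v. R (L (Q v)))) = det (matrix L)" if "linear L" for L
  proof -
    have "matrix (\<lambda>v. R (L (Q v))) = (\<chi> i j. matrix L $ e i $ e j)"
    proof -
      have "Q (axis j 1) = axis (e j) 1" for j
      proof -
        have "Hilbert_Choice.inv e i = j \<longleftrightarrow> i = e j" for i using e by (metis bij_inv_eq_iff)
        then show ?thesis by (simp add: Q_def reindex_def vec_eq_iff axis_def)
      qed
      then show ?thesis by (simp add: matrix_def R_def reindex_def)
    qed
    then show ?thesis using det_reindex[OF e, of "matrix L"] by simp
  qed
  have lin: "linear (g' x)" if "x \<in> S" for x using der[OF that] has_derivative_linear by blast
  let ?F = "\<lambda>x. ennreal (if x \<in> S then \<bar>det (matrix (g' x))\<bar> * f (g x) else 0)"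
  let ?G = "\<lambda>y. ennreal (if y \<in> T then f y else 0)"
  have detS: "(if x \<in> Q -` S then \<bar>det (matrix (\<lambda>v. R (g' (Q x) (Q v))))\<bar> * f (Q (R (g (Q x)))) else 0)
      = (\<lambda>x. if x \<in> S then \<bar>det (matrix (g' x))\<bar> * f (g x) else 0) (Q x)" for x
    using detR[OF lin, of "Q x"] by simp
  have "(\<integral>\<^sup>+ x. ennreal (if x \<in> Q -` S then \<bar>det (matrix (\<lambda>v. R (g' (Q x) (Q v))))\<bar> * f (Q (R (g (Q x)))) else 0) \<partial>lborel)
    = (\<integral>\<^sup>+ y. ennreal (if y \<in> Q -` T then f (Q y) else 0) \<partial>lborel)"
  proof (rule nn_integral_change_of_variables_wellorder[where h = "\<lambda>x. R (h (Q x))" and h' = "\<lambda>x v. R (h' (Q x) (Q v))"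
        and f = "\<lambda>y. f (Q y)" and g = "\<lambda>x. R (g (Q x))" and g' = "\<lambda>x v. R (g' (Q x) (Q v))"])
    show "(\<lambda>x. if x \<in> Q -` S then \<bar>det (matrix (\<lambda>v. R (g' (Q x) (Q v))))\<bar> * f (Q (R (g (Q x)))) else 0)
        \<in> borel_measurable borel"
      unfolding detS by (rule measurable_compose[OF _ meas(1)]) measurable
    show "(\<lambda>y. if y \<in> Q -` T then f (Q y) else 0) \<in> borel_measurable borel"
      using measurable_compose[OF _ meas(2), of Q] by simp
    show "(\<lambda>v. R (h' (Q y) (Q v))) \<circ> (\<lambda>v. R (g' (Q (R (h (Q y)))) (Q v))) = id" if "y \<in> Q -` T" for y
      using inv[of "Q y"] that by (simp add: fun_eq_iff)
  qed (use der_conj[OF der] der_conj[OF der_h] nonneg hg gh in auto)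
  moreover have "(\<integral>\<^sup>+ x. ?F (Q x) \<partial>lborel) = (\<integral>\<^sup>+ x. ?F x \<partial>lborel)"
    unfolding Q_def by (rule nn_integral_reindex[OF bij_imp_bij_inv[OF e]]) (use meas in measurable)
  moreover have "(\<integral>\<^sup>+ x. ?G (Q x) \<partial>lborel) = (\<integral>\<^sup>+ x. ?G x \<partial>lborel)"
    unfolding Q_def by (rule nn_integral_reindex[OF bij_imp_bij_inv[OF e]]) (use meas in measurable)
  ultimately show ?thesis unfolding detS by simp
qed

lemma emeasure_matrix_image_ball:
  fixes V W :: "real ^ 'n::finite ^ 'n"
  assumes VW: "V ** W = mat 1" "W ** V = mat 1"
  shows "(\<lambda>w. p + V *v w) ` ball 0 t \<in> sets borel"
    and "emeasure lborel ((\<lambda>w. p + V *v w) ` ball 0 t) = ennreal \<bar>det V\<bar> * emeasure lborel (ball (0 :: real ^ 'n) t)"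
proof -
  let ?g = "\<lambda>w. p + V *v w" and ?h = "\<lambda>y. W *v (y - p)"
  let ?T = "?g ` ball 0 t"
  have hg: "?h (?g w) = w" and gh: "?g (?h y) = y" for w y
    by (simp_all add: matrix_vector_mul_assoc VW)
  \<comment> \<open>As a preimage under the continuous inverse map, the ellipsoid is open.\<close>
  have T_eq: "?T = ?h -` ball 0 t"
    using hg gh by (metis (no_types, lifting) image_eqI subsetI subset_antisym image_subset_iff vimage_eq)
  have h_cont: "continuous_on UNIV ?h"
    by (intro continuous_on_compose2[OF linear_continuous_on[OF matrix_vector_mul_bounded_linear], of UNIV]) (auto intro: continuous_intros)
  have "open ?T" unfolding T_eq by (rule open_vimage[OF open_ball h_cont])
  then show T: "?T \<in> sets borel" by simp
  have "(\<integral>\<^sup>+ x. ennreal (if x \<in> ball (0 :: real ^ 'n) t then \<bar>det (matrix ((*v) V))\<bar> * 1 else 0) \<partial>lborel) =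
    (\<integral>\<^sup>+ y. ennreal (if y \<in> ?T then 1 else 0) \<partial>lborel)"
  proof (rule nn_integral_change_of_variables[where g = ?g and h = ?h and f = "\<lambda>_. 1" and g' = "\<lambda>_. (*v) V" and h' = "\<lambda>_. (*v) W"])
    show "(?g has_derivative (*v) V) (at x within ball 0 t)" for x
      using has_derivative_add[OF has_derivative_const bounded_linear_imp_has_derivative[OF matrix_vector_mul_bounded_linear]]
      by fastforce
    show "(?h has_derivative (*v) W) (at y within ?T)" for y
    proof -
      have "((\<lambda>y. y - p) has_derivative (\<lambda>v. v)) (at y within ?T)" by (auto intro!: derivative_eq_intros)
      then show ?thesis by (rule bounded_linear.has_derivative[OF matrix_vector_mul_bounded_linear])
    qed
    show "?g x \<in> ?T \<and> ?h (?g x) = x" if "x \<in> ball 0 t" for x using that hg by blast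
    show "?h y \<in> ball 0 t \<and> ?g (?h y) = y" if "y \<in> ?T" for y using that T_eq gh by blast
    show "(*v) W \<circ> (*v) V = id" by (simp add: fun_eq_iff matrix_vector_mul_assoc VW)
    show "(\<lambda>x. if x \<in> ball (0 :: real ^ 'n) t then \<bar>det (matrix ((*v) V))\<bar> * 1 else 0) \<in> borel_measurable borel"
      by (intro measurable_If_set) auto
    show "(\<lambda>y. if y \<in> ?T then 1 else 0 :: real) \<in> borel_measurable borel"
      using T by (intro measurable_If_set) auto
  qed simp
  moreover have "ennreal (if x \<in> ball 0 t then \<bar>det (matrix ((*v) V))\<bar> * 1 else 0) = ennreal \<bar>det V\<bar> * indicator (ball 0 t) x"
    for x :: "real ^ 'n" by (simp add: indicator_def)
  moreover have "ennreal (if y \<in> ?T then 1 else 0) = indicator ?T y" for y by (simp add: indicator_def)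
  ultimately have "(\<integral>\<^sup>+ x. ennreal \<bar>det V\<bar> * indicator (ball 0 t) x \<partial>(lborel :: (real ^ 'n) measure)) = (\<integral>\<^sup>+ y. indicator ?T y \<partial>lborel)"
    by simp
  then show "emeasure lborel ?T = ennreal \<bar>det V\<bar> * emeasure lborel (ball (0 :: real ^ 'n) t)"
    using T by (simp add: nn_integral_cmult_indicator)
qed

section \<open>Positive definite matrices\<close>

lemma symmetric_dot_commute:
  fixes G :: "real ^ 'n ^ 'n"
  assumes "transpose G = G"
  shows "u \<bullet> (G *v w) = w \<bullet> (G *v u)"
  by (metis assms dot_lmul_matrix inner_commute transpose_matrix_vector)

text \<open>A variant of Gram-Schmidt: the next vector is chosen Euclidean-orthogonal to the span of
  the images G u with u in B. This span has dimension at most m, below that of the space, and by the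
  symmetry of G the new vector is G-orthogonal to B.\<close>

lemma posdef_orthonormal_set:
  fixes G :: "real ^ 'n::finite ^ 'n"
  assumes sym: "transpose G = G" and pos: "\<And>v. v \<noteq> 0 \<Longrightarrow> 0 < v \<bullet> (G *v v)"
  shows "m \<le> CARD('n) \<Longrightarrow> \<exists>B. finite B \<and> card B = m \<and> (\<forall>u\<in>B. \<forall>w\<in>B. u \<bullet> (G *v w) = (if u = w then 1 else 0))"
proof (induction m)
  case 0
  then show ?case by (intro exI[of _ "{}"]) simp
next
  case (Suc m)
  then obtain B where B: "finite B" "card B = m"
    and on: "\<And>u w. u \<in> B \<Longrightarrow> w \<in> B \<Longrightarrow> u \<bullet> (G *v w) = (if u = w then 1 else 0)" by auto
  have "dim ((*v) G ` B) \<le> card ((*v) G ` B)" using B(1) by (simp add: dim_le_card')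
  also have "\<dots> \<le> card B" by (rule card_image_le[OF B(1)])
  also have "\<dots> < DIM(real ^ 'n)" using B(2) Suc.prems by simp
  finally obtain w where w: "w \<noteq> 0" "\<And>y. y \<in> span ((*v) G ` B) \<Longrightarrow> orthogonal w y"
    using orthogonal_to_subspace_exists by blast
  define c where "c = sqrt (w \<bullet> (G *v w))"
  have c: "c > 0" "c * c = w \<bullet> (G *v w)" using pos[OF w(1)] by (simp_all add: c_def)
  define w' where "w' = (1 / c) *\<^sub>R w"
  have w'G: "w' \<bullet> (G *v u) = 0" if "u \<in> B" for u
    using w(2)[of "G *v u"] that by (simp add: w'_def orthogonal_def span_base)
  have "w' \<bullet> (G *v w') = 1"
    using c(1) by (simp add: w'_def matrix_vector_mult_scaleR c(2)[symmetric])
  moreover have "u \<bullet> (G *v w') = 0" if "u \<in> B" for u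
    using w'G[OF that] symmetric_dot_commute[OF sym] by metis
  moreover have "w' \<notin> B" using w'G calculation by force
  ultimately show ?case using B on w'G by (intro exI[of _ "insert w' B"]) auto
qed

text \<open>The columns of V form a G-orthonormal basis. Thus V carries the Euclidean norm to the
  norm of G, and Euclidean balls to the ellipsoids that are the balls of G.\<close>

lemma posdef_orthonormal_matrix:
  fixes G :: "real ^ 'n::finite ^ 'n"
  assumes sym: "transpose G = G" and pos: "\<And>v. v \<noteq> 0 \<Longrightarrow> 0 < v \<bullet> (G *v v)"
  obtains V :: "real ^ 'n ^ 'n" where "transpose V ** G ** V = mat 1"
proof -
  obtain B where B: "finite B" "card B = CARD('n)"
    and on: "\<And>u w. u \<in> B \<Longrightarrow> w \<in> B \<Longrightarrow> u \<bullet> (G *v w) = (if u = w then 1 else 0)"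
    using posdef_orthonormal_set[OF assms, of "CARD('n)"] by auto
  obtain e :: "'n \<Rightarrow> real ^ 'n" where e: "bij_betw e UNIV B"
    using B by (metis finite_class.finite_UNIV finite_same_card_bij)
  define V :: "real ^ 'n ^ 'n" where "V = (\<chi> i j. e j $ i)"
  have V: "V *v axis j 1 = e j" for j
    by (simp add: V_def matrix_vector_mult_basis column_def vec_eq_iff)
  have "(transpose V ** G ** V) $ i $ j = (mat 1 :: real ^ 'n ^ 'n) $ i $ j" for i j
  proof -
    have "(transpose V ** G ** V) $ i $ j = ((transpose V ** G ** V) *v axis j 1) $ i"
      by (simp add: matrix_vector_mult_basis column_def)
    also have "\<dots> = axis i 1 \<bullet> (transpose V *v (G *v (V *v axis j 1)))"
      by (simp add: matrix_vector_mul_assoc[symmetric] inner_axis')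
    also have "\<dots> = e i \<bullet> (G *v e j)"
      by (metis V dot_lmul_matrix transpose_matrix_vector transpose_transpose)
    also have "\<dots> = (if i = j then 1 else 0)"
      using on e by (auto simp: bij_betw_def inj_on_def)
    finally show ?thesis by (simp add: mat_def)
  qed
  then have "transpose V ** G ** V = mat 1" by (simp add: vec_eq_iff)
  then show ?thesis by (rule that)
qed

text \<open>The second equation says that an ellipsoid V(B), measured with the constant density
  \<open>sqrt (det G)\<close>, has the Euclidean volume of B.\<close>

lemma posdef_det:
  fixes G :: "real ^ 'n::finite ^ 'n"
  assumes "transpose V ** G ** V = mat 1"
  shows "0 < det G" "\<bar>det V\<bar> * sqrt (det G) = 1"
proof -
  have "det (transpose V ** G ** V) = 1" by (simp add: assms)
  then have eq: "(det V)\<^sup>2 * det G = 1" by (simp add: det_mul power2_eq_square mult_ac)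
  then have "0 < (det V)\<^sup>2 * det G" by simp
  then show "0 < det G" using zero_le_power2[of "det V"] by (simp only: zero_less_mult_iff) linarith
  have "sqrt ((det V)\<^sup>2 * det G) = 1" by (simp add: eq)
  then show "\<bar>det V\<bar> * sqrt (det G) = 1" by (simp add: real_sqrt_mult)
qed

lemma norm_matrix_vector_le:
  fixes A :: "real ^ 'n::finite ^ 'm::finite"
  shows "norm (A *v v) \<le> real CARD('m) * real CARD('n) * norm A * norm v"
proof -
  have "\<bar>A $ i $ j\<bar> \<le> norm A" for i j
    using component_le_norm_cart[of "A $ i" j] Finite_Cartesian_Product.norm_nth_le[of A i] by linarith
  then have "onorm ((*v) A) \<le> real CARD('m) * real CARD('n) * norm A"
    by (rule onorm_le_matrix_component)
  then show ?thesis
    using onorm[OF matrix_vector_mul_bounded_linear[of A], of v] mult_right_mono[OF _ norm_ge_zero, of _ _ v]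
    by (meson order_trans)
qed

text \<open>The constant is the minimum of the form on the compact unit sphere; homogeneity does the
  rest.\<close>

lemma posdef_bounded_below:
  fixes G :: "real ^ 'n::finite ^ 'n"
  assumes pos: "\<And>v. v \<noteq> 0 \<Longrightarrow> 0 < v \<bullet> (G *v v)"
  obtains l where "0 < l" "\<And>v. l * (norm v)\<^sup>2 \<le> v \<bullet> (G *v v)"
proof -
  have "continuous_on (sphere 0 1) (\<lambda>v. v \<bullet> (G *v v))"
    by (intro continuous_intros linear_continuous_on matrix_vector_mul_bounded_linear)
  moreover have "(sphere 0 1 :: (real ^ 'n) set) \<noteq> {}" by simp
  ultimately obtain u :: "real ^ 'n" where u: "norm u = 1" "\<And>v. norm v = 1 \<Longrightarrow> u \<bullet> (G *v u) \<le> v \<bullet> (G *v v)"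
    using continuous_attains_inf[OF compact_sphere, of "0 :: real ^ 'n" 1 "\<lambda>v. v \<bullet> (G *v v)"] by auto
  show ?thesis
  proof (rule that)
    show "0 < u \<bullet> (G *v u)" using u(1) by (intro pos) auto
    show "u \<bullet> (G *v u) * (norm v)\<^sup>2 \<le> v \<bullet> (G *v v)" for v
    proof (cases "v = 0")
      case False
      have "u \<bullet> (G *v u) \<le> ((1 / norm v) *\<^sub>R v) \<bullet> (G *v ((1 / norm v) *\<^sub>R v))"
        using False by (intro u(2)) simp
      also have "\<dots> = v \<bullet> (G *v v) / (norm v)\<^sup>2"
        by (simp add: matrix_vector_mult_scaleR power2_eq_square)
      finally show ?thesis using False by (simp add: field_simps)
    qed simp
  qed
qed

section \<open>Charts and curves\<close>

abbreviation cdom :: "('a, 'n) chart \<Rightarrow> 'a set" where "cdom c \<equiv> fst c"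
abbreviation cimg :: "('a, 'n) chart \<Rightarrow> (real ^ 'n) set" where "cimg c \<equiv> snd c ` fst c"

locale riemannian =
  fixes M :: "('a, 'n::finite) riemannian"
  assumes manifold: "riemannian_manifold M"
begin

lemmas manifold_unfolded = manifold[unfolded riemannian_manifold_def split_beta Let_def]

lemma chart_basics:
  assumes "c \<in> charts M"
  shows "openin (mtop M) (cdom c)" "open (cimg c)"
    "homeomorphic_map (subtopology (mtop M) (cdom c)) (top_of_set (cimg c)) (snd c)"
  using manifold_unfolded assms by blast+

lemma dom_subset: "c \<in> charts M \<Longrightarrow> cdom c \<subseteq> points M"
  using chart_basics(1) openin_subset by blast

lemma chart_at: assumes "x \<in> points M" obtains c where "c \<in> charts M" "x \<in> cdom c"
  using manifold_unfolded assms that by blast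

lemma chart_inj: assumes "c \<in> charts M" shows "inj_on (snd c) (cdom c)"
  using homeomorphic_imp_injective_map[OF chart_basics(3)[OF assms]] dom_subset[OF assms]
  by (simp add: Int_absorb1)

lemma chart_inv_left [simp]: "c \<in> charts M \<Longrightarrow> x \<in> cdom c \<Longrightarrow> chart_inv c (snd c x) = x"
  by (simp add: chart_inv_def chart_inj)

lemma chart_inv_right [simp]: "c \<in> charts M \<Longrightarrow> y \<in> cimg c \<Longrightarrow> snd c (chart_inv c y) = y"
  by (simp add: chart_inv_def f_inv_into_f)

lemma chart_inv_in: "c \<in> charts M \<Longrightarrow> y \<in> cimg c \<Longrightarrow> chart_inv c y \<in> cdom c"
  by (simp add: chart_inv_def inv_into_into)

lemma chart_preimage_openin:
  assumes c: "c \<in> charts M" and W: "open W"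
  shows "openin (mtop M) {x \<in> cdom c. snd c x \<in> W}"
proof -
  have cm: "continuous_map (subtopology (mtop M) (cdom c)) (top_of_set (cimg c)) (snd c)"
    using homeomorphic_imp_continuous_map[OF chart_basics(3)[OF c]] .
  have "openin (subtopology (mtop M) (cdom c)) {x \<in> topspace (subtopology (mtop M) (cdom c)). snd c x \<in> cimg c \<inter> W}"
    by (rule openin_continuous_map_preimage[OF cm]) (use W in \<open>auto simp: openin_open\<close>)
  moreover have "{x \<in> topspace (subtopology (mtop M) (cdom c)). snd c x \<in> cimg c \<inter> W} = {x \<in> cdom c. snd c x \<in> W}"
    using dom_subset[OF c] by auto
  ultimately show ?thesis using chart_basics(1)[OF c] openin_trans_full by metis
qed

text \<open>On the image of the chart, \<open>inv_into\<close> agrees with the continuous inverse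
  supplied by the homeomorphism.\<close>

lemma chart_inv_continuous:
  assumes c: "c \<in> charts M"
  shows "continuous_map (top_of_set (cimg c)) (mtop M) (chart_inv c)"
proof -
  obtain g where g: "homeomorphic_maps (subtopology (mtop M) (cdom c)) (top_of_set (cimg c)) (snd c) g"
    using chart_basics(3)[OF c] homeomorphic_map_maps by blast
  have "continuous_map (top_of_set (cimg c)) (subtopology (mtop M) (cdom c)) g"
    using g by (simp add: homeomorphic_maps_def)
  then have "continuous_map (top_of_set (cimg c)) (mtop M) g"
    by (rule continuous_map_into_fulltopology)
  moreover have "g y = chart_inv c y" if "y \<in> cimg c" for y
    using g that dom_subset[OF c] chart_inv_left[OF c] by (auto simp: homeomorphic_maps_def)
  ultimately show ?thesis by (rule continuous_map_eq) simp
qed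

lemma chart_inv_preimage_open:
  assumes c: "c \<in> charts M" and U: "openin (mtop M) U"
  shows "open {y \<in> cimg c. chart_inv c y \<in> U}"
proof -
  have "openin (top_of_set (cimg c)) {y \<in> topspace (top_of_set (cimg c)). chart_inv c y \<in> U}"
    by (rule openin_continuous_map_preimage[OF chart_inv_continuous[OF c] U])
  then show ?thesis using chart_basics(2)[OF c] openin_open_eq by auto
qed

lemma image_dom_Int:
  assumes "c \<in> charts M" "A \<subseteq> points M"
  shows "snd c ` (cdom c \<inter> A) = {y \<in> cimg c. chart_inv c y \<in> A}"
  using assms by (auto simp: image_iff)

lemma open_overlap:
  assumes "c \<in> charts M" "c' \<in> charts M" shows "open (snd c ` (cdom c \<inter> cdom c'))"
  unfolding image_dom_Int[OF assms(1) dom_subset[OF assms(2)]]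
  by (rule chart_inv_preimage_open[OF assms(1) chart_basics(1)[OF assms(2)]])

section \<open>Transition maps and Gram matrices\<close>

definition transition :: "('a, 'n) chart \<Rightarrow> ('a, 'n) chart \<Rightarrow> real ^ 'n \<Rightarrow> real ^ 'n" where
  "transition c c' = snd c' \<circ> chart_inv c"

definition jac :: "('a, 'n) chart \<Rightarrow> ('a, 'n) chart \<Rightarrow> real ^ 'n \<Rightarrow> real ^ 'n \<Rightarrow> real ^ 'n" where
  "jac c c' y = frechet_derivative (transition c c') (at y)"

lemma
  assumes c: "c \<in> charts M" "c' \<in> charts M"
  shows transition_has_derivative:
      "y \<in> snd c ` (cdom c \<inter> cdom c') \<Longrightarrow> (transition c c' has_derivative jac c c' y) (at y)"
    and jac_continuous: "continuous_on (snd c ` (cdom c \<inter> cdom c')) (\<lambda>y. jac c c' y v)"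
proof -
  let ?O = "snd c ` (cdom c \<inter> cdom c')"
  have "smooth_on ?O (transition c c')"
    using manifold c unfolding riemannian_manifold_def transition_def by blast
  then have ck: "Ck_on (Suc 0) ?O (transition c c')" unfolding smooth_on_def by blast
  then show "continuous_on ?O (\<lambda>y. jac c c' y v)" by (simp add: jac_def)
  have "transition c c' differentiable at y" if "y \<in> ?O" for y
    using ck that differentiable_on_eq_differentiable_at[OF open_overlap[OF c], of "transition c c'"]
    unfolding Ck_on.simps by blast
  then show "(transition c c' has_derivative jac c c' y) (at y)" if "y \<in> ?O"
    using that by (simp add: jac_def frechet_derivative_works[symmetric])
qed

lemma transition_apply: "c \<in> charts M \<Longrightarrow> x \<in> cdom c \<Longrightarrow> transition c c' (snd c x) = snd c' x"
  by (simp add: transition_def)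

lemma linear_jac: "c \<in> charts M \<Longrightarrow> c' \<in> charts M \<Longrightarrow> x \<in> cdom c \<inter> cdom c' \<Longrightarrow> linear (jac c c' (snd c x))"
  using transition_has_derivative has_derivative_linear by blast

lemma gram_continuous: "c \<in> charts M \<Longrightarrow> continuous_on (cimg c) (\<lambda>y. gram M c (chart_inv c y))"
proof -
  assume "c \<in> charts M"
  then have "smooth_on (cimg c) (gram M c \<circ> chart_inv c)" using manifold_unfolded by blast
  then have "Ck_on 0 (cimg c) (gram M c \<circ> chart_inv c)" unfolding smooth_on_def by blast
  then show ?thesis by (simp add: o_def)
qed

lemma gram_symmetric: "c \<in> charts M \<Longrightarrow> x \<in> cdom c \<Longrightarrow> transpose (gram M c x) = gram M c x"
  using manifold_unfolded by blast

lemma gram_pos: "c \<in> charts M \<Longrightarrow> x \<in> cdom c \<Longrightarrow> v \<noteq> 0 \<Longrightarrow> 0 < v \<bullet> (gram M c x *v v)"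
  using manifold_unfolded by blast

lemma gram_nonneg: "c \<in> charts M \<Longrightarrow> x \<in> cdom c \<Longrightarrow> 0 \<le> v \<bullet> (gram M c x *v v)"
  using gram_pos[of c x v] by (cases "v = 0") auto

lemma gram_transform:
  "c \<in> charts M \<Longrightarrow> c' \<in> charts M \<Longrightarrow> x \<in> cdom c \<inter> cdom c' \<Longrightarrow>
    v \<bullet> (gram M c x *v w) = jac c c' (snd c x) v \<bullet> (gram M c' x *v jac c c' (snd c x) w)"
  using manifold_unfolded unfolding jac_def transition_def by blast

end

section \<open>Curves under affine reparametrisation\<close>

lemma C1_curve_on_iff:
  "C1_curve_on M s t \<gamma> \<longleftrightarrow> (\<forall>c\<in>charts M. \<exists>D. continuous_on {\<tau>\<in>{s..t}. \<gamma> \<tau> \<in> fst c} D \<and>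
      (\<forall>\<tau>\<in>{s..t}. \<gamma> \<tau> \<in> fst c \<longrightarrow> (snd c \<circ> \<gamma> has_vector_derivative D \<tau>) (at \<tau> within {s..t})))"
  by (simp add: C1_curve_on_def split_beta)

text \<open>One statement for three uses: restriction to a subinterval (\<alpha> = 1), reversal
  (\<alpha> = -1) and the halves of a joined curve (\<alpha> = 2). Agreement of the curves is asked
  on the closed interval only, as derivatives are taken within it.\<close>

lemma C1_curve_on_affine:
  assumes \<gamma>: "C1_curve_on M s t \<gamma>" and \<sigma>: "\<And>\<tau>. \<tau> \<in> {s'..t'} \<Longrightarrow> \<alpha> * \<tau> + \<beta> \<in> {s..t}"
    and eq: "\<And>\<tau>. \<tau> \<in> {s'..t'} \<Longrightarrow> \<delta> \<tau> = \<gamma> (\<alpha> * \<tau> + \<beta>)"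
  shows "C1_curve_on M s' t' \<delta>"
  unfolding C1_curve_on_iff
proof
  fix c assume "c \<in> charts M"
  then obtain D where D: "continuous_on {\<tau>\<in>{s..t}. \<gamma> \<tau> \<in> fst c} D"
    and der: "\<And>\<tau>. \<tau> \<in> {s..t} \<Longrightarrow> \<gamma> \<tau> \<in> fst c \<Longrightarrow> (snd c \<circ> \<gamma> has_vector_derivative D \<tau>) (at \<tau> within {s..t})"
    using \<gamma> unfolding C1_curve_on_iff by blast
  let ?\<sigma> = "\<lambda>\<tau>. \<alpha> * \<tau> + \<beta>"
  have "continuous_on {\<tau>\<in>{s'..t'}. \<delta> \<tau> \<in> fst c} (\<lambda>\<tau>. \<alpha> *\<^sub>R D (?\<sigma> \<tau>))"
    by (intro continuous_intros continuous_on_compose2[OF D]) (use \<sigma> eq in auto)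
  moreover have "(snd c \<circ> \<delta> has_vector_derivative \<alpha> *\<^sub>R D (?\<sigma> \<tau>)) (at \<tau> within {s'..t'})"
    if "\<tau> \<in> {s'..t'}" "\<delta> \<tau> \<in> fst c" for \<tau>
  proof -
    have "(?\<sigma> has_vector_derivative \<alpha>) (at \<tau> within {s'..t'})"
      by (auto intro!: derivative_eq_intros simp: has_real_derivative_iff_has_vector_derivative[symmetric])
    moreover have "(snd c \<circ> \<gamma> has_vector_derivative D (?\<sigma> \<tau>)) (at (?\<sigma> \<tau>) within ?\<sigma> ` {s'..t'})"
      by (rule has_vector_derivative_within_subset[OF der]) (use \<sigma> eq that in auto)
    ultimately have "((snd c \<circ> \<gamma>) \<circ> ?\<sigma> has_vector_derivative \<alpha> *\<^sub>R D (?\<sigma> \<tau>)) (at \<tau> within {s'..t'})"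
      by (rule vector_diff_chain_within)
    then show ?thesis
      by (rule has_vector_derivative_transform[OF that(1), rotated]) (use eq in auto)
  qed
  ultimately have "continuous_on {\<tau>\<in>{s'..t'}. \<delta> \<tau> \<in> fst c} (\<lambda>\<tau>. \<alpha> *\<^sub>R D (?\<sigma> \<tau>)) \<and>
      (\<forall>\<tau>\<in>{s'..t'}. \<delta> \<tau> \<in> fst c \<longrightarrow> (snd c \<circ> \<delta> has_vector_derivative \<alpha> *\<^sub>R D (?\<sigma> \<tau>)) (at \<tau> within {s'..t'}))"
    by simp
  then show "\<exists>D. continuous_on {\<tau>\<in>{s'..t'}. \<delta> \<tau> \<in> fst c} D \<and>
      (\<forall>\<tau>\<in>{s'..t'}. \<delta> \<tau> \<in> fst c \<longrightarrow> (snd c \<circ> \<delta> has_vector_derivative D \<tau>) (at \<tau> within {s'..t'}))"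
    by (rule exI[where x = "\<lambda>\<tau>. \<alpha> *\<^sub>R D (?\<sigma> \<tau>)"])
qed

text \<open>Intervals whose interior misses the nodes replace intervals between consecutive nodes.
  This form allows extra nodes and carries over to images of the node set under
  reparametrisation.\<close>

lemma piecewise_C1_curve_iff:
  "piecewise_C1_curve M \<gamma> \<longleftrightarrow> continuous_map (top_of_set {0..1}) (mtop M) \<gamma> \<and>
    (\<exists>S. finite S \<and> (\<forall>s t. 0 \<le> s \<longrightarrow> s < t \<longrightarrow> t \<le> 1 \<longrightarrow> {s<..<t} \<inter> S = {} \<longrightarrow> C1_curve_on M s t \<gamma>))"
proof (intro iffI conjI)
  assume "piecewise_C1_curve M \<gamma>"
  then have "\<exists>S. finite S \<and> {0, 1} \<subseteq> S \<and> S \<subseteq> {0..1} \<and>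
      (\<forall>s\<in>S. \<forall>t\<in>S. s < t \<and> {s<..<t} \<inter> S = {} \<longrightarrow> C1_curve_on M s t \<gamma>)"
    and cont: "continuous_map (top_of_set {0..1}) (mtop M) \<gamma>"
    unfolding piecewise_C1_curve_def by simp_all
  then obtain S where S: "finite S" "{0, 1} \<subseteq> S" "S \<subseteq> {0..1}"
    and C: "\<forall>s\<in>S. \<forall>t\<in>S. s < t \<and> {s<..<t} \<inter> S = {} \<longrightarrow> C1_curve_on M s t \<gamma>"
    by (elim exE conjE)
  show "continuous_map (top_of_set {0..1}) (mtop M) \<gamma>" by (rule cont)
  have "C1_curve_on M s t \<gamma>" if st: "0 \<le> s" "s < t" "t \<le> 1" "{s<..<t} \<inter> S = {}" for s t
  proof -
    \<comment> \<open>The consecutive nodes that enclose s and t; the curve is then restricted from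
      this interval.\<close>
    define s0 where "s0 = Max {x\<in>S. x \<le> s}"
    define t0 where "t0 = Min {x\<in>S. t \<le> x}"
    have s0: "s0 \<in> {x\<in>S. x \<le> s}" unfolding s0_def by (rule Max_in) (use S st in auto)
    have t0: "t0 \<in> {x\<in>S. t \<le> x}" unfolding t0_def by (rule Min_in) (use S st in auto)
    have "x \<le> s0" if "x \<in> S" "x \<le> s" for x unfolding s0_def using S that by (intro Max_ge) auto
    moreover have "t0 \<le> x" if "x \<in> S" "t \<le> x" for x unfolding t0_def using S that by (intro Min_le) auto
    ultimately have "{s0<..<t0} \<inter> S = {}"
      using st(4) by (auto simp: disjoint_iff) (meson greaterThanLessThan_iff not_le)
    then have "C1_curve_on M s0 t0 \<gamma>" using bspec[OF bspec[OF C, of s0], of t0] s0 t0 st by auto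
    then show ?thesis by (rule C1_curve_on_affine[where \<alpha> = 1 and \<beta> = 0]) (use s0 t0 in auto)
  qed
  then show "\<exists>S. finite S \<and> (\<forall>s t. 0 \<le> s \<longrightarrow> s < t \<longrightarrow> t \<le> 1 \<longrightarrow> {s<..<t} \<inter> S = {} \<longrightarrow> C1_curve_on M s t \<gamma>)"
    using S(1) by blast
next
  assume *: "continuous_map (top_of_set {0..1}) (mtop M) \<gamma> \<and>
    (\<exists>S. finite S \<and> (\<forall>s t. 0 \<le> s \<longrightarrow> s < t \<longrightarrow> t \<le> 1 \<longrightarrow> {s<..<t} \<inter> S = {} \<longrightarrow> C1_curve_on M s t \<gamma>))"
  then obtain S where S: "finite S"
    and C: "\<forall>s t. 0 \<le> s \<longrightarrow> s < t \<longrightarrow> t \<le> 1 \<longrightarrow> {s<..<t} \<inter> S = {} \<longrightarrow> C1_curve_on M s t \<gamma>"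
    by (elim exE conjE)
  have "C1_curve_on M s t \<gamma>"
    if "s \<in> S \<inter> {0..1} \<union> {0, 1}" "t \<in> S \<inter> {0..1} \<union> {0, 1}" "s < t" "{s<..<t} \<inter> (S \<inter> {0..1} \<union> {0, 1}) = {}" for s t
  proof (rule C[rule_format])
    show "0 \<le> s" "t \<le> 1" using that by auto
    then show "{s<..<t} \<inter> S = {}" using that(4) by (auto simp: disjoint_iff)
  qed (use that in auto)
  then show "piecewise_C1_curve M \<gamma>"
    unfolding piecewise_C1_curve_def using * S
    by (intro conjI exI[of _ "S \<inter> {0..1} \<union> {0, 1}"]) auto
qed

lemma piecewise_C1_curve_points: "piecewise_C1_curve M \<gamma> \<Longrightarrow> t \<in> {0..1} \<Longrightarrow> \<gamma> t \<in> points M"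
  unfolding piecewise_C1_curve_def continuous_map_def by auto

text \<open>\<open>speed\<close> uses two-sided derivatives, while the C1 condition takes
  derivatives within a closed interval. Off the nodes both agree, in the interior of a small
  interval around t.\<close>

lemma piecewise_C1_curve_differentiable:
  assumes "piecewise_C1_curve M \<gamma>"
  obtains S where "finite S"
    "\<And>t c. t \<in> {0<..<1} - S \<Longrightarrow> c \<in> charts M \<Longrightarrow> \<gamma> t \<in> fst c \<Longrightarrow> (snd c \<circ> \<gamma>) differentiable (at t)"
proof -
  obtain S where S: "finite S"
    and C: "\<forall>s t. 0 \<le> s \<longrightarrow> s < t \<longrightarrow> t \<le> 1 \<longrightarrow> {s<..<t} \<inter> S = {} \<longrightarrow> C1_curve_on M s t \<gamma>"
    using conjunct2[OF iffD1[OF piecewise_C1_curve_iff assms]] by (elim exE conjE)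
  have "(snd c \<circ> \<gamma>) differentiable (at t)" if t: "t \<in> {0<..<1} - S" and c: "c \<in> charts M" "\<gamma> t \<in> fst c" for t c
  proof -
    have "open ({0<..<1} - S)" by (intro open_Diff open_greaterThanLessThan finite_imp_closed S)
    then obtain e where e: "e > 0" "ball t e \<subseteq> {0<..<1} - S" using t by (meson openE)
    define h where "h = e / 2"
    have h: "0 < h" "h < e" using e(1) by (simp_all add: h_def)
    have "{t - h..t + h} \<subseteq> ball t e" using h by (auto simp: dist_real_def)
    then have sub: "{t - h..t + h} \<subseteq> {0<..<1} - S" using e(2) by blast
    moreover have "t - h \<in> {t - h..t + h}" "t + h \<in> {t - h..t + h}" using h by simp_all
    ultimately have ends: "t - h \<in> {0<..<1}" "t + h \<in> {0<..<1}" by blast+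
    have "{t - h<..<t + h} \<subseteq> {t - h..t + h}" by (rule greaterThanLessThan_subseteq_atLeastAtMost_iff[THEN iffD2]) simp
    then have "{t - h<..<t + h} \<inter> S = {}" using sub by blast
    then have "C1_curve_on M (t - h) (t + h) \<gamma>"
      using C[rule_format, of "t - h" "t + h"] ends h by simp
    from this[unfolded C1_curve_on_iff, THEN bspec, OF c(1)]
    obtain D where "\<forall>\<tau>\<in>{t - h..t + h}. \<gamma> \<tau> \<in> fst c \<longrightarrow>
        (snd c \<circ> \<gamma> has_vector_derivative D \<tau>) (at \<tau> within {t - h..t + h})" by (elim exE conjE)
    then have "(snd c \<circ> \<gamma> has_vector_derivative D t) (at t within {t - h..t + h})"
      using c(2) h by simp
    moreover have "at t within {t - h..t + h} = at t"
      using h by (intro at_within_interior) auto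
    ultimately show ?thesis unfolding has_vector_derivative_def by (auto intro: differentiableI)
  qed
  then show ?thesis by (rule that[OF S])
qed

section \<open>Speed and length\<close>

context riemannian
begin

text \<open>The chart chosen inside \<open>speed\<close>. It depends on the point alone, so two
  curves through the same point are measured in the same chart.\<close>

definition speed_chart :: "'a \<Rightarrow> ('a, 'n) chart" where
  "speed_chart x = (SOME c. c \<in> charts M \<and> x \<in> cdom c)"

lemma speed_chart: "x \<in> points M \<Longrightarrow> speed_chart x \<in> charts M \<and> x \<in> cdom (speed_chart x)"
  unfolding speed_chart_def by (rule someI_ex) (metis chart_at)

lemma speed_eq:
  "speed M \<gamma> t = (let v = vector_derivative (snd (speed_chart (\<gamma> t)) \<circ> \<gamma>) (at t)
    in sqrt (v \<bullet> (gram M (speed_chart (\<gamma> t)) (\<gamma> t) *v v)))"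
  by (simp add: speed_def speed_chart_def Let_def)

lemma speed_nonneg: "\<gamma> t \<in> points M \<Longrightarrow> 0 \<le> speed M \<gamma> t"
  using speed_chart[of "\<gamma> t"] gram_nonneg by (simp add: speed_eq Let_def)

lemma speed_affine:
  assumes "open J" "t \<in> J" "\<And>\<tau>. \<tau> \<in> J \<Longrightarrow> \<delta> \<tau> = \<gamma> (\<alpha> * \<tau> + \<beta>)" "\<gamma> (\<alpha> * t + \<beta>) \<in> points M"
    and diff: "\<And>c. c \<in> charts M \<Longrightarrow> \<gamma> (\<alpha> * t + \<beta>) \<in> cdom c \<Longrightarrow> (snd c \<circ> \<gamma>) differentiable (at (\<alpha> * t + \<beta>))"
  shows "speed M \<delta> t = \<bar>\<alpha>\<bar> * speed M \<gamma> (\<alpha> * t + \<beta>)"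
proof -
  let ?\<sigma> = "\<lambda>\<tau>. \<alpha> * \<tau> + \<beta>"
  let ?c = "speed_chart (\<gamma> (?\<sigma> t))"
  let ?v = "vector_derivative (snd ?c \<circ> \<gamma>) (at (?\<sigma> t))"
  have c: "?c \<in> charts M" "\<gamma> (?\<sigma> t) \<in> cdom ?c" using speed_chart assms(4) by blast+
  have "(snd ?c \<circ> \<gamma> has_vector_derivative ?v) (at (?\<sigma> t))"
    using diff[OF c] vector_derivative_works by blast
  moreover have "(?\<sigma> has_vector_derivative \<alpha>) (at t)"
    by (auto intro!: derivative_eq_intros simp: has_real_derivative_iff_has_vector_derivative[symmetric])
  ultimately have "((snd ?c \<circ> \<gamma>) \<circ> ?\<sigma> has_vector_derivative \<alpha> *\<^sub>R ?v) (at t)"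
    by (rule vector_diff_chain_at[rotated])
  then have "(snd ?c \<circ> \<delta> has_vector_derivative \<alpha> *\<^sub>R ?v) (at t)"
    by (rule has_vector_derivative_transform_within_open[OF _ assms(1,2)]) (use assms(3) in auto)
  then have "vector_derivative (snd ?c \<circ> \<delta>) (at t) = \<alpha> *\<^sub>R ?v" by (rule vector_derivative_at)
  moreover have "\<delta> t = \<gamma> (?\<sigma> t)" using assms(2,3) by blast
  ultimately show ?thesis
    by (simp add: speed_eq Let_def scaleR_matrix_vector_assoc[symmetric] matrix_vector_mult_scaleR real_sqrt_mult
        mult.assoc[symmetric] flip: power2_eq_square)
qed

lemma curve_length_nonneg:
  assumes "piecewise_C1_curve M \<gamma>" shows "0 \<le> curve_length M \<gamma>"
proof (cases "speed M \<gamma> integrable_on {0..1}")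
  case True
  then show ?thesis unfolding curve_length_def
    by (rule integral_nonneg) (use speed_nonneg piecewise_C1_curve_points[OF assms] in blast)
qed (simp add: curve_length_def not_integrable_integral)

text \<open>Integrability is transferred from the new curve \<delta> to the given curve \<gamma>,
  which is the direction that bounds the length of \<delta> by that of \<gamma>.\<close>

lemma speed_has_integral_affine:
  assumes \<gamma>: "piecewise_C1_curve M \<gamma>" and \<alpha>: "\<alpha> \<noteq> 0"
    and onto: "(\<lambda>\<tau>. \<alpha> * \<tau> + \<beta>) ` {p..q} = {0..1}"
    and eq: "\<And>\<tau>. \<tau> \<in> {p<..<q} \<Longrightarrow> \<delta> \<tau> = \<gamma> (\<alpha> * \<tau> + \<beta>)"
    and I: "(speed M \<delta> has_integral I) {p..q}"
  shows "(speed M \<gamma> has_integral I) {0..1}"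
proof -
  obtain S where S: "finite S"
    "\<And>t c. t \<in> {0<..<1} - S \<Longrightarrow> c \<in> charts M \<Longrightarrow> \<gamma> t \<in> fst c \<Longrightarrow> (snd c \<circ> \<gamma>) differentiable (at t)"
    using piecewise_C1_curve_differentiable[OF \<gamma>] by metis
  have int: "((\<lambda>x. speed M \<delta> (1 / \<alpha> * x + - (\<beta> / \<alpha>))) has_integral \<bar>\<alpha>\<bar> * I) {0..1}"
    using has_integral_affinity[of "speed M \<delta>" I p q "1 / \<alpha>" "- (\<beta> / \<alpha>)"] I \<alpha> onto by (simp add: cbox_interval)
  \<comment> \<open>The finite exceptional set holds the nodes of \<gamma> and the images of the
    endpoints, around which \<delta> is not controlled on both sides.\<close>
  have spike: "\<bar>\<alpha>\<bar> * speed M \<gamma> x = speed M \<delta> (1 / \<alpha> * x + - (\<beta> / \<alpha>))"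
    if x: "x \<in> {0..1} - (S \<union> {0, 1, \<alpha> * p + \<beta>, \<alpha> * q + \<beta>})" for x
  proof -
    define t where "t = 1 / \<alpha> * x + - (\<beta> / \<alpha>)"
    have xt: "x = \<alpha> * t + \<beta>" using \<alpha> by (simp add: t_def field_simps)
    have "t \<in> {p..q}"
    proof -
      have "x \<in> (\<lambda>\<tau>. \<alpha> * \<tau> + \<beta>) ` {p..q}" using onto x by blast
      then obtain s where "s \<in> {p..q}" "x = \<alpha> * s + \<beta>" by blast
      then show ?thesis using xt \<alpha> by simp
    qed
    moreover have "t \<noteq> p" "t \<noteq> q" using x xt by auto
    ultimately have t: "t \<in> {p<..<q}" by simp
    have "speed M \<delta> t = \<bar>\<alpha>\<bar> * speed M \<gamma> (\<alpha> * t + \<beta>)"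
    proof (rule speed_affine[where J = "{p<..<q}"])
      show "\<delta> \<tau> = \<gamma> (\<alpha> * \<tau> + \<beta>)" if "\<tau> \<in> {p<..<q}" for \<tau> by (rule eq[OF that])
      show "\<gamma> (\<alpha> * t + \<beta>) \<in> points M"
        using piecewise_C1_curve_points[OF \<gamma>, of x] x xt by simp
      show "(snd c \<circ> \<gamma>) differentiable at (\<alpha> * t + \<beta>)" if "c \<in> charts M" "\<gamma> (\<alpha> * t + \<beta>) \<in> cdom c" for c
        using S(2)[of x c] that x xt by simp
    qed (use t in auto)
    then have "speed M \<delta> t = \<bar>\<alpha>\<bar> * speed M \<gamma> x" by (simp only: xt[symmetric])
    then show ?thesis by (simp add: t_def)
  qed
  have "((\<lambda>x. \<bar>\<alpha>\<bar> * speed M \<gamma> x) has_integral \<bar>\<alpha>\<bar> * I) {0..1}"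
  proof (rule has_integral_spike_finite[OF _ _ int])
    show "finite (S \<union> {0, 1, \<alpha> * p + \<beta>, \<alpha> * q + \<beta>})" using S(1) by simp
  qed (rule spike)
  then have "((\<lambda>x. inverse \<bar>\<alpha>\<bar> * (\<bar>\<alpha>\<bar> * speed M \<gamma> x)) has_integral inverse \<bar>\<alpha>\<bar> * (\<bar>\<alpha>\<bar> * I)) {0..1}"
    by (rule has_integral_mult_right)
  then show ?thesis using \<alpha> by (simp add: mult.assoc[symmetric])
qed

text \<open>Integrability of the speed is not needed: a speed that is not integrable has integral 0, which
  only helps in the upper bounds for reversed and joined curves.\<close>

lemma reverse_curve:
  assumes \<gamma>: "piecewise_C1_curve M \<gamma>"
  shows "piecewise_C1_curve M (\<lambda>t. \<gamma> (1 - t))" "curve_length M (\<lambda>t. \<gamma> (1 - t)) \<le> curve_length M \<gamma>"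
proof -
  let ?\<delta> = "\<lambda>t. \<gamma> (1 - t)"
  obtain S where cont: "continuous_map (top_of_set {0..1}) (mtop M) \<gamma>" and S: "finite S"
    and C: "\<forall>s t. 0 \<le> s \<longrightarrow> s < t \<longrightarrow> t \<le> 1 \<longrightarrow> {s<..<t} \<inter> S = {} \<longrightarrow> C1_curve_on M s t \<gamma>"
    using iffD1[OF piecewise_C1_curve_iff \<gamma>] by (elim exE conjE)
  have "C1_curve_on M s t ?\<delta>" if st: "0 \<le> s" "s < t" "t \<le> 1" "{s<..<t} \<inter> (\<lambda>x. 1 - x) ` S = {}" for s t
  proof (rule C1_curve_on_affine[where \<alpha> = "-1" and \<beta> = 1])
    have "{1 - t<..<1 - s} \<inter> S = {}"
    proof (rule ccontr)
      assume "{1 - t<..<1 - s} \<inter> S \<noteq> {}"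
      then obtain x where "x \<in> S" "1 - t < x" "x < 1 - s" by auto
      then have "1 - x \<in> {s<..<t} \<inter> (\<lambda>x. 1 - x) ` S" by auto
      then show False using st(4) by blast
    qed
    then show "C1_curve_on M (1 - t) (1 - s) \<gamma>" using C st by simp
  qed auto
  moreover have "continuous_map (top_of_set {0..1}) (mtop M) ?\<delta>"
  proof -
    have "continuous_map (top_of_set {0..1}) (top_of_set {0..1}) (\<lambda>t::real. 1 - t)"
      by (auto intro!: continuous_intros simp: continuous_map_in_subtopology)
    from continuous_map_compose[OF this cont] show ?thesis by (simp add: o_def)
  qed
  ultimately show \<delta>: "piecewise_C1_curve M ?\<delta>"
    unfolding piecewise_C1_curve_iff using S by (intro conjI exI[of _ "(\<lambda>x. 1 - x) ` S"]) auto
  show "curve_length M ?\<delta> \<le> curve_length M \<gamma>"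
  proof (cases "speed M ?\<delta> integrable_on {0..1}")
    case True
    then have "(speed M ?\<delta> has_integral curve_length M ?\<delta>) {0..1}"
      unfolding curve_length_def by (rule integrable_integral)
    then have "(speed M \<gamma> has_integral curve_length M ?\<delta>) {0..1}"
    proof (rule speed_has_integral_affine[OF \<gamma>, of "-1" 1, rotated -1])
      have "x \<in> (\<lambda>\<tau>. -1 * \<tau> + 1) ` {0..1}" if "x \<in> {0..1}" for x :: real
        using that by (intro image_eqI[where x = "1 - x"]) auto
      then show "(\<lambda>\<tau>. -1 * \<tau> + 1) ` {0..1} = {0..1::real}" by auto
    qed auto
    then show ?thesis unfolding curve_length_def[of M \<gamma>] by (simp add: integral_unique)
  next
    case False
    then show ?thesis using curve_length_nonneg[OF \<gamma>]
      by (simp add: curve_length_def not_integrable_integral)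
  qed
qed

definition join :: "(real \<Rightarrow> 'a) \<Rightarrow> (real \<Rightarrow> 'a) \<Rightarrow> real \<Rightarrow> 'a" where
  "join \<gamma>\<^sub>1 \<gamma>\<^sub>2 t = (if t \<le> 1 / 2 then \<gamma>\<^sub>1 (2 * t) else \<gamma>\<^sub>2 (2 * t - 1))"

lemma join_curve:
  assumes \<gamma>\<^sub>1: "piecewise_C1_curve M \<gamma>\<^sub>1" and \<gamma>\<^sub>2: "piecewise_C1_curve M \<gamma>\<^sub>2" and eq: "\<gamma>\<^sub>1 1 = \<gamma>\<^sub>2 0"
  shows "piecewise_C1_curve M (join \<gamma>\<^sub>1 \<gamma>\<^sub>2)"
    "curve_length M (join \<gamma>\<^sub>1 \<gamma>\<^sub>2) \<le> curve_length M \<gamma>\<^sub>1 + curve_length M \<gamma>\<^sub>2"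
proof -
  let ?\<delta> = "join \<gamma>\<^sub>1 \<gamma>\<^sub>2"
  obtain S\<^sub>1 where cont1: "continuous_map (top_of_set {0..1}) (mtop M) \<gamma>\<^sub>1" and S1: "finite S\<^sub>1"
    and C1: "\<forall>s t. 0 \<le> s \<longrightarrow> s < t \<longrightarrow> t \<le> 1 \<longrightarrow> {s<..<t} \<inter> S\<^sub>1 = {} \<longrightarrow> C1_curve_on M s t \<gamma>\<^sub>1"
    using iffD1[OF piecewise_C1_curve_iff \<gamma>\<^sub>1] by (elim exE conjE)
  obtain S\<^sub>2 where cont2: "continuous_map (top_of_set {0..1}) (mtop M) \<gamma>\<^sub>2" and S2: "finite S\<^sub>2"
    and C2: "\<forall>s t. 0 \<le> s \<longrightarrow> s < t \<longrightarrow> t \<le> 1 \<longrightarrow> {s<..<t} \<inter> S\<^sub>2 = {} \<longrightarrow> C1_curve_on M s t \<gamma>\<^sub>2"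
    using iffD1[OF piecewise_C1_curve_iff \<gamma>\<^sub>2] by (elim exE conjE)
  \<comment> \<open>The halved nodes of both curves and the junction, where the derivatives from the
    two sides may differ.\<close>
  define S where "S = (\<lambda>x. x / 2) ` S\<^sub>1 \<union> (\<lambda>x. (x + 1) / 2) ` S\<^sub>2 \<union> {1 / 2}"
  have "C1_curve_on M s t ?\<delta>" if st: "0 \<le> s" "s < t" "t \<le> 1" "{s<..<t} \<inter> S = {}" for s t
  proof -
    have "1 / 2 \<notin> {s<..<t}" using st(4) by (auto simp: S_def)
    then consider "t \<le> 1 / 2" | "1 / 2 \<le> s" by fastforce
    then show ?thesis
    proof cases
      case 1
      have "{2 * s<..<2 * t} \<inter> S\<^sub>1 = {}"
      proof (rule ccontr)
        assume "{2 * s<..<2 * t} \<inter> S\<^sub>1 \<noteq> {}"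
        then obtain x where "x \<in> S\<^sub>1" "2 * s < x" "x < 2 * t" by auto
        then have "x / 2 \<in> {s<..<t} \<inter> S" by (auto simp: S_def)
        then show False using st(4) by blast
      qed
      then have "C1_curve_on M (2 * s) (2 * t) \<gamma>\<^sub>1" using C1 st 1 by simp
      then show ?thesis
        by (rule C1_curve_on_affine[where \<alpha> = 2 and \<beta> = 0]) (use 1 in \<open>auto simp: join_def\<close>)
    next
      case 2
      have "{2 * s - 1<..<2 * t - 1} \<inter> S\<^sub>2 = {}"
      proof (rule ccontr)
        assume "{2 * s - 1<..<2 * t - 1} \<inter> S\<^sub>2 \<noteq> {}"
        then obtain x where "x \<in> S\<^sub>2" "2 * s - 1 < x" "x < 2 * t - 1" by auto
        then have "(x + 1) / 2 \<in> {s<..<t} \<inter> S" by (auto simp: S_def)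
        then show False using st(4) by blast
      qed
      then have "C1_curve_on M (2 * s - 1) (2 * t - 1) \<gamma>\<^sub>2" using C2 st 2 by simp
      \<comment> \<open>At 1/2 the value of \<open>join\<close> comes from the first curve; the
        matching endpoints extend the formula to the closed half.\<close>
      have "?\<delta> \<tau> = \<gamma>\<^sub>2 (2 * \<tau> + - 1)" if "1 / 2 \<le> \<tau>" for \<tau>
      proof (cases "\<tau> = 1 / 2")
        case True
        then show ?thesis unfolding True using eq by (simp add: join_def)
      qed (use that in \<open>auto simp: join_def\<close>)
      then show ?thesis
        by (intro C1_curve_on_affine[OF \<open>C1_curve_on M (2 * s - 1) (2 * t - 1) \<gamma>\<^sub>2\<close>, where \<alpha> = 2 and \<beta> = "- 1"])
          (use 2 in auto)
    qed
  qed
  moreover have "continuous_map (top_of_set {0..1}) (mtop M) ?\<delta>"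
    unfolding join_def[abs_def]
  proof (rule continuous_map_cases_le)
    show "continuous_map (top_of_set {0..1}) euclideanreal (\<lambda>t. t)" by simp
    show "continuous_map (subtopology (top_of_set {0..1}) {x \<in> topspace (top_of_set {0..1}). x \<le> 1 / 2}) (mtop M) (\<lambda>t. \<gamma>\<^sub>1 (2 * t))"
    proof -
      have "continuous_map (subtopology (top_of_set {0..1}) {x \<in> topspace (top_of_set {0..1}). x \<le> 1 / 2})
          (top_of_set {0..1}) (\<lambda>t::real. 2 * t)"
        by (auto intro!: continuous_intros simp: continuous_map_in_subtopology subtopology_subtopology)
      from continuous_map_compose[OF this cont1] show ?thesis by (simp add: o_def)
    qed
    show "continuous_map (subtopology (top_of_set {0..1}) {x \<in> topspace (top_of_set {0..1}). 1 / 2 \<le> x}) (mtop M) (\<lambda>t. \<gamma>\<^sub>2 (2 * t - 1))"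
    proof -
      have "continuous_map (subtopology (top_of_set {0..1}) {x \<in> topspace (top_of_set {0..1}). 1 / 2 \<le> x})
          (top_of_set {0..1}) (\<lambda>t::real. 2 * t - 1)"
        by (auto intro!: continuous_intros simp: continuous_map_in_subtopology subtopology_subtopology)
      from continuous_map_compose[OF this cont2] show ?thesis by (simp add: o_def)
    qed
    show "\<gamma>\<^sub>1 (2 * t) = \<gamma>\<^sub>2 (2 * t - 1)" if "t = 1 / 2" for t :: real
      unfolding that using eq by simp
  qed simp
  moreover have "finite S" using S1 S2 by (simp add: S_def)
  ultimately show \<delta>: "piecewise_C1_curve M ?\<delta>"
    unfolding piecewise_C1_curve_iff by (intro conjI exI[of _ S]) auto
  show "curve_length M ?\<delta> \<le> curve_length M \<gamma>\<^sub>1 + curve_length M \<gamma>\<^sub>2"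
  proof (cases "speed M ?\<delta> integrable_on {0..1}")
    case True
    define I\<^sub>1 where "I\<^sub>1 = integral {0..1/2} (speed M ?\<delta>)"
    define I\<^sub>2 where "I\<^sub>2 = integral {1/2..1} (speed M ?\<delta>)"
    have i1: "(speed M ?\<delta> has_integral I\<^sub>1) {0..1/2}"
      unfolding I\<^sub>1_def by (rule integrable_integral, rule integrable_subinterval_real[OF True]) simp
    have i2: "(speed M ?\<delta> has_integral I\<^sub>2) {1/2..1}"
      unfolding I\<^sub>2_def by (rule integrable_integral, rule integrable_subinterval_real[OF True]) simp
    have "(speed M ?\<delta> has_integral (I\<^sub>1 + I\<^sub>2)) {0..1}"
      by (rule has_integral_combine[OF _ _ i1 i2]) simp_all
    then have "curve_length M ?\<delta> = I\<^sub>1 + I\<^sub>2" by (simp add: curve_length_def integral_unique)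
    moreover have "(speed M \<gamma>\<^sub>1 has_integral I\<^sub>1) {0..1}"
    proof (rule speed_has_integral_affine[OF \<gamma>\<^sub>1, of 2 0, OF _ _ _ i1])
      have "x \<in> (\<lambda>\<tau>. 2 * \<tau> + 0) ` {0..1/2}" if "x \<in> {0..1}" for x :: real
        using that by (intro image_eqI[where x = "x / 2"]) auto
      then show "(\<lambda>\<tau>. 2 * \<tau> + 0) ` {0..1/2} = {0..1::real}" by auto
    qed (auto simp: join_def)
    moreover have "(speed M \<gamma>\<^sub>2 has_integral I\<^sub>2) {0..1}"
    proof (rule speed_has_integral_affine[OF \<gamma>\<^sub>2, of 2 "- 1", OF _ _ _ i2])
      have "x \<in> (\<lambda>\<tau>. 2 * \<tau> + - 1) ` {1/2..1}" if "x \<in> {0..1}" for x :: real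
        using that by (intro image_eqI[where x = "(x + 1) / 2"]) (auto simp: add_divide_distrib)
      then show "(\<lambda>\<tau>. 2 * \<tau> + - 1) ` {1/2..1} = {0..1::real}" by auto
    qed (auto simp: join_def)
    ultimately show ?thesis by (simp add: curve_length_def integral_unique)
  next
    case False
    then show ?thesis using curve_length_nonneg[OF \<gamma>\<^sub>1] curve_length_nonneg[OF \<gamma>\<^sub>2]
      by (simp add: curve_length_def not_integrable_integral)
  qed
qed

end

section \<open>The Riemannian distance\<close>

context riemannian
begin

lemma transition_curve:
  assumes c: "c \<in> charts M" "c' \<in> charts M" and z: "l t \<in> cimg c" "chart_inv c (l t) \<in> cdom c'"
    and l: "(l has_vector_derivative v) (at t)"
  shows "(snd c' \<circ> (\<lambda>s. chart_inv c (l s)) has_vector_derivative jac c c' (l t) v) (at t)"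
proof -
  have "l t \<in> snd c ` (cdom c \<inter> cdom c')"
    using z by (simp add: image_dom_Int[OF c(1) dom_subset[OF c(2)]])
  then have "(transition c c' has_derivative jac c c' (l t)) (at (l t) within l ` UNIV)"
    by (rule has_derivative_at_withinI[OF transition_has_derivative[OF c]])
  with l have "(transition c c' \<circ> l has_vector_derivative jac c c' (l t) v) (at t within UNIV)"
    by (intro vector_derivative_diff_chain_within) simp_all
  moreover have "transition c c' \<circ> l = snd c' \<circ> (\<lambda>s. chart_inv c (l s))"
    by (simp add: transition_def fun_eq_iff)
  ultimately show ?thesis by simp
qed

text \<open>In the chart c the segment has constant velocity y' - y, so the bound on the Gram form
  bounds its speed by K. \<open>speed\<close> may use another chart at each point; the
  transformation law leads back to c.\<close>

lemma segment_curve: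
  assumes c: "c \<in> charts M" and W: "convex W" "W \<subseteq> cimg c" "y \<in> W" "y' \<in> W" and K: "0 \<le> K"
    and bound: "\<And>z. z \<in> W \<Longrightarrow> (y' - y) \<bullet> (gram M c (chart_inv c z) *v (y' - y)) \<le> K\<^sup>2"
  shows "\<exists>\<gamma>. piecewise_C1_curve M \<gamma> \<and> \<gamma> 0 = chart_inv c y \<and> \<gamma> 1 = chart_inv c y' \<and> curve_length M \<gamma> \<le> K"
proof -
  define v where "v = y' - y"
  define l where "l t = y + t *\<^sub>R v" for t :: real
  define \<gamma> where "\<gamma> t = chart_inv c (l t)" for t
  have lW: "l t \<in> W" if "t \<in> {0..1}" for t
  proof -
    have "l t = (1 - t) *\<^sub>R y + t *\<^sub>R y'" by (simp add: l_def v_def algebra_simps)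
    then show ?thesis using W(1,3,4) that by (simp add: convexD)
  qed
  have l_img: "l t \<in> cimg c" if "t \<in> {0..1}" for t using lW[OF that] W(2) by blast
  have l_der: "(l has_vector_derivative v) (at t)" for t
    unfolding l_def[abs_def] by (auto intro!: derivative_eq_intros)
  have l_cont: "continuous_on S l" for S unfolding l_def[abs_def] by (intro continuous_intros)
  have der: "(snd c' \<circ> \<gamma> has_vector_derivative jac c c' (l t) v) (at t)"
    if "c' \<in> charts M" "t \<in> {0..1}" "\<gamma> t \<in> cdom c'" for c' t
    unfolding \<gamma>_def[abs_def] using that by (intro transition_curve[OF c _ _ _ l_der] l_img) (auto simp: \<gamma>_def)
  have "C1_curve_on M 0 1 \<gamma>"
    unfolding C1_curve_on_iff
  proof
    fix c' assume c': "c' \<in> charts M"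
    have "continuous_on {t \<in> {0..1}. \<gamma> t \<in> cdom c'} (\<lambda>t. jac c c' (l t) v)"
      by (rule continuous_on_compose2[OF jac_continuous[OF c c'] l_cont])
        (use l_img in \<open>auto simp: image_dom_Int[OF c dom_subset[OF c']] \<gamma>_def\<close>)
    moreover have "\<forall>t\<in>{0..1}. \<gamma> t \<in> cdom c' \<longrightarrow>
        (snd c' \<circ> \<gamma> has_vector_derivative jac c c' (l t) v) (at t within {0..1})"
      using der[OF c'] has_vector_derivative_at_within by blast
    ultimately show "\<exists>D. continuous_on {t \<in> {0..1}. \<gamma> t \<in> cdom c'} D \<and>
        (\<forall>t\<in>{0..1}. \<gamma> t \<in> cdom c' \<longrightarrow> (snd c' \<circ> \<gamma> has_vector_derivative D t) (at t within {0..1}))"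
      by (intro exI[where x = "\<lambda>t. jac c c' (l t) v"] conjI)
  qed
  then have "C1_curve_on M s t \<gamma>" if "0 \<le> s" "s < t" "t \<le> 1" for s t
    by (rule C1_curve_on_affine[where \<alpha> = 1 and \<beta> = 0]) (use that in auto)
  moreover have "continuous_map (top_of_set {0..1}) (mtop M) \<gamma>"
  proof -
    have "continuous_map (top_of_set {0..1}) (top_of_set (cimg c)) l"
      using l_cont l_img by (auto simp: continuous_map_in_subtopology)
    from continuous_map_compose[OF this chart_inv_continuous[OF c]] show ?thesis by (simp add: o_def \<gamma>_def[abs_def])
  qed
  ultimately have pw: "piecewise_C1_curve M \<gamma>"
    unfolding piecewise_C1_curve_iff by (intro conjI exI[of _ "{}"]) auto
  have speed: "speed M \<gamma> t \<le> K" if t: "t \<in> {0..1}" for t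
  proof -
    have in_c: "\<gamma> t \<in> cdom c" using chart_inv_in[OF c l_img[OF t]] by (simp add: \<gamma>_def)
    let ?c = "speed_chart (\<gamma> t)"
    have c': "?c \<in> charts M" "\<gamma> t \<in> cdom ?c" using speed_chart dom_subset[OF c] in_c by blast+
    have "vector_derivative (snd ?c \<circ> \<gamma>) (at t) = jac c ?c (l t) v"
      using der[OF c'(1) t c'(2)] by (rule vector_derivative_at)
    moreover have "snd c (\<gamma> t) = l t" using c l_img[OF t] by (simp add: \<gamma>_def)
    ultimately have "speed M \<gamma> t = sqrt (v \<bullet> (gram M c (\<gamma> t) *v v))"
      using gram_transform[OF c c'(1), of "\<gamma> t" v v] in_c c'(2) by (simp add: speed_eq Let_def)
    also have "\<dots> \<le> sqrt (K\<^sup>2)"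
      unfolding v_def \<gamma>_def by (rule real_sqrt_le_mono[OF bound[OF lW[OF t]]])
    finally show ?thesis using K by simp
  qed
  have "curve_length M \<gamma> \<le> K"
  proof (cases "speed M \<gamma> integrable_on {0..1}")
    case True
    then have "curve_length M \<gamma> \<le> integral {0..1} (\<lambda>_::real. K)"
      unfolding curve_length_def by (rule integral_le) (use speed in auto)
    then show ?thesis by simp
  qed (use K in \<open>simp add: curve_length_def not_integrable_integral\<close>)
  then show ?thesis using pw by (intro exI[of _ \<gamma>]) (simp add: \<gamma>_def l_def v_def)
qed

text \<open>Continuity of the Gram matrix at p. The factor 4 in the form is a factor 2 for lengths,
  and det / 4 is a factor 1/2 for the volume density.\<close>

lemma chart_nbhd:
  assumes c: "c \<in> charts M" and p: "p \<in> cdom c"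
  obtains \<rho> where "0 < \<rho>" "ball (snd c p) \<rho> \<subseteq> cimg c"
    "\<And>z v. z \<in> ball (snd c p) \<rho> \<Longrightarrow> v \<bullet> (gram M c (chart_inv c z) *v v) \<le> 4 * (v \<bullet> (gram M c p *v v))"
    "\<And>z. z \<in> ball (snd c p) \<rho> \<Longrightarrow> det (gram M c p) / 4 \<le> det (gram M c (chart_inv c z))"
proof -
  let ?G = "gram M c p"
  let ?g = "\<lambda>z. gram M c (chart_inv c z)"
  let ?N = "real CARD('n) * real CARD('n)"
  have "\<exists>l>0. \<forall>v. l * (norm v)\<^sup>2 \<le> v \<bullet> (?G *v v)"
    by (rule posdef_bounded_below[of ?G]) (rule gram_pos[OF c p], assumption, blast)
  then obtain l where l: "0 < l" "\<And>v. l * (norm v)\<^sup>2 \<le> v \<bullet> (?G *v v)" by (elim exE conjE) simp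
  have "\<exists>V :: real ^ 'n ^ 'n. transpose V ** ?G ** V = mat 1"
    by (rule posdef_orthonormal_matrix[OF gram_symmetric[OF c p]]) (rule gram_pos[OF c p], assumption, blast)
  then obtain V :: "real ^ 'n ^ 'n" where "transpose V ** ?G ** V = mat 1" by blast
  then have det: "0 < det ?G" by (rule posdef_det)
  have img: "snd c p \<in> cimg c" using p by blast
  have g_p: "?g (snd c p) = ?G" using c p by simp
  have "isCont ?g (snd c p)"
    using continuous_on_eq_continuous_at[OF chart_basics(2)[OF c], of ?g] gram_continuous[OF c] p by simp
  then have tg: "(?g \<longlongrightarrow> ?G) (nhds (snd c p))"
    using tendsto_at_iff_tendsto_nhds[of ?g "snd c p"] unfolding isCont_def g_p by simp
  have "continuous_on UNIV (det :: real ^ 'n ^ 'n \<Rightarrow> real)"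
    unfolding det_def[abs_def] by (intro continuous_intros)
  then have "isCont det ?G" by (simp add: continuous_on_eq_continuous_at)
  then have "((\<lambda>z. det (?g z)) \<longlongrightarrow> det ?G) (nhds (snd c p))" by (rule isCont_tendsto_compose[OF _ tg])
  then have e1: "eventually (\<lambda>z. det ?G / 4 < det (?g z)) (nhds (snd c p))"
    by (rule order_tendstoD) (use det in simp)
  \<comment> \<open>Here l is a lower bound of the form at p on the unit sphere. This closeness
    changes the form at v by at most 3 l |v|^2, hence by at most three times its value at p.\<close>
  have e2: "eventually (\<lambda>z. dist (?g z) ?G < 3 * l / ?N) (nhds (snd c p))"
    using tg by (rule tendstoD) (use l in simp)
  have e3: "eventually (\<lambda>z. z \<in> cimg c) (nhds (snd c p))"
    using chart_basics(2)[OF c] img by (rule eventually_nhds_in_open)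
  have "eventually (\<lambda>z. z \<in> cimg c \<and> dist (?g z) ?G < 3 * l / ?N \<and> det ?G / 4 < det (?g z)) (nhds (snd c p))"
    using e1 e2 e3 by eventually_elim simp
  then obtain \<rho> where \<rho>: "0 < \<rho>" and
    near: "\<And>z. dist z (snd c p) < \<rho> \<Longrightarrow> z \<in> cimg c \<and> dist (?g z) ?G < 3 * l / ?N \<and> det ?G / 4 < det (?g z)"
    unfolding eventually_nhds_metric by (elim exE conjE) simp
  show ?thesis
  proof (rule that[OF \<rho>])
    show "ball (snd c p) \<rho> \<subseteq> cimg c" using near by (auto simp: dist_commute)
    show "det ?G / 4 \<le> det (?g z)" if "z \<in> ball (snd c p) \<rho>" for z
      using near[of z] that by (simp add: dist_commute)
    show "v \<bullet> (?g z *v v) \<le> 4 * (v \<bullet> (?G *v v))" if "z \<in> ball (snd c p) \<rho>" for z v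
    proof -
      have "?N * norm (?g z - ?G) \<le> 3 * l"
        using near[of z] that by (simp add: dist_commute dist_norm norm_minus_commute[of _ ?G] field_simps)
      have "v \<bullet> (?g z *v v) - v \<bullet> (?G *v v) = v \<bullet> ((?g z - ?G) *v v)"
        by (simp add: matrix_vector_mult_diff_rdistrib inner_diff_right)
      also have "\<dots> \<le> norm v * norm ((?g z - ?G) *v v)" by (rule norm_cauchy_schwarz)
      also have "\<dots> \<le> norm v * (?N * norm (?g z - ?G) * norm v)"
        by (intro mult_left_mono norm_matrix_vector_le) simp
      also have "\<dots> = ?N * norm (?g z - ?G) * (norm v)\<^sup>2" by (simp add: power2_eq_square)
      also have "\<dots> \<le> 3 * l * (norm v)\<^sup>2"
        using \<open>?N * norm (?g z - ?G) \<le> 3 * l\<close> by (rule mult_right_mono) simp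
      also have "\<dots> \<le> 3 * (v \<bullet> (?G *v v))" using l(2)[of v] by simp
      finally show ?thesis by simp
    qed
  qed
qed

text \<open>Keeps the curve itself: before any two points are known to be joined,
  \<open>rdist\<close> could be the infimum of the empty set, and a bound on it would say
  nothing.\<close>

definition joined_within :: "'a \<Rightarrow> 'a \<Rightarrow> real \<Rightarrow> bool" where
  "joined_within x y r \<longleftrightarrow> (\<exists>\<gamma>. piecewise_C1_curve M \<gamma> \<and> \<gamma> 0 = x \<and> \<gamma> 1 = y \<and> curve_length M \<gamma> < r)"

lemma joined_within_nbhd:
  assumes p: "p \<in> points M" and \<epsilon>: "0 < \<epsilon>"
  shows "\<exists>T. openin (mtop M) T \<and> p \<in> T \<and> (\<forall>q\<in>T. joined_within p q \<epsilon>)"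
proof -
  obtain c where c: "c \<in> charts M" "p \<in> cdom c" using chart_at[OF p] .
  obtain \<rho> where \<rho>: "0 < \<rho>" "ball (snd c p) \<rho> \<subseteq> cimg c"
    "\<And>z v. z \<in> ball (snd c p) \<rho> \<Longrightarrow> v \<bullet> (gram M c (chart_inv c z) *v v) \<le> 4 * (v \<bullet> (gram M c p *v v))"
    by (rule chart_nbhd[OF c]) (rule that; blast)
  define h where "h z = (z - snd c p) \<bullet> (gram M c p *v (z - snd c p))" for z
  \<comment> \<open>\<open>sqrt (4 * h z)\<close> is twice the length of the segment from p to z in
    the constant metric at p, and so bounds its Riemannian length.\<close>
  define W where "W = ball (snd c p) \<rho> \<inter> {z. sqrt (4 * h z) < \<epsilon>}"
  have "continuous_on UNIV (\<lambda>z. sqrt (4 * h z))"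
    unfolding h_def by (intro continuous_intros continuous_on_compose2[OF linear_continuous_on[OF matrix_vector_mul_bounded_linear], of UNIV]) auto
  then have W: "open W" unfolding W_def by (intro open_Int open_ball open_Collect_less continuous_on_const)
  have "joined_within p q \<epsilon>" if q: "q \<in> {x \<in> cdom c. snd c x \<in> W}" for q
  proof -
    have h0: "0 \<le> h z" for z using gram_nonneg[OF c] by (simp add: h_def)
    have "\<exists>\<gamma>. piecewise_C1_curve M \<gamma> \<and> \<gamma> 0 = chart_inv c (snd c p) \<and> \<gamma> 1 = chart_inv c (snd c q) \<and>
        curve_length M \<gamma> \<le> sqrt (4 * h (snd c q))"
      by (rule segment_curve[OF c(1) convex_ball \<rho>(2)]) (use q \<rho> h0 in \<open>auto simp: W_def h_def\<close>)
    then obtain \<gamma> where "piecewise_C1_curve M \<gamma>" "\<gamma> 0 = p" "\<gamma> 1 = q" "curve_length M \<gamma> \<le> sqrt (4 * h (snd c q))"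
      using c q by auto
    then show ?thesis unfolding joined_within_def using q by (intro exI[of _ \<gamma>]) (simp add: W_def)
  qed
  moreover have "p \<in> {x \<in> cdom c. snd c x \<in> W}" using c \<rho>(1) \<epsilon> by (simp add: W_def h_def)
  ultimately show ?thesis
    using chart_preimage_openin[OF c(1) W] by (intro exI[of _ "{x \<in> cdom c. snd c x \<in> W}"]) simp
qed

definition joined :: "'a \<Rightarrow> 'a \<Rightarrow> bool" where
  "joined x y \<longleftrightarrow> (\<exists>\<gamma>. piecewise_C1_curve M \<gamma> \<and> \<gamma> 0 = x \<and> \<gamma> 1 = y)"

lemma joined_sym:
  assumes "joined x y" shows "joined y x"
proof -
  obtain \<gamma> where "piecewise_C1_curve M \<gamma>" "\<gamma> 0 = x" "\<gamma> 1 = y" using assms unfolding joined_def by blast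
  then show ?thesis unfolding joined_def
    by (intro exI[of _ "\<lambda>t. \<gamma> (1 - t)"]) (simp add: reverse_curve(1))
qed

lemma joined_trans:
  assumes "joined x y" "joined y z" shows "joined x z"
proof -
  obtain \<gamma>\<^sub>1 where 1: "piecewise_C1_curve M \<gamma>\<^sub>1" "\<gamma>\<^sub>1 0 = x" "\<gamma>\<^sub>1 1 = y"
    using assms(1) unfolding joined_def by blast
  obtain \<gamma>\<^sub>2 where 2: "piecewise_C1_curve M \<gamma>\<^sub>2" "\<gamma>\<^sub>2 0 = y" "\<gamma>\<^sub>2 1 = z"
    using assms(2) unfolding joined_def by blast
  have "piecewise_C1_curve M (join \<gamma>\<^sub>1 \<gamma>\<^sub>2)" by (rule join_curve(1)[OF 1(1) 2(1)]) (simp add: 1 2)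
  then show ?thesis unfolding joined_def
    by (intro exI[of _ "join \<gamma>\<^sub>1 \<gamma>\<^sub>2"]) (simp add: join_def 1 2)
qed

text \<open>Points near p are joined to p, so the set of points joined to x and its complement are
  both open; connectedness leaves only the whole manifold.\<close>

lemma joined_points:
  assumes "x \<in> points M" "y \<in> points M" shows "joined x y"
proof -
  let ?R = "{y \<in> points M. joined x y}"
  have nb: "\<exists>T. openin (mtop M) T \<and> p \<in> T \<and> (\<forall>q\<in>T. joined p q)" if p: "p \<in> points M" for p
    using joined_within_nbhd[OF p zero_less_one] unfolding joined_def joined_within_def by meson
  have "openin (mtop M) ?R"
    unfolding openin_subopen[of _ ?R]
  proof
    fix p assume p: "p \<in> ?R"
    then obtain T where T: "openin (mtop M) T" "p \<in> T" "\<forall>q\<in>T. joined p q" using nb by blast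
    then have "T \<subseteq> ?R" using p joined_trans openin_subset by blast
    then show "\<exists>T. openin (mtop M) T \<and> p \<in> T \<and> T \<subseteq> ?R" using T by blast
  qed
  moreover have "openin (mtop M) (points M - ?R)"
    unfolding openin_subopen[of _ "points M - ?R"]
  proof
    fix p assume p: "p \<in> points M - ?R"
    then obtain T where T: "openin (mtop M) T" "p \<in> T" "\<forall>q\<in>T. joined p q" using nb by blast
    then have "T \<subseteq> points M - ?R" using p joined_trans joined_sym openin_subset by blast
    then show "\<exists>T. openin (mtop M) T \<and> p \<in> T \<and> T \<subseteq> points M - ?R" using T by blast
  qed
  ultimately have "openin (mtop M) ?R \<and> closedin (mtop M) ?R" by (auto simp: closedin_def)
  moreover have "connected_space (mtop M)" using manifold by (simp add: riemannian_manifold_def)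
  ultimately have "?R = {} \<or> ?R = points M" unfolding connected_space_clopen_in by blast
  moreover have "x \<in> ?R" using nb[OF assms(1)] assms(1) by blast
  ultimately show ?thesis using assms(2) by blast
qed

lemma rdist_le:
  assumes "piecewise_C1_curve M \<gamma>" "\<gamma> 0 = x" "\<gamma> 1 = y" shows "rdist M x y \<le> curve_length M \<gamma>"
  unfolding rdist_def
proof (rule cInf_lower)
  show "bdd_below {curve_length M \<gamma> | \<gamma>. piecewise_C1_curve M \<gamma> \<and> \<gamma> 0 = x \<and> \<gamma> 1 = y}"
    using curve_length_nonneg by (intro bdd_belowI[of _ 0]) blast
qed (use assms in blast)

lemma rdist_approx:
  assumes "x \<in> points M" "y \<in> points M" "rdist M x y < r"
  obtains \<gamma> where "piecewise_C1_curve M \<gamma>" "\<gamma> 0 = x" "\<gamma> 1 = y" "curve_length M \<gamma> < r"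
proof -
  have "{curve_length M \<gamma> | \<gamma>. piecewise_C1_curve M \<gamma> \<and> \<gamma> 0 = x \<and> \<gamma> 1 = y} \<noteq> {}"
    using joined_points[OF assms(1,2)] unfolding joined_def by blast
  from cInf_lessD[OF this assms(3)[unfolded rdist_def]] show ?thesis using that by blast
qed

lemma rdist_nonneg:
  assumes "x \<in> points M" "y \<in> points M" shows "0 \<le> rdist M x y"
proof (rule ccontr)
  assume "\<not> 0 \<le> rdist M x y"
  then have "rdist M x y < 0" by simp
  from rdist_approx[OF assms this] curve_length_nonneg show False by (metis not_less)
qed

lemma rdist_nbhd:
  assumes p: "p \<in> points M" and \<epsilon>: "0 < \<epsilon>"
  shows "\<exists>T. openin (mtop M) T \<and> p \<in> T \<and> (\<forall>q\<in>T. rdist M p q < \<epsilon>)"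
proof -
  have "rdist M p q < \<epsilon>" if "joined_within p q \<epsilon>" for q
    using that rdist_le unfolding joined_within_def by (meson le_less_trans)
  then show ?thesis using joined_within_nbhd[OF assms] by meson
qed

text \<open>Reversed and joined curves are no longer than the originals allow, and these one-sided
  estimates suffice: symmetry follows by exchanging the points, the triangle inequality from almost
  minimal curves.\<close>

sublocale pm: pseudometric "points M" "rdist M"
proof
  fix x y z assume x: "x \<in> points M" and y: "y \<in> points M"
  show "0 \<le> rdist M x y" by (rule rdist_nonneg[OF x y])
  have "rdist M x x \<le> \<epsilon>" if "0 < \<epsilon>" for \<epsilon>
    using rdist_nbhd[OF x that] less_imp_le by blast
  then show "rdist M x x = 0" using rdist_nonneg[OF x x] field_le_epsilon[of "rdist M x x" 0] by simp
  have le: "rdist M q p \<le> rdist M p q" if pq: "p \<in> points M" "q \<in> points M" for p q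
  proof (rule ccontr)
    assume "\<not> rdist M q p \<le> rdist M p q"
    then have "rdist M p q < rdist M q p" by simp
    then obtain \<gamma> where \<gamma>: "piecewise_C1_curve M \<gamma>" "\<gamma> 0 = p" "\<gamma> 1 = q" "curve_length M \<gamma> < rdist M q p"
      using rdist_approx[OF pq] by blast
    have "rdist M q p \<le> curve_length M (\<lambda>t. \<gamma> (1 - t))"
      by (rule rdist_le) (use \<gamma> reverse_curve(1) in auto)
    then show False using reverse_curve(2)[OF \<gamma>(1)] \<gamma>(4) by linarith
  qed
  then show "rdist M x y = rdist M y x" using x y by (simp add: antisym)
  assume z: "z \<in> points M"
  show "rdist M x z \<le> rdist M x y + rdist M y z"
  proof (rule field_le_epsilon)
    fix e :: real assume e: "0 < e"
    obtain \<gamma>\<^sub>1 where 1: "piecewise_C1_curve M \<gamma>\<^sub>1" "\<gamma>\<^sub>1 0 = x" "\<gamma>\<^sub>1 1 = y" "curve_length M \<gamma>\<^sub>1 < rdist M x y + e / 2"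
      using rdist_approx[OF x y, of "rdist M x y + e / 2"] e by auto
    obtain \<gamma>\<^sub>2 where 2: "piecewise_C1_curve M \<gamma>\<^sub>2" "\<gamma>\<^sub>2 0 = y" "\<gamma>\<^sub>2 1 = z" "curve_length M \<gamma>\<^sub>2 < rdist M y z + e / 2"
      using rdist_approx[OF y z, of "rdist M y z + e / 2"] e by auto
    have "rdist M x z \<le> curve_length M (join \<gamma>\<^sub>1 \<gamma>\<^sub>2)"
      by (rule rdist_le) (use 1 2 join_curve(1) in \<open>auto simp: join_def\<close>)
    also have "\<dots> \<le> curve_length M \<gamma>\<^sub>1 + curve_length M \<gamma>\<^sub>2"
      by (rule join_curve(2)) (use 1 2 in auto)
    finally show "rdist M x z \<le> rdist M x y + rdist M y z + e" using 1 2 by linarith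
  qed
qed

text \<open>Makes metric balls Borel for \<open>rvol\<close>, whose sigma-algebra comes from the
  manifold topology.\<close>

lemma openin_rball:
  assumes x: "x \<in> points M" shows "openin (mtop M) (rball M x r)"
  unfolding openin_subopen[of _ "rball M x r"]
proof
  fix y assume "y \<in> rball M x r"
  then have y: "y \<in> points M" "rdist M x y < r" by (auto simp: open_ball_def)
  then obtain T where T: "openin (mtop M) T" "y \<in> T" "\<forall>q\<in>T. rdist M y q < r - rdist M x y"
    using rdist_nbhd[of y "r - rdist M x y"] by auto
  have "T \<subseteq> rball M x r"
  proof
    fix q assume q: "q \<in> T"
    then have "q \<in> points M" using T(1) openin_subset by blast
    then show "q \<in> rball M x r"
      using pm.tri[OF x y(1), of q] T(3) q by (force simp: open_ball_def)
  qed
  then show "\<exists>T. openin (mtop M) T \<and> y \<in> T \<and> T \<subseteq> rball M x r" using T by blast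
qed

end

section \<open>The Riemannian volume\<close>

lemma ennreal_suminf_swap:
  fixes f :: "nat \<Rightarrow> nat \<Rightarrow> ennreal"
  shows "(\<Sum>i. \<Sum>j. f i j) = (\<Sum>j. \<Sum>i. f i j)"
  using nn_integral_suminf[of "\<lambda>j i. f i j" "count_space UNIV"] by (simp add: nn_integral_count_space_nat)

context riemannian
begin

text \<open>Stands for the Borel sigma-algebra as long as \<open>rvol\<close> is not yet known to
  exist.\<close>

definition borelM :: "'a measure" where
  "borelM = sigma (points M) {U. openin (mtop M) U}"

lemma opens_Pow: "{U. openin (mtop M) U} \<subseteq> Pow (points M)"
  using openin_subset by auto

lemma space_borelM: "space borelM = points M"
  unfolding borelM_def by (rule space_measure_of[OF opens_Pow])

lemma sets_borelM: "sets borelM = sigma_sets (points M) {U. openin (mtop M) U}"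
  unfolding borelM_def by (rule sets_measure_of[OF opens_Pow])

lemma openin_borelM: "openin (mtop M) U \<Longrightarrow> U \<in> sets borelM"
  unfolding sets_borelM by blast

lemma cdom_borelM: "c \<in> charts M \<Longrightarrow> cdom c \<in> sets borelM"
  using chart_basics(1) openin_borelM by blast

lemma borelM_subset: "B \<in> sets borelM \<Longrightarrow> B \<subseteq> points M"
  using sets.sets_into_space[of B borelM] by (simp add: space_borelM)

lemma image_borel:
  assumes c: "c \<in> charts M" and B: "B \<in> sets borelM" "B \<subseteq> cdom c"
  shows "snd c ` B \<in> sets borel"
proof -
  have img: "cimg c \<in> sets borel" using chart_basics(2)[OF c] by simp
  have "chart_inv c \<in> measurable (restrict_space borel (cimg c)) borelM"
    unfolding borelM_def
  proof (rule measurable_measure_of[OF opens_Pow])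
    show "chart_inv c \<in> space (restrict_space borel (cimg c)) \<rightarrow> points M"
      using chart_inv_in[OF c] dom_subset[OF c] by (auto simp: space_restrict_space)
    fix U assume "U \<in> {U. openin (mtop M) U}"
    then have "open {y \<in> cimg c. chart_inv c y \<in> U}" using chart_inv_preimage_open[OF c] by blast
    moreover have "chart_inv c -` U \<inter> space (restrict_space borel (cimg c)) = {y \<in> cimg c. chart_inv c y \<in> U}"
      by (auto simp: space_restrict_space)
    ultimately show "chart_inv c -` U \<inter> space (restrict_space borel (cimg c)) \<in> sets (restrict_space borel (cimg c))"
      using img by (subst sets_restrict_space_iff) auto
  qed
  from measurable_sets[OF this B(1)] have "chart_inv c -` B \<inter> cimg c \<in> sets borel"
    using img by (simp add: space_restrict_space sets_restrict_space_iff)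
  moreover have "snd c ` B = chart_inv c -` B \<inter> cimg c"
    using image_dom_Int[OF c borelM_subset[OF B(1)]] B(2) by (auto simp: Int_absorb1)
  ultimately show ?thesis by simp
qed

text \<open>The extension by zero makes the density Borel measurable on the whole coordinate
  space.\<close>

definition vdens :: "('a, 'n) chart \<Rightarrow> real ^ 'n \<Rightarrow> real" where
  "vdens c y = (if y \<in> cimg c then sqrt (det (gram M c (chart_inv c y))) else 0)"

lemma det_gram_pos: "c \<in> charts M \<Longrightarrow> x \<in> cdom c \<Longrightarrow> 0 < det (gram M c x)"
  by (rule posdef_orthonormal_matrix[OF gram_symmetric, of c x])
    (auto intro: gram_pos posdef_det(1))

lemma vdens_nonneg: "c \<in> charts M \<Longrightarrow> 0 \<le> vdens c y"
  unfolding vdens_def using det_gram_pos[OF _ chart_inv_in, of c y] by (simp add: less_imp_le del: image_iff)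

lemma continuous_on_det: "continuous_on S (det :: real ^ 'n ^ 'n \<Rightarrow> real)"
  unfolding det_def[abs_def] by (intro continuous_intros)

lemma vdens_measurable:
  assumes c: "c \<in> charts M" shows "vdens c \<in> borel_measurable borel"
proof -
  have "continuous_on (cimg c) (\<lambda>y. sqrt (det (gram M c (chart_inv c y))))"
    by (intro continuous_intros continuous_on_compose2[OF continuous_on_det gram_continuous[OF c]]) auto
  then have "(\<lambda>y. indicator (cimg c) y *\<^sub>R sqrt (det (gram M c (chart_inv c y)))) \<in> borel_measurable borel"
    using chart_basics(2)[OF c] by (intro borel_measurable_continuous_on_indicator) auto
  moreover have "vdens c = (\<lambda>y. indicator (cimg c) y *\<^sub>R sqrt (det (gram M c (chart_inv c y))))"
    by (auto simp: vdens_def fun_eq_iff)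
  ultimately show ?thesis by simp
qed

definition chart_vol :: "('a, 'n) chart \<Rightarrow> 'a set \<Rightarrow> ennreal" where
  "chart_vol c B = (\<integral>\<^sup>+ y \<in> snd c ` B. ennreal (vdens c y) \<partial>lborel)"

lemma chart_vol_eq:
  assumes "B \<subseteq> cdom c"
  shows "chart_vol c B = (\<integral>\<^sup>+ y \<in> snd c ` B. ennreal (sqrt (det (gram M c (chart_inv c y)))) \<partial>lborel)"
  unfolding chart_vol_def
  by (rule set_nn_integral_cong) (use assms in \<open>auto simp: vdens_def\<close>)

lemma chart_vol_suminf:
  assumes c: "c \<in> charts M" and B: "\<And>i::nat. B i \<in> sets borelM" "\<And>i. B i \<subseteq> cdom c" and disj: "disjoint_family B"
  shows "chart_vol c (\<Union>i. B i) = (\<Sum>i. chart_vol c (B i))"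
proof -
  have "disjoint_family (\<lambda>i. snd c ` B i)"
    using disj inj_on_image_Int[OF chart_inj[OF c] B(2) B(2)] unfolding disjoint_family_on_def by (metis image_empty)
  moreover have "(\<lambda>y. ennreal (vdens c y)) \<in> borel_measurable lborel" using vdens_measurable[OF c] by simp
  ultimately show ?thesis unfolding chart_vol_def image_UN
    by (intro nn_integral_disjoint_family) (simp_all add: image_borel[OF c B(1) B(2)])
qed

lemma jac_inverse:
  assumes c: "c \<in> charts M" "c' \<in> charts M" and x: "x \<in> cdom c" "x \<in> cdom c'"
  shows "jac c' c (snd c' x) \<circ> jac c c' (snd c x) = id"
proof -
  let ?O = "snd c ` (cdom c \<inter> cdom c')"
  have xO: "snd c x \<in> ?O" using x by blast
  have t: "transition c c' (snd c x) = snd c' x" using transition_apply[OF c(1) x(1)] .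
  have "(transition c' c has_derivative jac c' c (snd c' x)) (at (transition c c' (snd c x)))"
    unfolding t by (rule transition_has_derivative[OF c(2,1)]) (use x in blast)
  then have "(transition c' c \<circ> transition c c' has_derivative jac c' c (snd c' x) \<circ> jac c c' (snd c x)) (at (snd c x))"
    by (rule diff_chain_at[OF transition_has_derivative[OF c xO]])
  moreover have "(transition c' c \<circ> transition c c' has_derivative id) (at (snd c x))"
  proof (rule has_derivative_transform_within_open[OF _ open_overlap[OF c] xO])
    show "(id has_derivative id) (at (snd c x))" by (rule has_derivative_id)
    show "id y = (transition c' c \<circ> transition c c') y" if "y \<in> ?O" for y
      using that c by (auto simp: transition_def)
  qed
  ultimately show ?thesis by (rule has_derivative_unique)
qed

text \<open>The transformation law makes the Gram matrices congruent by the Jacobian; the claim is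
  the square root of the resulting equation of determinants.\<close>

lemma vdens_transform:
  assumes c: "c \<in> charts M" "c' \<in> charts M" and x: "x \<in> cdom c" "x \<in> cdom c'"
  shows "vdens c (snd c x) = \<bar>det (matrix (jac c c' (snd c x)))\<bar> * vdens c' (snd c' x)"
proof -
  let ?J = "matrix (jac c c' (snd c x))"
  have lin: "linear (jac c c' (snd c x))" by (rule linear_jac[OF c]) (use x in blast)
  have J: "jac c c' (snd c x) v = ?J *v v" for v by (rule fun_cong[OF matrix_vector_mul(2)[OF lin], symmetric])
  have "v \<bullet> (gram M c x *v w) = v \<bullet> ((transpose ?J ** gram M c' x ** ?J) *v w)" for v w
  proof -
    have "v \<bullet> (gram M c x *v w) = (?J *v v) \<bullet> (gram M c' x *v (?J *v w))"
      using gram_transform[OF c, of x v w] x by (simp only: J[symmetric] IntI)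
    also have "\<dots> = v \<bullet> (transpose ?J *v (gram M c' x *v (?J *v w)))"
      by (metis dot_lmul_matrix transpose_matrix_vector transpose_transpose)
    finally show ?thesis by (simp add: matrix_vector_mul_assoc matrix_mul_assoc)
  qed
  then have "gram M c x *v w = (transpose ?J ** gram M c' x ** ?J) *v w" for w
    using vector_eq_ldot by blast
  then have "gram M c x = transpose ?J ** gram M c' x ** ?J" by (simp add: matrix_eq)
  then have "det (gram M c x) = (det ?J)\<^sup>2 * det (gram M c' x)"
    by (simp add: det_mul power2_eq_square mult_ac)
  then show ?thesis using c x by (simp add: vdens_def real_sqrt_mult)
qed

text \<open>The change of variables by the transition map, whose Jacobian factor is exactly the one
  in the transformation of the densities.\<close>

lemma chart_vol_consistent:
  assumes c: "c \<in> charts M" "c' \<in> charts M" and B: "B \<in> sets borelM" "B \<subseteq> cdom c" "B \<subseteq> cdom c'"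
  shows "chart_vol c B = chart_vol c' B"
proof -
  let ?S = "snd c ` B" and ?T = "snd c' ` B"
  have S: "?S \<in> sets borel" by (rule image_borel[OF c(1) B(1,2)])
  have T: "?T \<in> sets borel" by (rule image_borel[OF c(2) B(1,3)])
  \<comment> \<open>Identifies the transformed integrand with the density of c, which also settles
    its measurability.\<close>
  have eqS: "(\<lambda>y. if y \<in> ?S then \<bar>det (matrix (jac c c' y))\<bar> * vdens c' (transition c c' y) else 0)
      = (\<lambda>y. if y \<in> ?S then vdens c y else 0)"
  proof -
    have "\<bar>det (matrix (jac c c' y))\<bar> * vdens c' (transition c c' y) = vdens c y" if y: "y \<in> ?S" for y
    proof -
      obtain x where x: "x \<in> B" "y = snd c x" using y by blast
      then have "x \<in> cdom c" "x \<in> cdom c'" using B by auto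
      then show ?thesis using vdens_transform[OF c, of x] transition_apply[OF c(1), of x c'] x(2) by simp
    qed
    then show ?thesis by (simp add: fun_eq_iff)
  qed
  have "(\<integral>\<^sup>+ y. ennreal (if y \<in> ?S then \<bar>det (matrix (jac c c' y))\<bar> * vdens c' (transition c c' y) else 0) \<partial>lborel)
    = (\<integral>\<^sup>+ y. ennreal (if y \<in> ?T then vdens c' y else 0) \<partial>lborel)"
  proof (rule nn_integral_change_of_variables[where h = "transition c' c" and h' = "jac c' c"])
    show "(transition c c' has_derivative jac c c' y) (at y within ?S)" if "y \<in> ?S" for y
      by (rule has_derivative_at_withinI, rule transition_has_derivative[OF c]) (use that B in blast)
    show "(transition c' c has_derivative jac c' c y) (at y within ?T)" if "y \<in> ?T" for y
      by (rule has_derivative_at_withinI, rule transition_has_derivative[OF c(2,1)]) (use that B in blast)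
    show "transition c c' y \<in> ?T \<and> transition c' c (transition c c' y) = y" if y: "y \<in> ?S" for y
    proof -
      obtain x where x: "x \<in> B" "y = snd c x" using y by blast
      then have "x \<in> cdom c" "x \<in> cdom c'" using B by auto
      then show ?thesis using x transition_apply[OF c(1), of x c'] transition_apply[OF c(2), of x c] by auto
    qed
    show inv: "transition c' c y \<in> ?S \<and> transition c c' (transition c' c y) = y" if y: "y \<in> ?T" for y
    proof -
      obtain x where x: "x \<in> B" "y = snd c' x" using y by blast
      then have "x \<in> cdom c" "x \<in> cdom c'" using B by auto
      then show ?thesis using x transition_apply[OF c(1), of x c'] transition_apply[OF c(2), of x c] by auto
    qed
    show "jac c' c y \<circ> jac c c' (transition c' c y) = id" if y: "y \<in> ?T" for y
    proof -
      obtain x where x: "x \<in> B" "y = snd c' x" using y by blast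
      then have "x \<in> cdom c" "x \<in> cdom c'" using B by auto
      then show ?thesis using x transition_apply[OF c(2), of x c] jac_inverse[OF c, of x] by simp
    qed
    show "(\<lambda>y. if y \<in> ?S then \<bar>det (matrix (jac c c' y))\<bar> * vdens c' (transition c c' y) else 0) \<in> borel_measurable borel"
      unfolding eqS using vdens_measurable[OF c(1)] S by (intro measurable_If_set) auto
    show "(\<lambda>y. if y \<in> ?T then vdens c' y else 0) \<in> borel_measurable borel"
      using vdens_measurable[OF c(2)] T by (intro measurable_If_set) auto
  qed (rule vdens_nonneg[OF c(2)])
  moreover have "ennreal (if y \<in> ?S then \<bar>det (matrix (jac c c' y))\<bar> * vdens c' (transition c c' y) else 0)
      = ennreal (vdens c y) * indicator ?S y" for y
    unfolding fun_cong[OF eqS] by (simp add: indicator_def)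
  moreover have "ennreal (if y \<in> ?T then vdens c' y else 0) = ennreal (vdens c' y) * indicator ?T y" for y
    by (simp add: indicator_def)
  ultimately show ?thesis unfolding chart_vol_def by simp
qed

lemma ex_countable_charts:
  assumes "points M \<noteq> {}"
  shows "\<exists>c :: nat \<Rightarrow> ('a, 'n) chart. (\<forall>i. c i \<in> charts M) \<and> (\<Union>i. cdom (c i)) = points M"
proof -
  have L: "Lindelof_space (mtop M)"
    by (rule second_countable_imp_Lindelof_space) (use manifold in \<open>simp add: riemannian_manifold_def\<close>)
  have Un: "\<Union>(fst ` charts M) = points M"
  proof
    show "points M \<subseteq> \<Union>(fst ` charts M)"
    proof
      fix x assume "x \<in> points M"
      then obtain c where "c \<in> charts M" "x \<in> cdom c" by (rule chart_at)
      then show "x \<in> \<Union>(fst ` charts M)" by blast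
    qed
  qed (use dom_subset in blast)
  have op: "openin (mtop M) U" if "U \<in> fst ` charts M" for U
    using that chart_basics(1) by blast
  have "\<exists>\<V>. countable \<V> \<and> \<V> \<subseteq> fst ` charts M \<and> \<Union>\<V> = points M"
    by (rule Lindelof_spaceD[OF L _ Un]) (rule op)
  then obtain \<V> where V: "countable \<V>" "\<V> \<subseteq> fst ` charts M" "\<Union>\<V> = points M"
    by (elim exE conjE)
  have ne: "\<V> \<noteq> {}" using V(3) assms by (metis Sup_empty)
  have "\<exists>c\<in>charts M. cdom c = from_nat_into \<V> i" for i
    using subsetD[OF V(2) from_nat_into[OF ne, of i]] by (auto simp: image_iff Bex_def)
  then have "\<forall>i. \<exists>c. c \<in> charts M \<and> cdom c = from_nat_into \<V> i" by blast
  from choice[OF this] obtain c where c: "\<forall>i. c i \<in> charts M \<and> cdom (c i) = from_nat_into \<V> i" ..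
  have "(\<Union>i. cdom (c i)) = points M"
    using range_from_nat_into[OF ne V(1)] V(3) c by simp
  then show ?thesis using c by blast
qed

text \<open>\<open>rvol\<close> is a definite description, so existence and uniqueness both have to
  be shown. They rest on a countable decomposition into Borel pieces, each inside one chart.\<close>

lemma is_rvol_rvol:
  assumes "points M \<noteq> {}" shows "is_rvol M (rvol M)"
proof -
  obtain c :: "nat \<Rightarrow> ('a, 'n) chart" where c: "\<And>i. c i \<in> charts M" "(\<Union>i. cdom (c i)) = points M"
    using ex_countable_charts[OF assms] by blast
  define A where "A = disjointed (\<lambda>i. cdom (c i))"
  have A: "A i \<in> sets borelM" "A i \<subseteq> cdom (c i)" for i
    using sets.range_disjointed_sets[of "\<lambda>i. cdom (c i)" borelM] cdom_borelM[OF c(1)] disjointed_subset[of "\<lambda>i. cdom (c i)" i]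
    by (auto simp: A_def)
  have Adisj: "disjoint_family A" unfolding A_def by (rule disjoint_family_disjointed)
  have Aun: "(\<Union>i. A i) = points M" unfolding A_def using c(2) UN_disjointed_eq[of "\<lambda>i. cdom (c i)"] by simp
  define total where "total B = (\<Sum>i. chart_vol (c i) (B \<inter> A i))" for B
  \<comment> \<open>Each piece of B may be measured in the chart c' as well, and countable
    additivity in c' puts them together again.\<close>
  have total_chart: "total B = chart_vol c' B" if c': "c' \<in> charts M" and B: "B \<in> sets borelM" "B \<subseteq> cdom c'" for c' B
  proof -
    have BA: "B \<inter> A i \<in> sets borelM" "B \<inter> A i \<subseteq> cdom c'" "B \<inter> A i \<subseteq> cdom (c i)" for i
      using A B by (auto intro: sets.Int)
    have "total B = (\<Sum>i. chart_vol c' (B \<inter> A i))"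
      unfolding total_def by (rule suminf_cong) (rule chart_vol_consistent[OF c(1) c' BA(1,3,2)])
    also have "\<dots> = chart_vol c' (\<Union>i. B \<inter> A i)"
      by (rule chart_vol_suminf[OF c' BA(1,2), symmetric]) (use Adisj in \<open>auto simp: disjoint_family_on_def\<close>)
    also have "(\<Union>i. B \<inter> A i) = B" using Aun borelM_subset[OF B(1)] by blast
    finally show ?thesis .
  qed
  define \<mu> where "\<mu> = measure_of (points M) {U. openin (mtop M) U} total"
  have sets_\<mu>: "sets \<mu> = sets borelM" unfolding \<mu>_def sets_borelM by (rule sets_measure_of[OF opens_Pow])
  have emeasure_\<mu>: "emeasure \<mu> B = total B" if "B \<in> sets borelM" for B
  proof (rule emeasure_measure_of[OF \<mu>_def opens_Pow])
    show "positive (sets \<mu>) total" by (simp add: positive_def total_def chart_vol_def)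
    show "countably_additive (sets \<mu>) total"
    proof (rule countably_additiveI)
      fix F :: "nat \<Rightarrow> 'a set" assume F: "range F \<subseteq> sets \<mu>" "disjoint_family F"
      have "F j \<in> sets borelM" for j using F(1) sets_\<mu> by auto
      then have FA: "F j \<inter> A i \<in> sets borelM" "F j \<inter> A i \<subseteq> cdom (c i)" for i j
        using A[of i] by (auto intro: sets.Int)
      have "total (\<Union>j. F j) = (\<Sum>i. \<Sum>j. chart_vol (c i) (F j \<inter> A i))"
        unfolding total_def
      proof (rule suminf_cong)
        fix i
        have "(\<Union>j. F j) \<inter> A i = (\<Union>j. F j \<inter> A i)" by blast
        moreover have "disjoint_family (\<lambda>j. F j \<inter> A i)"
          using F(2) unfolding disjoint_family_on_def by blast
        ultimately show "chart_vol (c i) ((\<Union>j. F j) \<inter> A i) = (\<Sum>j. chart_vol (c i) (F j \<inter> A i))"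
          using chart_vol_suminf[where c = "c i" and B = "\<lambda>j. F j \<inter> A i", OF c(1) FA] by (simp only:)
      qed
      then show "(\<Sum>j. total (F j)) = total (\<Union>j. F j)"
        using ennreal_suminf_swap[of "\<lambda>j i. chart_vol (c i) (F j \<inter> A i)"] unfolding total_def by (simp only:)
    qed
    show "B \<in> sets \<mu>" using that sets_\<mu> by simp
  qed
  have "is_rvol M \<mu>" unfolding is_rvol_def
  proof (intro conjI ballI impI)
    show "sets \<mu> = sigma_sets (points M) {U. openin (mtop M) U}" using sets_\<mu> sets_borelM by simp
    fix c' B assume "c' \<in> charts M" "B \<in> sets \<mu>" "B \<subseteq> cdom c'"
    then show "emeasure \<mu> B = (\<integral>\<^sup>+ y \<in> snd c' ` B. ennreal (sqrt (det (gram M c' (chart_inv c' y)))) \<partial>lborel)"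
      using emeasure_\<mu>[of B] total_chart[of c' B] chart_vol_eq[of B c'] sets_\<mu> by simp
  qed
  \<comment> \<open>A competing measure is prescribed on every piece by the chart containing it,
    hence on all Borel sets.\<close>
  moreover have "\<nu> = \<mu>" if \<nu>: "is_rvol M \<nu>" for \<nu>
  proof (rule measure_eqI)
    show sets_\<nu>: "sets \<nu> = sets \<mu>" using \<nu> sets_\<mu> sets_borelM by (simp add: is_rvol_def)
    fix B assume "B \<in> sets \<nu>"
    then have B: "B \<in> sets borelM" using sets_\<nu> sets_\<mu> by simp
    have BA: "B \<inter> A i \<in> sets borelM" "B \<inter> A i \<subseteq> cdom (c i)" for i
      using A B by (auto intro: sets.Int)
    have "(\<Union>i. B \<inter> A i) = B" using Aun borelM_subset[OF B] by blast
    then have "emeasure \<nu> B = emeasure \<nu> (\<Union>i. B \<inter> A i)" by simp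
    also have "\<dots> = (\<Sum>i. emeasure \<nu> (B \<inter> A i))"
    proof (rule suminf_emeasure[symmetric])
      show "disjoint_family (\<lambda>i. B \<inter> A i)" using Adisj unfolding disjoint_family_on_def by blast
    qed (use BA(1) sets_\<nu> sets_\<mu> in auto)
    also have "\<dots> = (\<Sum>i. chart_vol (c i) (B \<inter> A i))"
    proof (rule suminf_cong)
      fix i
      have "B \<inter> A i \<in> sets \<nu>" using BA(1) sets_\<nu> sets_\<mu> by simp
      then show "emeasure \<nu> (B \<inter> A i) = chart_vol (c i) (B \<inter> A i)"
        using \<nu> c(1)[of i] BA(2)[of i] chart_vol_eq[OF BA(2)] unfolding is_rvol_def by auto
    qed
    finally show "emeasure \<nu> B = emeasure \<mu> B" using emeasure_\<mu>[OF B] by (simp add: total_def)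
  qed
  ultimately show ?thesis unfolding rvol_def by (rule theI)
qed

lemma sets_rvol: "points M \<noteq> {} \<Longrightarrow> sets (rvol M) = sets borelM"
  using is_rvol_rvol by (simp add: is_rvol_def sets_borelM)

lemma emeasure_rvol_chart:
  assumes c: "c \<in> charts M" and B: "B \<in> sets borelM" "B \<subseteq> cdom c" and ne: "points M \<noteq> {}"
  shows "emeasure (rvol M) B = chart_vol c B"
  using is_rvol_rvol[OF ne] c B chart_vol_eq[OF B(2)] unfolding is_rvol_def sets_borelM by auto

end

section \<open>Volume of balls and asymptotic dimension\<close>

context riemannian
begin

lemma ball_preimage_volume:
  fixes f :: "'a \<Rightarrow> real ^ 'n"
  assumes x: "x \<in> points M" and b: "0 < b"
    and f: "bilipschitz b (rball M x a) (rdist M) (ball z 1) dist f"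
    and p: "p \<in> rball M x a"
  shows "\<exists>s0>0. \<forall>s. 0 < s \<and> s < s0 \<longrightarrow> (\<exists>E\<in>sets borelM. E \<subseteq> rball M x a \<and> f ` E \<subseteq> ball (f p) s \<and>
    ennreal (1 / 2 * (1 / (2 * b)) ^ CARD('n)) * emeasure lborel (ball (f p) s) \<le> emeasure (rvol M) E)"
proof -
  have pM: "p \<in> points M" "rdist M x p < a" using p by (auto simp: open_ball_def)
  then obtain c where c: "c \<in> charts M" "p \<in> cdom c" using chart_at by blast
  obtain \<rho> where \<rho>: "0 < \<rho>" "ball (snd c p) \<rho> \<subseteq> cimg c"
    and quad: "\<And>z v. z \<in> ball (snd c p) \<rho> \<Longrightarrow> v \<bullet> (gram M c (chart_inv c z) *v v) \<le> 4 * (v \<bullet> (gram M c p *v v))"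
    and dens: "\<And>z. z \<in> ball (snd c p) \<rho> \<Longrightarrow> det (gram M c p) / 4 \<le> det (gram M c (chart_inv c z))"
    by (rule chart_nbhd[OF c]) (rule that; blast)
  let ?G = "gram M c p"
  have "\<exists>V :: real ^ 'n ^ 'n. transpose V ** ?G ** V = mat 1"
    by (rule posdef_orthonormal_matrix[OF gram_symmetric[OF c]]) (rule gram_pos[OF c], assumption, blast)
  then obtain V :: "real ^ 'n ^ 'n" where V: "transpose V ** ?G ** V = mat 1" by blast
  have detV: "\<bar>det V\<bar> * sqrt (det ?G) = 1" by (rule posdef_det(2)[OF V])
  define W where "W = transpose V ** ?G"
  have WV: "W ** V = mat 1" using V by (simp add: W_def)
  then have VW: "V ** W = mat 1" by (rule matrix_left_right_inverse[THEN iffD1])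
  define Ell where "Ell t = (\<lambda>w. snd c p + V *v w) ` ball 0 t" for t
  \<comment> \<open>The first bound keeps E in the ball around x, the second keeps the ellipsoid in
    the coordinate ball of radius \<rho>; the summand 1 makes the denominator positive.\<close>
  define s0 where "s0 = min (b * (a - rdist M x p)) (\<rho> / (real CARD('n) * real CARD('n) * norm V + 1) * b)"
  have N0: "0 < real CARD('n) * real CARD('n) * norm V + 1" by (intro add_nonneg_pos) auto
  have s0: "0 < s0" unfolding s0_def using b pM \<rho>(1) N0 by (simp add: min_def)
  have "\<exists>E\<in>sets borelM. E \<subseteq> rball M x a \<and> f ` E \<subseteq> ball (f p) s \<and>
    ennreal (1 / 2 * (1 / (2 * b)) ^ CARD('n)) * emeasure lborel (ball (f p) s) \<le> emeasure (rvol M) E"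
    if s: "0 < s" "s < s0" for s
  proof -
    \<comment> \<open>One factor 2 pays for the variation of the metric in the chart, the factor b
      for the expansion by f.\<close>
    define t where "t = s / (2 * b)"
    have t: "0 < t" using s b by (simp add: t_def)
    have sub: "Ell t \<subseteq> ball (snd c p) \<rho>"
    proof
      fix y assume "y \<in> Ell t"
      then obtain w where w: "norm w < t" "y = snd c p + V *v w" by (auto simp: Ell_def)
      have "norm (V *v w) \<le> real CARD('n) * real CARD('n) * norm V * norm w" by (rule norm_matrix_vector_le)
      also have "\<dots> \<le> (real CARD('n) * real CARD('n) * norm V + 1) * t"
        using w(1) by (intro mult_mono) auto
      also have "\<dots> < \<rho>"
      proof -
        have "s < \<rho> / (real CARD('n) * real CARD('n) * norm V + 1) * b" using s(2) by (simp add: s0_def)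
        then have "t < \<rho> / (real CARD('n) * real CARD('n) * norm V + 1)"
        proof -
          assume "s < \<rho> / (real CARD('n) * real CARD('n) * norm V + 1) * b"
          then have "s / b < \<rho> / (real CARD('n) * real CARD('n) * norm V + 1)"
            by (simp only: pos_divide_less_eq[OF b])
          moreover have "t \<le> s / b" using b s(1) by (simp add: t_def field_simps)
          ultimately show ?thesis by linarith
        qed
        then show ?thesis using N0 by (simp add: pos_less_divide_eq mult.commute)
      qed
      finally show "y \<in> ball (snd c p) \<rho>" using w(2) by (simp add: dist_norm)
    qed
    define E where "E = {q \<in> cdom c. snd c q \<in> Ell t}"
    have Ell_borel: "Ell t \<in> sets borel" unfolding Ell_def by (rule emeasure_matrix_image_ball(1)[OF VW WV])
    have Ell_open: "open (Ell t)"
    proof -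
      have "Ell t = (\<lambda>y. W *v (y - snd c p)) -` ball 0 t"
      proof (intro set_eqI iffI)
        fix y assume "y \<in> (\<lambda>y. W *v (y - snd c p)) -` ball 0 t"
        moreover have "y = snd c p + V *v (W *v (y - snd c p))" by (simp add: matrix_vector_mul_assoc VW)
        ultimately show "y \<in> Ell t" unfolding Ell_def by blast
      qed (auto simp: Ell_def matrix_vector_mul_assoc WV)
      moreover have "continuous_on UNIV (\<lambda>y. W *v (y - snd c p))"
        by (intro continuous_on_compose2[OF linear_continuous_on[OF matrix_vector_mul_bounded_linear], of UNIV]) (auto intro: continuous_intros)
      ultimately show ?thesis using open_vimage[OF open_ball] by metis
    qed
    have E: "E \<in> sets borelM" "E \<subseteq> cdom c"
      unfolding E_def using chart_preimage_openin[OF c(1) Ell_open] openin_borelM by blast+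
    have img_E: "snd c ` E = Ell t"
    proof
      show "Ell t \<subseteq> snd c ` E"
      proof
        fix y assume y: "y \<in> Ell t"
        then have "y \<in> cimg c" using sub \<rho>(2) by blast
        then show "y \<in> snd c ` E" using y by (auto simp: E_def)
      qed
    qed (auto simp: E_def)
    have near: "rdist M p q < s / b" if q: "q \<in> E" for q
    proof -
      obtain w where w: "norm w < t" "snd c q = snd c p + V *v w" using q by (auto simp: E_def Ell_def)
      have qc: "q \<in> cdom c" "snd c q \<in> ball (snd c p) \<rho>" using q sub by (auto simp: E_def)
      have "(V *v w) \<bullet> (?G *v (V *v w)) = w \<bullet> ((transpose V ** ?G ** V) *v w)"
        by (metis dot_lmul_matrix matrix_vector_mul_assoc transpose_matrix_vector transpose_transpose)
      then have Gw: "(V *v w) \<bullet> (?G *v (V *v w)) = (norm w)\<^sup>2" by (simp add: V power2_norm_eq_inner)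
      have "\<exists>\<gamma>. piecewise_C1_curve M \<gamma> \<and> \<gamma> 0 = chart_inv c (snd c p) \<and> \<gamma> 1 = chart_inv c (snd c q) \<and>
          curve_length M \<gamma> \<le> 2 * norm w"
      proof (rule segment_curve[OF c(1) convex_ball \<rho>(2) _ qc(2)])
        fix z' assume "z' \<in> ball (snd c p) \<rho>"
        from quad[OF this, of "V *v w"]
        show "(snd c q - snd c p) \<bullet> (gram M c (chart_inv c z') *v (snd c q - snd c p)) \<le> (2 * norm w)\<^sup>2"
          by (simp add: w(2) Gw power_mult_distrib)
      qed (use \<rho>(1) in auto)
      then obtain \<gamma> where "piecewise_C1_curve M \<gamma>" "\<gamma> 0 = p" "\<gamma> 1 = q" "curve_length M \<gamma> \<le> 2 * norm w"
        using c qc by auto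
      then have "rdist M p q \<le> 2 * norm w" using rdist_le[of \<gamma> p q] by linarith
      also have "\<dots> < s / b" using w(1) b by (simp add: t_def field_simps)
      finally show ?thesis .
    qed
    have Erball: "E \<subseteq> rball M x a"
    proof
      fix q assume q: "q \<in> E"
      then have qM: "q \<in> points M" using E(2) dom_subset[OF c(1)] by blast
      have "s < b * (a - rdist M x p)" using s(2) by (simp add: s0_def)
      then have "s / b < a - rdist M x p" using b by (simp add: pos_divide_less_eq mult.commute)
      then show "q \<in> rball M x a"
        using near[OF q] pm.tri[OF x pM(1) qM] qM by (simp add: open_ball_def)
    qed
    have fE: "f ` E \<subseteq> ball (f p) s"
    proof
      fix u assume "u \<in> f ` E"
      then obtain q where q: "q \<in> E" "u = f q" by blast
      have "dist (f p) (f q) \<le> b * rdist M p q"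
        using f p Erball q(1) unfolding bilipschitz_def by blast
      also have "\<dots> < s" using near[OF q(1)] b by (simp add: pos_less_divide_eq mult.commute)
      finally show "u \<in> ball (f p) s" using q(2) by simp
    qed
    \<comment> \<open>The chain passes from the ball of radius s to the one of radius t by scaling,
      to the ellipsoid by |det V| \<open>sqrt (det G)\<close> = 1, and to the true density by its
      lower bound.\<close>
    have "ennreal (1 / 2 * (1 / (2 * b)) ^ CARD('n)) * emeasure lborel (ball (f p) s)
        = ennreal (1 / 2) * emeasure lborel (ball (0 :: real ^ 'n) t)"
    proof -
      let ?u = "unit_ball_vol (real CARD('n))"
      have "(1 / 2 * (1 / (2 * b)) ^ CARD('n)) * (?u * s ^ CARD('n)) = 1 / 2 * (?u * t ^ CARD('n))"
        by (simp add: t_def power_divide)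
      then have "ennreal (1 / 2 * (1 / (2 * b)) ^ CARD('n)) * ennreal (?u * s ^ CARD('n)) = ennreal (1 / 2) * ennreal (?u * t ^ CARD('n))"
        using ennreal_mult'[of "1 / 2 * (1 / (2 * b)) ^ CARD('n)" "?u * s ^ CARD('n)"]
          ennreal_mult'[of "1 / 2" "?u * t ^ CARD('n)"] b by (simp only: less_imp_le) simp
      then show ?thesis using s t by (simp only: emeasure_ball less_imp_le DIM_cart DIM_real mult_1_right)
    qed
    also have "\<dots> = ennreal (1 / 2 * sqrt (det ?G)) * emeasure lborel (Ell t)"
    proof -
      have "emeasure lborel (Ell t) = ennreal \<bar>det V\<bar> * emeasure lborel (ball (0 :: real ^ 'n) t)"
        unfolding Ell_def by (rule emeasure_matrix_image_ball(2)[OF VW WV])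
      moreover have "ennreal (1 / 2 * sqrt (det ?G)) * ennreal \<bar>det V\<bar> = ennreal (1 / 2)"
        using detV det_gram_pos[OF c] by (simp add: ennreal_mult'[symmetric] mult.commute)
      ultimately show ?thesis by (metis mult.assoc)
    qed
    also have "\<dots> = (\<integral>\<^sup>+ y \<in> Ell t. ennreal (1 / 2 * sqrt (det ?G)) \<partial>lborel)"
      using Ell_borel by (simp add: nn_integral_cmult_indicator)
    also have "\<dots> \<le> (\<integral>\<^sup>+ y \<in> Ell t. ennreal (vdens c y) \<partial>lborel)"
    proof (rule nn_integral_mono)
      fix y
      show "ennreal (1 / 2 * sqrt (det ?G)) * indicator (Ell t) y \<le> ennreal (vdens c y) * indicator (Ell t) y"
      proof (cases "y \<in> Ell t")
        case True
        then have y: "y \<in> ball (snd c p) \<rho>" using sub by blast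
        have "1 / 2 * sqrt (det ?G) = sqrt (det ?G / 4)" by (simp add: real_sqrt_divide)
        also have "\<dots> \<le> sqrt (det (gram M c (chart_inv c y)))" by (rule real_sqrt_le_mono[OF dens[OF y]])
        also have "\<dots> = vdens c y" using y \<rho>(2) by (auto simp: vdens_def)
        finally show ?thesis using True by (simp add: ennreal_leI)
      qed simp
    qed
    also have "\<dots> = chart_vol c E" by (simp add: chart_vol_def img_E)
    also have "\<dots> = emeasure (rvol M) E"
      by (rule emeasure_rvol_chart[OF c(1) E, symmetric]) (use x in blast)
    finally show ?thesis using E(1) Erball fE by blast
  qed
  then show ?thesis using s0 by blast
qed

text \<open>By Vitali's theorem almost all of the target ball is filled by disjoint small balls, whose
  preimages have at least a fixed fraction of their volume.\<close>

lemma rball_volume_ge: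
  fixes f :: "'a \<Rightarrow> real ^ 'n"
  assumes x: "x \<in> points M" and b: "0 < b"
    and f: "bilipschitz b (rball M x a) (rdist M) (ball z 1) dist f"
  shows "ennreal (1 / 2 * (1 / (2 * b)) ^ CARD('n)) * emeasure lborel (ball (0 :: real ^ 'n) 1) \<le> emeasure (rvol M) (rball M x a)"
proof -
  let ?\<theta> = "ennreal (1 / 2 * (1 / (2 * b)) ^ CARD('n))"
  define good where "good u s \<longleftrightarrow> 0 < s \<and> (\<exists>E\<in>sets borelM. E \<subseteq> rball M x a \<and> f ` E \<subseteq> ball u s \<and>
    ?\<theta> * emeasure lborel (ball u s) \<le> emeasure (rvol M) E)" for u :: "real ^ 'n" and s :: real
  have ex_good: "\<exists>s0>0. \<forall>s. 0 < s \<and> s < s0 \<longrightarrow> good u s" if "u \<in> ball z 1" for u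
  proof -
    have "u \<in> f ` rball M x a" using f that by (simp add: bilipschitz_def)
    then obtain p where "p \<in> rball M x a" "u = f p" by blast
    then show ?thesis using ball_preimage_volume[OF x b f] unfolding good_def by simp
  qed
  \<comment> \<open>Pairs of centre and radius. Every point of the target is the centre of
    arbitrarily small good balls, so K is a fine cover in the sense of Vitali.\<close>
  define K where "K = {i. good (fst i) (snd i)}"
  have K: "\<exists>i. i \<in> K \<and> u \<in> ball (fst i) (snd i) \<and> snd i < d" if "u \<in> ball z 1" "0 < d" for u d
  proof -
    obtain s0 where "0 < s0" "\<forall>s. 0 < s \<and> s < s0 \<longrightarrow> good u s" using ex_good[OF \<open>u \<in> ball z 1\<close>] by blast
    then have "good u (min s0 d / 2)" using \<open>0 < d\<close> by auto
    then show ?thesis using \<open>0 < d\<close> \<open>0 < s0\<close> by (intro exI[of _ "(u, min s0 d / 2)"]) (auto simp: K_def)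
  qed
  obtain C where C: "countable C" "C \<subseteq> K"
    and disj: "pairwise (\<lambda>i j. disjnt (ball (fst i) (snd i)) (ball (fst j) (snd j))) C"
    and neg: "negligible (ball z 1 - (\<Union>i\<in>C. ball (fst i) (snd i)))"
    by (rule Vitali_covering_theorem_balls[OF K])
  let ?B = "\<lambda>i. ball (fst i) (snd i)"
  have "\<forall>i\<in>C. \<exists>E. E \<in> sets borelM \<and> E \<subseteq> rball M x a \<and> f ` E \<subseteq> ?B i \<and> ?\<theta> * emeasure lborel (?B i) \<le> emeasure (rvol M) E"
  proof
    fix i assume "i \<in> C"
    then have "good (fst i) (snd i)" using C(2) by (simp add: K_def subset_iff)
    then show "\<exists>E. E \<in> sets borelM \<and> E \<subseteq> rball M x a \<and> f ` E \<subseteq> ?B i \<and> ?\<theta> * emeasure lborel (?B i) \<le> emeasure (rvol M) E"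
      unfolding good_def by blast
  qed
  from bchoice[OF this] obtain E where
    E: "\<forall>i\<in>C. E i \<in> sets borelM \<and> E i \<subseteq> rball M x a \<and> f ` E i \<subseteq> ?B i \<and> ?\<theta> * emeasure lborel (?B i) \<le> emeasure (rvol M) (E i)" ..
  have ne: "points M \<noteq> {}" using x by blast
  have disjB: "disjoint_family_on ?B C"
    using disj unfolding pairwise_def disjnt_def disjoint_family_on_def by blast
  \<comment> \<open>A common point would have its image under f in two disjoint balls.\<close>
  have disjE: "disjoint_family_on E C"
    unfolding disjoint_family_on_def
  proof (intro ballI impI)
    fix i j assume ij: "i \<in> C" "j \<in> C" "i \<noteq> j"
    then have "?B i \<inter> ?B j = {}" using disjB by (simp add: disjoint_family_on_def)
    moreover have "f ` E i \<subseteq> ?B i" "f ` E j \<subseteq> ?B j" using E ij by blast+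
    ultimately show "E i \<inter> E j = {}" by blast
  qed
  have "emeasure lborel (ball z 1) \<le> emeasure lborel (\<Union>i\<in>C. ?B i)"
  proof -
    let ?U = "\<Union>i\<in>C. ?B i"
    have U: "open ?U" by blast
    \<comment> \<open>Negligibility refers to the completed measure; a difference of open sets is
      Borel, so the set is null for \<open>lborel\<close> as well.\<close>
    have "ball z 1 - ?U \<in> null_sets lborel"
      using neg U by (subst null_sets_completion_iff[symmetric]) (auto simp: negligible_iff_null_sets)
    then have "emeasure lborel (ball z 1 - ?U) = 0" by blast
    moreover have "emeasure lborel (ball z 1) \<le> emeasure lborel (?U \<union> (ball z 1 - ?U))"
      using U by (intro emeasure_mono) auto
    moreover have "\<dots> \<le> emeasure lborel ?U + emeasure lborel (ball z 1 - ?U)"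
      using U by (intro emeasure_subadditive) auto
    ultimately show ?thesis by simp
  qed
  then have "?\<theta> * emeasure lborel (ball z 1) \<le> ?\<theta> * emeasure lborel (\<Union>i\<in>C. ?B i)"
    by (rule mult_left_mono) simp
  also have "\<dots> = ?\<theta> * (\<integral>\<^sup>+i. emeasure lborel (?B i) \<partial>count_space C)"
    using disjB C(1) by (subst emeasure_UN_countable) auto
  also have "\<dots> = (\<integral>\<^sup>+i. ?\<theta> * emeasure lborel (?B i) \<partial>count_space C)"
    by (rule nn_integral_cmult[symmetric]) simp
  also have "\<dots> \<le> (\<integral>\<^sup>+i. emeasure (rvol M) (E i) \<partial>count_space C)"
    by (rule nn_integral_mono) (use E in auto)
  also have "\<dots> = emeasure (rvol M) (\<Union>i\<in>C. E i)"
    by (rule emeasure_UN_countable[symmetric, OF _ C(1) disjE]) (use E sets_rvol[OF ne] in auto)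
  also have "\<dots> \<le> emeasure (rvol M) (rball M x a)"
    by (rule emeasure_mono) (use E sets_rvol[OF ne] openin_borelM[OF openin_rball[OF x]] in auto)
  finally show ?thesis by (simp add: emeasure_ball)
qed

end

theorem corollary3p3:
  fixes M :: "('a, 'n::finite) riemannian" and k :: nat
  assumes "riemannian_manifold M"
    and "bounded_geometry M"
    and "((\<lambda>r::real. volume_growth M r / ennreal (r ^ (k + 1))) \<longlongrightarrow> 0) at_top"
  shows "asdim (points M) (rdist M) \<le> enat k"
proof (cases "points M = {}")
  case True
  then show ?thesis by (simp add: asdim_le_iff asdim_at_most_empty)
next
  case False
  interpret riemannian M by unfold_locales (rule assms(1))
  obtain a b where a: "0 < a" and b: "1 < b"
    and f: "\<forall>x\<in>points M. \<exists>f :: 'a \<Rightarrow> real ^ 'n. \<exists>z. bilipschitz b (rball M x a) (rdist M) (ball z 1) dist f"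
    using assms(2) unfolding bounded_geometry_def by (elim exE conjE)
  \<comment> \<open>The lower bound for the volume of all balls of radius a; it depends on b and the
    dimension only.\<close>
  define v where "v = 1 / 2 * (1 / (2 * b)) ^ CARD('n) * measure lborel (ball (0 :: real ^ 'n) 1)"
  have v: "0 < v" using b content_ball_pos[of 1 "0 :: real ^ 'n"] by (simp add: v_def)
  have vol: "ennreal v \<le> emeasure (rvol M) (rball M x a)" if x: "x \<in> points M" for x
  proof -
    obtain f :: "'a \<Rightarrow> real ^ 'n" and z where "bilipschitz b (rball M x a) (rdist M) (ball z 1) dist f"
      using f x by blast
    from rball_volume_ge[OF x _ this] b
    have "ennreal (1 / 2 * (1 / (2 * b)) ^ CARD('n)) * emeasure lborel (ball (0 :: real ^ 'n) 1)
        \<le> emeasure (rvol M) (rball M x a)" by simp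
    moreover have "emeasure lborel (ball (0 :: real ^ 'n) 1) = ennreal (measure lborel (ball (0 :: real ^ 'n) 1))"
      by (rule emeasure_eq_ennreal_measure) (simp add: emeasure_ball)
    ultimately show ?thesis
      unfolding v_def using b by (subst ennreal_mult') simp_all
  qed
  \<comment> \<open>Separation 2a makes the balls of radius a around net points disjoint, so that
    volume counts net points.\<close>
  obtain N where N: "N \<subseteq> points M" "\<forall>x\<in>N. \<forall>y\<in>N. x \<noteq> y \<longrightarrow> 2 * a \<le> rdist M x y"
    and net: "\<forall>x\<in>points M. \<exists>p\<in>N. rdist M x p \<le> 2 * a"
    using pm.ex_maximal_separated[of "2 * a"] a by auto
  have disj: "disjoint_family_on (\<lambda>p. rball M p a) N"
    unfolding disjoint_family_on_def
  proof (intro ballI impI)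
    fix p q assume pq: "p \<in> N" "q \<in> N" "p \<noteq> q"
    have False if y: "y \<in> points M" "rdist M p y < a" "rdist M q y < a" for y
    proof -
      have "2 * a \<le> rdist M p q" using N(2) pq by blast
      moreover have "p \<in> points M" "q \<in> points M" using N(1) pq by auto
      ultimately show False using pm.tri[of p y q] pm.sym[of y q] y by linarith
    qed
    then show "rball M p a \<inter> rball M q a = {}" by (auto simp: open_ball_def)
  qed
  \<comment> \<open>Stated for finite subsets: a bound on \<open>card\<close> of the whole ball
    would be empty before the ball is known to be finite.\<close>
  have card_bound: "ennreal (real (card F) * v) \<le> volume_growth M (r + a)"
    if p: "p \<in> N" and F: "F \<subseteq> {q \<in> N. rdist M p q \<le> r}" "finite F" for p F r
  proof -
    have pM: "p \<in> points M" using p N by blast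
    have FM: "q \<in> points M" if "q \<in> F" for q using that F N by blast
    have rball_sets: "rball M q t \<in> sets (rvol M)" if "q \<in> points M" for q t
      using openin_borelM[OF openin_rball[OF that]] sets_rvol[OF False] by simp
    have "ennreal (real (card F) * v) = (\<Sum>q\<in>F. ennreal v)"
      using v by (simp add: ennreal_mult ennreal_of_nat_eq_real_of_nat)
    also have "\<dots> \<le> (\<Sum>q\<in>F. emeasure (rvol M) (rball M q a))" by (intro sum_mono vol FM)
    also have "\<dots> = emeasure (rvol M) (\<Union>q\<in>F. rball M q a)"
    proof (rule sum_emeasure[OF _ _ F(2)])
      show "disjoint_family_on (\<lambda>q. rball M q a) F" using disj F(1) unfolding disjoint_family_on_def by blast
    qed (use FM rball_sets in blast)
    also have "\<dots> \<le> emeasure (rvol M) (rball M p (r + a))"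
    proof (rule emeasure_mono[OF _ rball_sets[OF pM]])
      show "(\<Union>q\<in>F. rball M q a) \<subseteq> rball M p (r + a)"
      proof
        fix y assume "y \<in> (\<Union>q\<in>F. rball M q a)"
        then obtain q where q: "q \<in> F" "y \<in> points M" "rdist M q y < a" by (auto simp: open_ball_def)
        then have "rdist M p q \<le> r" using F(1) by blast
        then show "y \<in> rball M p (r + a)"
          using pm.tri[OF pM FM[OF q(1)] q(2)] q by (simp add: open_ball_def)
      qed
    qed
    also have "\<dots> \<le> volume_growth M (r + a)" unfolding volume_growth_def by (rule SUP_upper[OF pM])
    finally show ?thesis .
  qed
  have growth: "\<exists>r\<ge>\<rho>. pm.thin r (\<epsilon> * r ^ (k + 1)) N" if \<epsilon>: "0 < \<epsilon>" for \<epsilon> \<rho>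
  proof -
    \<comment> \<open>The volume bound is read at radius r + a, where r + a \<le> 2r as soon as a
      \<le> r; the power of 2 is compensated here and v turns volume into a number of
      points.\<close>
    define \<delta> where "\<delta> = \<epsilon> * v / 2 ^ (k + 1)"
    have \<delta>: "0 < \<delta>" using \<epsilon> v by (simp add: \<delta>_def)
    have "eventually (\<lambda>R. volume_growth M R / ennreal (R ^ (k + 1)) < ennreal \<delta>) at_top"
      using assms(3) by (rule order_tendstoD) (use \<delta> in simp)
    then obtain R0 where R0: "\<And>R. R0 \<le> R \<Longrightarrow> volume_growth M R / ennreal (R ^ (k + 1)) < ennreal \<delta>"
      unfolding eventually_at_top_linorder by auto
    define r where "r = max \<rho> (max R0 a)"
    have r: "\<rho> \<le> r" "R0 \<le> r + a" "a \<le> r" "0 < r" using a by (auto simp: r_def)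
    have "volume_growth M (r + a) < ennreal \<delta> * ennreal ((r + a) ^ (k + 1))"
      using R0[OF r(2)] r a by (subst (asm) divide_less_ennreal) auto
    then have vg: "volume_growth M (r + a) < ennreal (\<delta> * (r + a) ^ (k + 1))"
      using \<delta> r a by (simp add: ennreal_mult)
    have "\<delta> * (r + a) ^ (k + 1) \<le> \<delta> * (2 * r) ^ (k + 1)"
      using \<delta> r a by (intro mult_left_mono power_mono) auto
    also have "\<dots> = \<epsilon> * r ^ (k + 1) * v" by (simp add: \<delta>_def power_mult_distrib)
    finally have le: "\<delta> * (r + a) ^ (k + 1) \<le> \<epsilon> * r ^ (k + 1) * v" .
    have card: "real (card F) \<le> \<epsilon> * r ^ (k + 1)"
      if "p \<in> N" "F \<subseteq> {q \<in> N. rdist M p q \<le> r}" "finite F" for p F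
    proof -
      have "ennreal (real (card F) * v) < ennreal (\<delta> * (r + a) ^ (k + 1))"
        using card_bound[OF that] vg by (rule le_less_trans)
      then have "real (card F) * v < \<delta> * (r + a) ^ (k + 1)"
        using v by (subst (asm) ennreal_less_iff) auto
      then have "real (card F) * v \<le> \<epsilon> * r ^ (k + 1) * v" using le by linarith
      then show ?thesis using v by (simp only: mult_le_cancel_right_pos)
    qed
    have "pm.thin r (\<epsilon> * r ^ (k + 1)) N" unfolding pm.thin_def
    proof (intro conjI ballI N(1))
      fix p assume p: "p \<in> N"
      \<comment> \<open>A common bound on the cardinality of all finite subsets makes the set
        finite.\<close>
      show fin: "finite {q \<in> N. rdist M p q \<le> r}"
      proof (rule conjunct1[OF finite_if_finite_subsets_card_bdd])
        fix G assume "G \<subseteq> {q \<in> N. rdist M p q \<le> r}" "finite G"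
        from card[OF p this] show "card G \<le> nat \<lfloor>\<epsilon> * r ^ (k + 1)\<rfloor>" by (simp add: le_nat_floor)
      qed
      show "real (card {q \<in> N. rdist M p q \<le> r}) \<le> \<epsilon> * r ^ (k + 1)" by (rule card[OF p order.refl fin])
    qed
    then show ?thesis using r(1) by blast
  qed
  have "asdim_at_most (points M) (rdist M) k"
    by (rule pm.asdim_at_most_of_net_growth[OF N(1), of "2 * a"]) (use a net growth in auto)
  then show ?thesis by (simp add: asdim_le_iff)
qed

end
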